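(* Let $\mathcal X$ be a quantum set. The one-to-one correspondence between quantum preorders $V$ on $\ell^\infty(\mathcal X)$ and binary relations $R$ on $\mathcal X$ satisfying (1) $[\![(\forall (x = x_* ) \in \mathcal X \times \mathcal X^* )\, \widehat R(x, x_* ) ]\!] = \top$, (2) $[\![(\forall (x_1 = x_{1*}) \in \mathcal X \times \mathcal X^* )\, (\forall (x_2 = x_{2*}) \in \mathcal X \times \mathcal X^* )\, (\forall (x_3 = x_{3*}) \in \mathcal X \times \mathcal X^* )\,((\widehat R(x_1, x_{2*}) \wedge \widehat R(x_2, x_{3*})) \to (\widehat R)_*(x_{1*}, x_3))]\!] = \top$, given by $R(X_1, X_2) = \mathrm{inc}_{X_2}^\dagger \cdot V \cdot \mathrm{inc}_{X_1}$ for $X_1, X_2 \in \mathrm{At}(\mathcal X)$, restricts to a one-to-one correspondence between quantum partial orders $V$ on $\ell^\infty(\mathcal X)$ and binary relations $R$ on $\mathcal X$ satisfying (1) and (2) as well as (3) $[\![(\forall x_1 \in \mathcal X)\, (\forall x_{2*} \in \mathcal X^* )\, ((\widehat R(x_1, x_{2*}) \wedge (\widehat R)_*(x_{2*},x_1)) \to E_{\mathcal X}(x_1, x_{2*}))]\!] = \top$.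
   Context: Operators. Hilbert spaces are complex. $L(H,K)$ is the space of bounded operators $H\to K$, $L(H)=L(H,H)$, $H^*=L(H,\mathbb C)$. For $a\in L(H,K)$: $a^\dagger\in L(K,H)$ is the Hermitian adjoint, $a^*\in L(K^*,H^* )$ the transpose, $a_*=(a^\dagger)^*\in L(H^*,K^* )$. Products of subspaces of operators denote linear spans of products. The identifications $X^{**}=X$, $(X\otimes Y)^*=X^*\otimes Y^*$, $\mathbb C^*=\mathbb C$, $X\otimes\mathbb C=X$ are used. Quantum sets. A quantum set $\mathcal X$ is an object uniquely determined by a set $\mathrm{At}(\mathcal X)$ of nonzero finite-dimensional Hilbert spaces, its atoms. $\ell^\infty(\mathcal X)=\bigoplus_{X\in\mathrm{At}(\mathcal X)}L(X)$ is the $\ell^\infty$-direct sum von Neumann algebra, canonically represented on the $\ell^2$-direct sum $\bigoplus\mathrm{At}(\mathcal X)$; $\mathrm{inc}_X\in L(X,\bigoplus\mathrm{At}(\mathcal X))$ is the inclusion isometry. $\mathcal X\times\mathcal Y$ has atoms $X\otimes Y$; $\mathcal X^*$ has atoms $X^*$; $\mathbf 1$ (the empty product) has the single atom $\mathbb C$. Quantum orders. For a von Neumann algebra $M\subseteq L(H)$ with commutant $M'$, a quantum preorder on $M$ is an ultraweakly closed algebra $V\subseteq L(H)$ containing $M'$; it is a quantum partial order if moreover $V\cap V^\dagger= M'$, where $V^\dagger=\{v^\dagger:v\in V\}$. Binary relations. A binary relation $R$ from $\mathcal X$ to $\mathcal Y$ (on $\mathcal X$ if $\mathcal Y=\mathcal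 X$) is a choice of subspaces $R(X,Y)\le L(X,Y)$ for all atoms $X,Y$. Order, joins, meets and complement $\neg$ are componentwise (inclusion, span, intersection, orthogonal complement for $\langle a|b\rangle=\mathrm{Tr}(a^\dagger b)$); $\top$ and $\bot$ (or $\top_{\mathcal X}$, $\bot_{\mathcal X}$ for $\mathcal Y=\mathbf 1$) are the largest and smallest. $(S\circ R)(X,Z)=\sum_Y S(Y,Z)\cdot R(X,Y)$; $(R\times S)(X\otimes X',Y\otimes Y')=R(X,Y)\otimes S(X',Y')$; $R_*(X^*,Y^* )=\{r_*: r\in R(X,Y)\}$; $I_{\mathcal X}(X,X)=\mathbb C1_X$, with other components $0$. A relation of arity $(\mathcal X_1,\dots,\mathcal X_n)$ is a binary relation $R$ from $\mathcal X_1\times\cdots\times\mathcal X_n$ to $\mathbf 1$; write $R(X_1\otimes\cdots\otimes X_n)$ for $R(X_1\otimes\cdots\otimes X_n,\mathbb C)$; its conjugate $R_*$ has arity $(\mathcal X_1^*,\dots,\mathcal X_n^* )$. The equality relation $E_{\mathcal X}$ of arity $(\mathcal X,\mathcal X^* )$ has $E_{\mathcal X}(X\otimes X^* )=\mathbb C\epsilon_X$, with $\epsilon_X:X\otimes X^*\to\mathbb C$ evaluation, and $E_{\mathcal X}(X_1\otimes X_2^* )=0$ for $X_1\ne X_2$. For a binary relation $B$ from $\mathcal X$ to $\mathcal Y$, $\widehat B=E_{\mathcal Y}\circ(B\times I_{\mathcal Y^*})$, of arity $(\mathcal X,\mathcal Y^* )$; so $(\widehat B)_*$ has arity $(\mathcal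 X^*,\mathcal Y)$. Interpretation of formulas. Each quantum set is a sort with infinitely many variables. Formulas are built from atomic formulas $R(x_1,\dots,x_n)$ ($R$ a relation of arity $(\mathcal X_1,\dots,\mathcal X_n)$, $x_i$ distinct variables of sorts $\mathcal X_i$). For distinct variables $x_i$ of sorts $\mathcal X_i$ including the free variables of $\phi$, $[\![\phi]\!]=[\![(x_1,\dots,x_n)\in\mathcal X_1\times\cdots\times\mathcal X_n\,|\,\phi]\!]$ is a relation of arity $(\mathcal X_1,\dots,\mathcal X_n)$ (for a sentence, of arity $()$, so $\top$ or $\bot$), defined recursively. For a permutation $\pi$ of $\{1,\dots,n\}$, $m\le n$ and $R$ of arity $(\mathcal X_{\pi(1)},\dots,\mathcal X_{\pi(m)})$, $[\![R(x_{\pi(1)},\dots,x_{\pi(m)})]\!](X_1\otimes\cdots\otimes X_n)=(R\times\top_{\mathcal X_{\pi(m+1)}}\times\cdots\times\top_{\mathcal X_{\pi(n)}})(X_{\pi(1)}\otimes\cdots\otimes X_{\pi(n)})\cdot u_\pi$, where $u_\pi$ is the unitary permuting tensor factors. $[\![\neg\phi]\!]=\neg[\![\phi]\!]$; $[\![\phi\wedge\psi]\!]=[\![\phi]\!]\wedge[\![\psi]\!]$; $[\![(x_1,\dots,x_n)\,|\,(\forall x\in\mathcal X)\,\phi]\!]=\sup\{R \text{ of arity }(\mathcal X_1,\dots,\mathcal X_n): \top_{\mathcal X}\times R\le[\![(x,x_1,\dots,x_n)\,|\,\phi]\!]\}$. Abbreviations: $\phi\vee\psi$ is $\neg(\neg\phi\wedge\neg\psi)$;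 $\exists$ is $\neg\forall\neg$; $\phi\to\psi$ is $\neg\phi\vee(\phi\wedge\psi)$; $(\forall(x=x_* )\in\mathcal X\times\mathcal X^* )\,\phi$ is $(\forall x_*\in\mathcal X^* )(\forall x\in\mathcal X)(E_{\mathcal X}(x,x_* )\to\phi)$, where $x$ (sort $\mathcal X$) and $x_*$ (sort $\mathcal X^*$) are distinct variables. *)

theory Defs
  imports "HOL-Analysis.Analysis" "HOL-Library.Function_Algebras"
begin

section \<open>Complex vector spaces\<close>

class cvector = ab_group_add +
  fixes scaleC :: "complex \<Rightarrow> 'a \<Rightarrow> 'a"  (infixr "*C" 75)
  assumes scaleC_add_right: "c *C (x + y) = c *C x + c *C y"
    and scaleC_add_left: "(c + d) *C x = c *C x + d *C x"
    and scaleC_scaleC: "c *C d *C x = (c * d) *C x"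
    and scaleC_one: "1 *C x = x"

interpretation cvec: vector_space "scaleC :: complex \<Rightarrow> 'a::cvector \<Rightarrow> 'a"
  by unfold_locales (simp_all add: scaleC_add_right scaleC_add_left scaleC_scaleC scaleC_one)

instantiation complex :: cvector
begin
definition scaleC_complex_def: "c *C (z::complex) = c * z"
instance by standard (simp_all add: scaleC_complex_def algebra_simps)
end

instantiation "fun" :: (type, cvector) cvector
begin
definition scaleC_fun_def: "c *C f = (\<lambda>x. c *C f x)"
instance
  by standard
    (simp_all add: scaleC_fun_def fun_eq_iff scaleC_add_right scaleC_add_left scaleC_scaleC scaleC_one)
end

instantiation prod :: (cvector, cvector) cvector
begin
definition scaleC_prod_def: "c *C p = (c *C fst p, c *C snd p)"
instance
  by standard
    (simp_all add: scaleC_prod_def prod_eq_iff scaleC_add_right scaleC_add_left scaleC_scaleC scaleC_one)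
end

section \<open>Hilbert spaces and bounded operators\<close>

text \<open>
  A Hilbert space is a linear subspace of an ambient complex vector space together with an inner
  product of its own, linear in the second argument.  Only the values of the inner product on the
  carrier matter.
\<close>

record 'v hspace =
  carrier :: "'v set"
  ip :: "'v \<Rightarrow> 'v \<Rightarrow> complex"

definition hnorm :: "'v hspace \<Rightarrow> 'v \<Rightarrow> real" where
  "hnorm H x = sqrt (Re (ip H x x))"

text \<open>Completeness is automatic in finite dimension.\<close>

definition fd_hilbert :: "'v::cvector hspace \<Rightarrow> bool" where
  "fd_hilbert H \<longleftrightarrow>
     cvec.subspace (carrier H) \<and>
     (\<forall>x\<in>carrier H. \<forall>y\<in>carrier H. \<forall>z\<in>carrier H. ip H x (y + z) = ip H x y + ip H x z) \<and>
     (\<forall>x\<in>carrier H. \<forall>y\<in>carrier H. \<forall>c. ip H x (c *C y) = c * ip H x y) \<and>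
     (\<forall>x\<in>carrier H. \<forall>y\<in>carrier H. ip H y x = cnj (ip H x y)) \<and>
     (\<forall>x\<in>carrier H. x \<noteq> 0 \<longrightarrow> 0 < Re (ip H x x)) \<and>
     (\<exists>B. finite B \<and> cvec.span B = carrier H)"

definition onb :: "'v::cvector hspace \<Rightarrow> 'v set \<Rightarrow> bool" where
  "onb H B \<longleftrightarrow> finite B \<and> cvec.span B = carrier H \<and>
     (\<forall>x\<in>B. \<forall>y\<in>B. ip H x y = (if x = y then 1 else 0))"

definition some_onb :: "'v::cvector hspace \<Rightarrow> 'v set" where
  "some_onb H = (SOME B. onb H B)"

definition scalars :: "complex hspace" where
  "scalars = \<lparr>carrier = UNIV, ip = (\<lambda>z w. cnj z * w)\<rparr>"

text \<open>
  The bounded operators from \<open>H\<close> to \<open>K\<close>.  An operator is extended by \<open>0\<close> outside the carrier of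
  its domain, so that equality of operators is equality of functions.
\<close>

definition ops :: "'u::cvector hspace \<Rightarrow> 'w::cvector hspace \<Rightarrow> ('u \<Rightarrow> 'w) set" where
  "ops H K = {a.
     (\<forall>x\<in>carrier H. a x \<in> carrier K) \<and>
     (\<forall>x\<in>carrier H. \<forall>y\<in>carrier H. a (x + y) = a x + a y) \<and>
     (\<forall>c. \<forall>x\<in>carrier H. a (c *C x) = c *C a x) \<and>
     (\<forall>x. x \<notin> carrier H \<longrightarrow> a x = 0) \<and>
     (\<exists>C. \<forall>x\<in>carrier H. hnorm K (a x) \<le> C * hnorm H x)}"

definition id_op :: "'u::cvector hspace \<Rightarrow> 'u \<Rightarrow> 'u" where
  "id_op H = (\<lambda>x. if x \<in> carrier H then x else 0)"

definition adj :: "'u::cvector hspace \<Rightarrow> 'w::cvector hspace \<Rightarrow> ('u \<Rightarrow> 'w) \<Rightarrow> ('w \<Rightarrow> 'u)" where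
  "adj H K a = (THE b. b \<in> ops K H \<and>
     (\<forall>x\<in>carrier H. \<forall>y\<in>carrier K. ip K (a x) y = ip H x (b y)))"

section \<open>Quantum orders on von Neumann algebras\<close>

definition commutant :: "'u::cvector hspace \<Rightarrow> ('u \<Rightarrow> 'u) set \<Rightarrow> ('u \<Rightarrow> 'u) set" where
  "commutant H M = {a \<in> ops H H. \<forall>m\<in>M. a \<circ> m = m \<circ> a}"

definition normal_functionals :: "'u::cvector hspace \<Rightarrow> (('u \<Rightarrow> 'u) \<Rightarrow> complex) set" where
  "normal_functionals H = {\<lambda>a. \<Sum>k. ip H (\<xi> k) (a (\<eta> k)) | \<xi> \<eta>.
     range \<xi> \<subseteq> carrier H \<and> range \<eta> \<subseteq> carrier H \<and>
     summable (\<lambda>k::nat. (hnorm H (\<xi> k))\<^sup>2) \<and> summable (\<lambda>k. (hnorm H (\<eta> k))\<^sup>2)}"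

definition ultraweak :: "'u::cvector hspace \<Rightarrow> ('u \<Rightarrow> 'u) topology" where
  "ultraweak H = topology_generated_by
     {{a \<in> ops H H. \<omega> a \<in> U} | \<omega> U. \<omega> \<in> normal_functionals H \<and> open U}"

definition quantum_preorder :: "'u::cvector hspace \<Rightarrow> ('u \<Rightarrow> 'u) set \<Rightarrow> ('u \<Rightarrow> 'u) set \<Rightarrow> bool" where
  "quantum_preorder H M V \<longleftrightarrow>
     V \<subseteq> ops H H \<and> cvec.subspace V \<and> (\<forall>v\<in>V. \<forall>w\<in>V. v \<circ> w \<in> V) \<and>
     closedin (ultraweak H) V \<and> commutant H M \<subseteq> V"

definition quantum_partial_order :: "'u::cvector hspace \<Rightarrow> ('u \<Rightarrow> 'u) set \<Rightarrow> ('u \<Rightarrow> 'u) set \<Rightarrow> bool" where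
  "quantum_partial_order H M V \<longleftrightarrow>
     quantum_preorder H M V \<and> V \<inter> adj H H ` V = commutant H M"

section \<open>Quantum sets\<close>

text \<open>
  An atom is a Hilbert space \<open>H\<close> or the dual \<open>H\<^sup>*\<close> of one; in this way \<open>X\<^sup>*\<^sup>* = X\<close> holds
  literally.  Vectors of \<open>H\<close> and of \<open>H\<^sup>*\<close> are placed in the common ambient space
  \<open>'v \<times> ('v \<Rightarrow> complex)\<close>.  The inner product on \<open>H\<^sup>*\<close> is the one induced by the Riesz
  correspondence.
\<close>

datatype 'v atom = Space "'v hspace" | Dual "'v hspace"

type_synonym 'v vec = "'v \<times> ('v \<Rightarrow> complex)"
type_synonym 'v qset = "'v atom set"

definition riesz :: "'v::cvector hspace \<Rightarrow> ('v \<Rightarrow> complex) \<Rightarrow> 'v" where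
  "riesz H f = (THE v. v \<in> carrier H \<and> (\<forall>x\<in>carrier H. f x = ip H v x))"

fun hs :: "'v::cvector atom \<Rightarrow> 'v vec hspace" where
  "hs (Space H) = \<lparr>carrier = carrier H \<times> {0}, ip = (\<lambda>x y. ip H (fst x) (fst y))\<rparr>"
| "hs (Dual H) = \<lparr>carrier = {0} \<times> ops H scalars,
     ip = (\<lambda>f g. ip H (riesz H (snd g)) (riesz H (snd f)))\<rparr>"

fun dual :: "'v atom \<Rightarrow> 'v atom" where
  "dual (Space H) = Dual H"
| "dual (Dual H) = Space H"

fun underlying :: "'v atom \<Rightarrow> 'v hspace" where
  "underlying (Space H) = H"
| "underlying (Dual H) = H"

definition quantum_set :: "'v::cvector qset \<Rightarrow> bool" where
  "quantum_set \<X> \<longleftrightarrow> (\<forall>X\<in>\<X>. fd_hilbert (underlying X) \<and> carrier (underlying X) \<noteq> {0})"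

definition dual_qset :: "'v qset \<Rightarrow> 'v qset" where
  "dual_qset \<X> = dual ` \<X>"

text \<open>The evaluation pairing of a vector in \<open>X\<close> with a functional in \<open>X\<^sup>*\<close>.\<close>

fun pairing :: "'v atom \<Rightarrow> 'v vec \<Rightarrow> 'v vec \<Rightarrow> complex" where
  "pairing (Space H) x f = snd f (fst x)"
| "pairing (Dual H) f x = snd f (fst x)"

text \<open>The vector in \<open>X\<close> that represents a functional in \<open>X\<^sup>*\<close>.\<close>

definition riesz_vec :: "'v::cvector atom \<Rightarrow> 'v vec \<Rightarrow> 'v vec" where
  "riesz_vec X f = (THE v. v \<in> carrier (hs X) \<and> (\<forall>x\<in>carrier (hs X). pairing X x f = ip (hs X) v x))"

definition l2sum :: "'v::cvector qset \<Rightarrow> ('v atom \<Rightarrow> 'v vec) hspace" where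
  "l2sum \<X> = \<lparr>carrier = {\<psi>. (\<forall>X\<in>\<X>. \<psi> X \<in> carrier (hs X)) \<and> (\<forall>X. X \<notin> \<X> \<longrightarrow> \<psi> X = 0) \<and>
       (\<lambda>X. (hnorm (hs X) (\<psi> X))\<^sup>2) summable_on \<X>},
     ip = (\<lambda>\<phi> \<psi>. \<Sum>\<^sub>\<infinity>X\<in>\<X>. ip (hs X) (\<phi> X) (\<psi> X))\<rparr>"

definition inc :: "'v::cvector atom \<Rightarrow> 'v vec \<Rightarrow> ('v atom \<Rightarrow> 'v vec)" where
  "inc X x = (\<lambda>Y. if Y = X then id_op (hs X) x else 0)"

definition diag_op :: "'v::cvector qset \<Rightarrow> ('v atom \<Rightarrow> 'v vec \<Rightarrow> 'v vec) \<Rightarrow>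
    ('v atom \<Rightarrow> 'v vec) \<Rightarrow> ('v atom \<Rightarrow> 'v vec)" where
  "diag_op \<X> m \<psi> = (\<lambda>X. if \<psi> \<in> carrier (l2sum \<X>) \<and> X \<in> \<X> then m X (\<psi> X) else 0)"

definition linfty :: "'v::cvector qset \<Rightarrow> (('v atom \<Rightarrow> 'v vec) \<Rightarrow> ('v atom \<Rightarrow> 'v vec)) set" where
  "linfty \<X> = {diag_op \<X> m | m. (\<forall>X\<in>\<X>. m X \<in> ops (hs X) (hs X)) \<and>
     (\<exists>C. \<forall>X\<in>\<X>. \<forall>x\<in>carrier (hs X). hnorm (hs X) (m X x) \<le> C * hnorm (hs X) x)}"

section \<open>Relations\<close>

text \<open>
  Components of a relation at anything other than a tuple of atoms of the right quantum sets are
  the zero subspace \<open>{0}\<close>.  The componentwise order and meet are then the pointwise \<open>\<le>\<close> and \<open>inf\<close>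
  on functions into sets.
\<close>

type_synonym 'v brel = "'v atom \<Rightarrow> 'v atom \<Rightarrow> ('v vec \<Rightarrow> 'v vec) set"

definition binary_relation :: "'v::cvector qset \<Rightarrow> 'v qset \<Rightarrow> 'v brel \<Rightarrow> bool" where
  "binary_relation \<X> \<Y> R \<longleftrightarrow>
     (\<forall>X Y. cvec.subspace (R X Y) \<and>
        R X Y \<subseteq> (if X \<in> \<X> \<and> Y \<in> \<Y> then ops (hs X) (hs Y) else {0}))"

definition id_rel :: "'v::cvector qset \<Rightarrow> 'v brel" where
  "id_rel \<X> X Y = (if X = Y \<and> X \<in> \<X> then cvec.span {id_op (hs X)} else {0})"

text \<open>
  A relation of arity \<open>(\<X>\<^sub>1, \<dots>, \<X>\<^sub>n)\<close> has components in \<open>L(X\<^sub>1 \<otimes> \<dots> \<otimes> X\<^sub>n, \<complex>)\<close>.  An operator \<open>r\<close> in this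
  space is given as the multilinear form \<open>(x\<^sub>1, \<dots>, x\<^sub>n) \<mapsto> r (x\<^sub>1 \<otimes> \<dots> \<otimes> x\<^sub>n)\<close>, extended by \<open>0\<close>; by the
  universal property of the tensor product, every multilinear form arises from exactly one \<open>r\<close>.
  Tuples are lists, and the empty tensor product is \<open>\<complex>\<close>.
\<close>

type_synonym 'v form = "'v vec list \<Rightarrow> complex"
type_synonym 'v arel = "'v atom list \<Rightarrow> 'v form set"

definition tuples :: "'v::cvector atom list \<Rightarrow> 'v vec list set" where
  "tuples Xs = listset (map (\<lambda>X. carrier (hs X)) Xs)"

definition forms :: "'v::cvector atom list \<Rightarrow> 'v form set" where
  "forms Xs = {r. (\<forall>xs. xs \<notin> tuples Xs \<longrightarrow> r xs = 0) \<and>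
     (\<forall>xs\<in>tuples Xs. \<forall>i<length Xs. \<forall>y\<in>carrier (hs (Xs ! i)). \<forall>c.
        r (xs[i := xs ! i + y]) = r xs + r (xs[i := y]) \<and>
        r (xs[i := c *C xs ! i]) = c * r xs)}"

text \<open>
  The inner product \<open>Tr(a\<^sup>\<dagger> b)\<close> on \<open>L(X\<^sub>1 \<otimes> \<dots> \<otimes> X\<^sub>n, \<complex>)\<close>, computed in a product orthonormal basis (its
  value does not depend on the choice of the bases).
\<close>

definition form_ip :: "'v::cvector atom list \<Rightarrow> 'v form \<Rightarrow> 'v form \<Rightarrow> complex" where
  "form_ip Xs a b = (\<Sum>es \<in> listset (map (\<lambda>X. some_onb (hs X)) Xs). cnj (a es) * b es)"

definition top_rel :: "'v::cvector qset list \<Rightarrow> 'v arel" where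
  "top_rel \<X>s Xs = (if Xs \<in> listset \<X>s then forms Xs else {0})"

definition relation :: "'v::cvector qset list \<Rightarrow> 'v arel \<Rightarrow> bool" where
  "relation \<X>s R \<longleftrightarrow> (\<forall>Xs. cvec.subspace (R Xs)) \<and> R \<le> top_rel \<X>s"

definition neg_rel :: "'v::cvector qset list \<Rightarrow> 'v arel \<Rightarrow> 'v arel" where
  "neg_rel \<X>s R Xs = {a \<in> top_rel \<X>s Xs. \<forall>b\<in>R Xs. form_ip Xs b a = 0}"

definition Sup_rel :: "'v::cvector arel set \<Rightarrow> 'v arel" where
  "Sup_rel \<R> Xs = cvec.span (\<Union>R\<in>\<R>. R Xs)"

text \<open>\<open>R \<times> S\<close>, where \<open>R\<close> has \<open>n\<close> arguments.\<close>

definition times_rel :: "nat \<Rightarrow> 'v::cvector arel \<Rightarrow> 'v arel \<Rightarrow> 'v arel" where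
  "times_rel n R S Xs = cvec.span
     {(\<lambda>xs. r (take n xs) * s (drop n xs)) | r s. r \<in> R (take n Xs) \<and> s \<in> S (drop n Xs)}"

text \<open>\<open>S \<circ> (B \<times> C)\<close> for a relation \<open>S\<close> with two arguments and binary relations \<open>B\<close> and \<open>C\<close>.\<close>

definition comp_times :: "'v::cvector arel \<Rightarrow> 'v brel \<Rightarrow> 'v brel \<Rightarrow> 'v arel" where
  "comp_times S B C Xs = (case Xs of
     [X, X'] \<Rightarrow> cvec.span
       {(\<lambda>xs. case xs of [x, x'] \<Rightarrow> s [b x, c x'] | _ \<Rightarrow> 0) | s b c Y Y'.
          s \<in> S [Y, Y'] \<and> b \<in> B X Y \<and> c \<in> C X' Y'}
   | _ \<Rightarrow> {0})"

text \<open>The evaluation functional \<open>\<epsilon>\<^sub>X\<close> on \<open>X \<otimes> X\<^sup>*\<close>.\<close>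

definition ev :: "'v::cvector atom \<Rightarrow> 'v form" where
  "ev X xs = (if xs \<in> tuples [X, dual X] then pairing X (xs ! 0) (xs ! 1) else 0)"

definition eq_rel :: "'v::cvector qset \<Rightarrow> 'v arel" where
  "eq_rel \<X> Xs = (if \<exists>X\<in>\<X>. Xs = [X, dual X] then cvec.span {ev (hd Xs)} else {0})"

text \<open>\<open>B\<close> is a binary relation into \<open>\<Y>\<close>.\<close>

definition hat :: "'v::cvector qset \<Rightarrow> 'v brel \<Rightarrow> 'v arel" where
  "hat \<Y> B = comp_times (eq_rel \<Y>) B (id_rel (dual_qset \<Y>))"

text \<open>
  For \<open>r : H = X\<^sub>1 \<otimes> \<dots> \<otimes> X\<^sub>n \<rightarrow> \<complex>\<close>, \<open>r\<^sub>* = (r\<^sup>\<dagger>)\<^sup>*\<close> maps a functional \<open>f\<close> on \<open>H\<close> to \<open>f (r\<^sup>\<dagger> 1)\<close>.  If \<open>f\<close> is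
  represented by the vector \<open>w\<close>, then this is \<open>\<langle>w | r\<^sup>\<dagger> 1\<rangle>\<close>, the complex conjugate of \<open>r w\<close>; the
  vector representing \<open>f\<^sub>1 \<otimes> \<dots> \<otimes> f\<^sub>n\<close> is the tensor product of those representing the \<open>f\<^sub>i\<close>.
\<close>

definition conj_form :: "'v::cvector atom list \<Rightarrow> 'v form \<Rightarrow> 'v form" where
  "conj_form Xs r = (\<lambda>fs. if fs \<in> tuples (map dual Xs) then cnj (r (map2 riesz_vec Xs fs)) else 0)"

definition conj_rel :: "'v::cvector arel \<Rightarrow> 'v arel" where
  "conj_rel R Ws = conj_form (map dual Ws) ` R (map dual Ws)"

section \<open>Formulas and their interpretation\<close>

datatype 'v var = Var (sort_of: "'v qset") nat

datatype 'v fm =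
    Rel "'v arel" "'v var list"
  | Neg "'v fm"
  | Conj "'v fm" "'v fm"
  | Forall "'v var" "'v fm"

abbreviation Disj :: "'v fm \<Rightarrow> 'v fm \<Rightarrow> 'v fm" where
  "Disj \<phi> \<psi> \<equiv> Neg (Conj (Neg \<phi>) (Neg \<psi>))"

abbreviation Imp :: "'v fm \<Rightarrow> 'v fm \<Rightarrow> 'v fm" where
  "Imp \<phi> \<psi> \<equiv> Disj (Neg \<phi>) (Conj \<phi> \<psi>)"

text \<open>\<open>ForallEq x y \<phi>\<close> is \<open>(\<forall>(x = y) \<in> \<X> \<times> \<X>\<^sup>*) \<phi>\<close>, with \<open>x\<close> of sort \<open>\<X>\<close> and \<open>y\<close> of sort \<open>\<X>\<^sup>*\<close>.\<close>

abbreviation ForallEq :: "'v::cvector var \<Rightarrow> 'v var \<Rightarrow> 'v fm \<Rightarrow> 'v fm" where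
  "ForallEq x y \<phi> \<equiv> Forall y (Forall x (Imp (Rel (eq_rel (sort_of x)) [x, y]) \<phi>))"

text \<open>The entries of \<open>zs\<close>, indexed by the variables \<open>ctx\<close>, in the order given by the variables \<open>ys\<close>.\<close>

definition arrange :: "'x list \<Rightarrow> 'x list \<Rightarrow> 'z list \<Rightarrow> 'z list" where
  "arrange ctx ys zs = map (\<lambda>y. the (map_of (zip ctx zs) y)) ys"

text \<open>
  An atomic formula with argument variables \<open>ys\<close>: the permutation \<open>\<pi>\<close> of the context \<open>ctx\<close> puts
  \<open>ys\<close> first and keeps the order of the remaining variables.  (Any other order of the latter
  only permutes the factors of \<open>\<top> \<times> \<dots> \<times> \<top>\<close>.)
\<close>

definition atomic :: "'v::cvector var list \<Rightarrow> 'v arel \<Rightarrow> 'v var list \<Rightarrow> 'v arel" where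
  "atomic ctx R ys Xs =
    (let rest = filter (\<lambda>y. y \<notin> set ys) ctx; \<pi> = ys @ rest in
     if length Xs = length ctx then
       (\<lambda>t xs. if length xs = length ctx then t (arrange ctx \<pi> xs) else 0) `
         times_rel (length ys) R (top_rel (map sort_of rest)) (arrange ctx \<pi> Xs)
     else {0})"

text \<open>
  \<open>interp \<phi> [x\<^sub>1, \<dots>, x\<^sub>n]\<close> is the relation \<open>[[(x\<^sub>1, \<dots>, x\<^sub>n) | \<phi>]]\<close>.  As usual, the \<open>x\<^sub>i\<close> are distinct, include
  the free variables of \<open>\<phi>\<close>, and differ from the bound ones.
\<close>

primrec interp :: "'v::cvector fm \<Rightarrow> 'v var list \<Rightarrow> 'v arel" where
  "interp (Rel R ys) ctx = atomic ctx R ys"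
| "interp (Neg \<phi>) ctx = neg_rel (map sort_of ctx) (interp \<phi> ctx)"
| "interp (Conj \<phi> \<psi>) ctx = inf (interp \<phi> ctx) (interp \<psi> ctx)"
| "interp (Forall x \<phi>) ctx = Sup_rel {R. relation (map sort_of ctx) R \<and>
     times_rel 1 (top_rel [sort_of x]) R \<le> interp \<phi> (x # ctx)}"

definition holds :: "'v::cvector fm \<Rightarrow> bool" where
  "holds \<phi> \<longleftrightarrow> interp \<phi> [] = top_rel []"

section \<open>The relation associated with a quantum preorder\<close>

definition rel_of :: "'v::cvector qset \<Rightarrow> (('v atom \<Rightarrow> 'v vec) \<Rightarrow> ('v atom \<Rightarrow> 'v vec)) set \<Rightarrow> 'v brel" where
  "rel_of \<X> V X\<^sub>1 X\<^sub>2 =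
    (if X\<^sub>1 \<in> \<X> \<and> X\<^sub>2 \<in> \<X>
     then {adj (hs X\<^sub>2) (l2sum \<X>) (inc X\<^sub>2) \<circ> v \<circ> inc X\<^sub>1 | v. v \<in> V}
     else {0})"

end

theory Submission
  imports Defs
begin

text \<open>
  The theorem amounts to two independent translations into conditions on a binary relation \<open>R\<close> on \<open>\<X>\<close>.

  On the logical side, the three formulas hold if and only if \<open>1\<^sub>X \<in> R(X, X)\<close> (\<open>reflexivity_iff\<close>),
  \<open>R(Y, Z) R(X, Y) \<subseteq> R(X, Z)\<close> (\<open>transitivity_iff\<close>), and \<open>R(X, Y) \<inter> R(Y, X)\<^sup>\<dagger>\<close> is contained in the identity relation
  (\<open>antisymmetry_iff\<close>).  The forms on a tensor product of atoms are a finite-dimensional inner product space, and the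
  interpretation of a formula consists of subspaces of such spaces.  Three facts carry the translation.
  An atomic formula is interpreted by the forms all of whose slices are in the given relation
  (\<open>atomic_iff_slices\<close>).  The implication is the Sasaki arrow of the lattice of subspaces: it contains \<open>\<phi>\<^sup>\<bottom>\<close> and
  \<open>\<phi> \<and> \<psi>\<close>, and it satisfies modus ponens.  Finally, the quantifier \<open>\<forall>(x = x\<^sub>*)\<close> inserts the evaluation \<open>\<epsilon>\<^sub>X\<close> into the
  arguments \<open>x, x\<^sub>*\<close> (\<open>mem_ForallEq_iff\<close>).  So the transitivity axiom says that \<open>\<epsilon> \<otimes> \<epsilon> \<otimes> \<epsilon>\<close> belongs to one implication.
  This is decided by its inner products with \<open>r \<otimes> s \<otimes> k\<close>, for \<open>r, s\<close> in \<open>R\<close>; the contraction of \<open>\<epsilon> \<otimes> \<epsilon> \<otimes> \<epsilon>\<close> with \<open>r\<close> and \<open>s\<close>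
  is the conjugate of the form of \<open>s r\<close> (\<open>form_ip_triple_loop\<close>), which is to be compared with the conjugate of \<open>R\<close>.

  On the operator side, the commutant of \<open>\<ell>\<^sup>\<infinity>(\<X>)\<close> consists of the block diagonal operators with scalar blocks
  (\<open>commutant_linfty\<close>).  The inverse of \<open>V \<mapsto> R\<close> sends \<open>R\<close> to the set of all bounded operators with blocks in \<open>R\<close>.  This set
  is ultraweakly closed, because a block is in \<open>R(X, Y)\<close> if and only if finitely many matrix coefficients satisfy linear equations; and
  it is an algebra, because a block of a product is a convergent sum of products of blocks.  Conversely, a quantum preorder
  \<open>V\<close> contains the projections \<open>p\<^sub>X\<close> onto the atoms.  If the blocks of \<open>v\<close> are blocks of elements of \<open>V\<close>, then \<open>V\<close> contains
  \<open>p\<^sub>F v p\<^sub>F\<close> for every finite set \<open>F\<close> of atoms.  These operators converge ultraweakly to \<open>v\<close>, so \<open>v \<in> V\<close>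
  (\<open>preorder_eq_rel_ops\<close>).  Since the blocks of \<open>v\<^sup>\<dagger>\<close> are the adjoints of those of \<open>v\<close>, the equation \<open>V \<inter> V\<^sup>\<dagger> = M'\<close> for
  \<open>M = \<ell>\<^sup>\<infinity>(\<X>)\<close> is the third condition on \<open>R\<close> (\<open>partial_order_iff\<close>).
\<close>

section \<open>Inner product spaces\<close>

text \<open>What \<open>fd_hilbert\<close> and the (possibly infinite-dimensional) l2-direct sum have in common, so that elementary facts about
  inner products are available for both.\<close>

definition prehilbert :: "'u::cvector hspace \<Rightarrow> bool" where
  "prehilbert H \<longleftrightarrow>
     cvec.subspace (carrier H) \<and>
     (\<forall>x\<in>carrier H. \<forall>y\<in>carrier H. \<forall>z\<in>carrier H. ip H x (y + z) = ip H x y + ip H x z) \<and>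
     (\<forall>x\<in>carrier H. \<forall>y\<in>carrier H. \<forall>c. ip H x (c *C y) = c * ip H x y) \<and>
     (\<forall>x\<in>carrier H. \<forall>y\<in>carrier H. ip H y x = cnj (ip H x y)) \<and>
     (\<forall>x\<in>carrier H. x \<noteq> 0 \<longrightarrow> 0 < Re (ip H x x))"

lemma fd_hilbert_iff: "fd_hilbert H \<longleftrightarrow> prehilbert H \<and> (\<exists>B. finite B \<and> cvec.span B = carrier H)"
  by (simp only: fd_hilbert_def prehilbert_def conj_assoc)

lemma fd_prehilbert: "fd_hilbert H \<Longrightarrow> prehilbert H"
  by (simp add: fd_hilbert_iff)

lemma carrier_add [simp, intro]: "prehilbert H \<Longrightarrow> x \<in> carrier H \<Longrightarrow> y \<in> carrier H \<Longrightarrow> x + y \<in> carrier H"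
  and carrier_scale [simp, intro]: "prehilbert H \<Longrightarrow> x \<in> carrier H \<Longrightarrow> c *C x \<in> carrier H"
  and carrier_zero [simp, intro]: "prehilbert H \<Longrightarrow> 0 \<in> carrier H"
  and carrier_diff [simp, intro]: "prehilbert H \<Longrightarrow> x \<in> carrier H \<Longrightarrow> y \<in> carrier H \<Longrightarrow> x - y \<in> carrier H"
  and carrier_sum: "prehilbert H \<Longrightarrow> (\<And>i. i \<in> I \<Longrightarrow> f i \<in> carrier H) \<Longrightarrow> sum f I \<in> carrier H"
  unfolding prehilbert_def
  by (auto intro: cvec.subspace_add cvec.subspace_scale cvec.subspace_0 cvec.subspace_diff cvec.subspace_sum)

lemma ip_add_right: "prehilbert H \<Longrightarrow> x \<in> carrier H \<Longrightarrow> y \<in> carrier H \<Longrightarrow> z \<in> carrier H \<Longrightarrow>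
    ip H x (y + z) = ip H x y + ip H x z"
  unfolding prehilbert_def by (drule conjunct2, drule conjunct1) simp

lemma ip_scale_right: "prehilbert H \<Longrightarrow> x \<in> carrier H \<Longrightarrow> y \<in> carrier H \<Longrightarrow> ip H x (c *C y) = c * ip H x y"
  unfolding prehilbert_def by (drule conjunct2, drule conjunct2, drule conjunct1) simp

lemma ip_cnj: "prehilbert H \<Longrightarrow> x \<in> carrier H \<Longrightarrow> y \<in> carrier H \<Longrightarrow> ip H y x = cnj (ip H x y)"
  unfolding prehilbert_def
  by (drule conjunct2, drule conjunct2, drule conjunct2, drule conjunct1, drule (1) bspec, erule (1) bspec)

lemma ip_pos: "prehilbert H \<Longrightarrow> x \<in> carrier H \<Longrightarrow> x \<noteq> 0 \<Longrightarrow> 0 < Re (ip H x x)"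
  unfolding prehilbert_def
  by (drule conjunct2, drule conjunct2, drule conjunct2, drule conjunct2) simp

lemma ip_add_left: "prehilbert H \<Longrightarrow> x \<in> carrier H \<Longrightarrow> y \<in> carrier H \<Longrightarrow> z \<in> carrier H \<Longrightarrow>
    ip H (x + y) z = ip H x z + ip H y z"
  by (simp add: ip_cnj[of H z "x + y"] ip_cnj[of H z x] ip_cnj[of H z y] ip_add_right)

lemma ip_scale_left: "prehilbert H \<Longrightarrow> x \<in> carrier H \<Longrightarrow> y \<in> carrier H \<Longrightarrow>
    ip H (c *C x) y = cnj c * ip H x y"
  by (simp add: ip_cnj[of H y "c *C x"] ip_cnj[of H y x] ip_scale_right)

lemma ip_zero_right [simp]: "prehilbert H \<Longrightarrow> x \<in> carrier H \<Longrightarrow> ip H x 0 = 0"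
  using ip_scale_right[of H x 0 0] by simp

lemma ip_zero_left [simp]: "prehilbert H \<Longrightarrow> x \<in> carrier H \<Longrightarrow> ip H 0 x = 0"
  using ip_scale_left[of H 0 x 0] by simp

lemma ip_diff_right: "prehilbert H \<Longrightarrow> x \<in> carrier H \<Longrightarrow> y \<in> carrier H \<Longrightarrow> z \<in> carrier H \<Longrightarrow>
    ip H x (y - z) = ip H x y - ip H x z"
  using ip_add_right[of H x "y - z" z] by simp

lemma ip_diff_left: "prehilbert H \<Longrightarrow> x \<in> carrier H \<Longrightarrow> y \<in> carrier H \<Longrightarrow> z \<in> carrier H \<Longrightarrow>
    ip H (x - y) z = ip H x z - ip H y z"
  using ip_add_left[of H "x - y" y z] by simp

lemma ip_sum_right: "prehilbert H \<Longrightarrow> x \<in> carrier H \<Longrightarrow> (\<And>i. i \<in> I \<Longrightarrow> f i \<in> carrier H) \<Longrightarrow>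
    ip H x (sum f I) = (\<Sum>i\<in>I. ip H x (f i))"
  by (induction I rule: infinite_finite_induct) (simp_all add: ip_add_right carrier_sum)

lemma ip_sum_left: "prehilbert H \<Longrightarrow> x \<in> carrier H \<Longrightarrow> (\<And>i. i \<in> I \<Longrightarrow> f i \<in> carrier H) \<Longrightarrow>
    ip H (sum f I) x = (\<Sum>i\<in>I. ip H (f i) x)"
  by (induction I rule: infinite_finite_induct) (simp_all add: ip_add_left carrier_sum)

lemma ip_self: "prehilbert H \<Longrightarrow> x \<in> carrier H \<Longrightarrow> ip H x x = complex_of_real ((hnorm H x)\<^sup>2)"
proof -
  assume H: "prehilbert H" "x \<in> carrier H"
  have "0 \<le> Re (ip H x x)" using H by (cases "x = 0") (auto dest: ip_pos simp: less_imp_le)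
  moreover have "Im (ip H x x) = 0" using ip_cnj[OF H(1) H(2) H(2)]
    by (metis complex_is_Real_iff Reals_cnj_iff)
  ultimately show ?thesis by (simp add: hnorm_def complex_eq_iff)
qed

lemma hnorm_nonneg [simp]: "prehilbert H \<Longrightarrow> x \<in> carrier H \<Longrightarrow> 0 \<le> hnorm H x"
  unfolding hnorm_def by (cases "x = 0") (auto dest: ip_pos simp: less_imp_le)

lemma hnorm_eq_zero: "prehilbert H \<Longrightarrow> x \<in> carrier H \<Longrightarrow> hnorm H x = 0 \<longleftrightarrow> x = 0"
  by (cases "x = 0") (auto dest: ip_pos simp: hnorm_def)

lemma hnorm_zero [simp]: "prehilbert H \<Longrightarrow> hnorm H 0 = 0"
  by (simp add: hnorm_eq_zero)

lemma ip_self_zero: "prehilbert H \<Longrightarrow> x \<in> carrier H \<Longrightarrow> ip H x x = 0 \<Longrightarrow> x = 0"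
  using ip_pos[of H x] by auto

lemma ip_nondegenerate:
  assumes "prehilbert H" "x \<in> carrier H" "y \<in> carrier H" "\<And>z. z \<in> carrier H \<Longrightarrow> ip H z x = ip H z y"
  shows "x = y"
proof -
  have "ip H (x - y) (x - y) = 0" using assms by (simp add: ip_diff_right)
  then show ?thesis using ip_self_zero[of H "x - y"] assms by simp
qed

lemma hnorm_scale: "prehilbert H \<Longrightarrow> x \<in> carrier H \<Longrightarrow> hnorm H (c *C x) = cmod c * hnorm H x"
proof -
  assume H: "prehilbert H" "x \<in> carrier H"
  have "ip H (c *C x) (c *C x) = (c * cnj c) * ip H x x"
    using H by (simp add: ip_scale_left ip_scale_right)
  then have "ip H (c *C x) (c *C x) = complex_of_real ((cmod c * hnorm H x)\<^sup>2)"
    using H by (simp add: ip_self[of H x] complex_norm_square[symmetric] power_mult_distrib)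
  then have "(hnorm H (c *C x))\<^sup>2 = (cmod c * hnorm H x)\<^sup>2"
    using H by (simp only: ip_self carrier_scale of_real_eq_iff)
  then show ?thesis using H by (simp add: power2_eq_iff_nonneg)
qed

lemma Cauchy_Schwarz:
  assumes "prehilbert H" "x \<in> carrier H" "y \<in> carrier H"
  shows "cmod (ip H x y) \<le> hnorm H x * hnorm H y"
proof (cases "x = 0")
  case False
  then have nx: "hnorm H x > 0" using assms hnorm_eq_zero[of H x] hnorm_nonneg[of H x] by linarith
  define c where "c = ip H x y / ip H x x"
  define z where "z = y - c *C x"
  have z: "z \<in> carrier H" using assms by (simp add: z_def)
  have nxx: "ip H x x \<noteq> 0" using nx assms by (simp add: ip_self)
  have xz: "ip H x z = 0" using assms nxx by (simp add: z_def ip_diff_right ip_scale_right c_def)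
  then have zx: "ip H z x = 0" using ip_cnj[OF assms(1,2) z] by simp
  have "y = z + c *C x" by (simp add: z_def)
  then have "ip H y y = ip H z z + c * cnj c * ip H x x"
    using assms z xz zx by (simp add: ip_add_left ip_add_right ip_scale_left ip_scale_right algebra_simps)
  then have "complex_of_real ((hnorm H y)\<^sup>2) = complex_of_real ((hnorm H z)\<^sup>2 + (cmod c)\<^sup>2 * (hnorm H x)\<^sup>2)"
    using assms z by (simp add: ip_self complex_norm_square[symmetric] del: of_real_power)
  then have "(hnorm H y)\<^sup>2 = (hnorm H z)\<^sup>2 + (cmod c)\<^sup>2 * (hnorm H x)\<^sup>2"
    by (simp only: of_real_eq_iff)
  then have "(cmod c * hnorm H x)\<^sup>2 \<le> (hnorm H y)\<^sup>2" by (simp add: power_mult_distrib)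
  then have le: "cmod c * hnorm H x \<le> hnorm H y"
    using power2_le_imp_le[OF _ hnorm_nonneg[OF assms(1,3)]] by blast
  have "cmod c = cmod (ip H x y) / (hnorm H x)\<^sup>2"
    using assms by (simp add: c_def norm_divide ip_self norm_power)
  with le nx show ?thesis by (simp add: field_simps power2_eq_square)
qed (use assms in simp)

lemma hnorm_triangle:
  assumes "prehilbert H" "x \<in> carrier H" "y \<in> carrier H"
  shows "hnorm H (x + y) \<le> hnorm H x + hnorm H y"
proof -
  have "ip H (x + y) (x + y) = ip H x x + ip H y y + (ip H x y + cnj (ip H x y))"
    using assms ip_cnj[OF assms] by (simp add: ip_add_left ip_add_right)
  then have "complex_of_real ((hnorm H (x + y))\<^sup>2) = complex_of_real ((hnorm H x)\<^sup>2 + (hnorm H y)\<^sup>2 + 2 * Re (ip H x y))"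
    using assms by (simp add: ip_self complex_add_cnj)
  then have "(hnorm H (x + y))\<^sup>2 = (hnorm H x)\<^sup>2 + (hnorm H y)\<^sup>2 + 2 * Re (ip H x y)"
    by (simp only: of_real_eq_iff)
  also have "\<dots> \<le> (hnorm H x + hnorm H y)\<^sup>2"
    using Cauchy_Schwarz[OF assms] complex_Re_le_cmod[of "ip H x y"] by (simp add: power2_sum)
  finally show ?thesis
    by (rule power2_le_imp_le) (simp add: assms)
qed

lemma hnorm_sum:
  assumes "prehilbert H" "\<And>i. i \<in> I \<Longrightarrow> f i \<in> carrier H"
  shows "hnorm H (sum f I) \<le> (\<Sum>i\<in>I. hnorm H (f i))"
  using assms(2)
proof (induction I rule: infinite_finite_induct)
  case (insert i I)
  then have "hnorm H (f i + sum f I) \<le> hnorm H (f i) + hnorm H (sum f I)"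
    using assms(1) by (intro hnorm_triangle) (auto intro: carrier_sum)
  then show ?case using insert by fastforce
qed (use assms(1) in auto)

section \<open>Orthonormal bases and orthogonal projections\<close>

lemma onbD:
  assumes "onb H B"
  shows "finite B" "cvec.span B = carrier H" "e \<in> B \<Longrightarrow> e \<in> carrier H"
    "e \<in> B \<Longrightarrow> f \<in> B \<Longrightarrow> ip H e f = (if e = f then 1 else 0)"
  using assms cvec.span_base[of e B] unfolding onb_def by auto

lemma onb_expansion:
  assumes H: "prehilbert H" and B: "onb H B" and x: "x \<in> carrier H"
  shows "x = (\<Sum>e\<in>B. ip H e x *C e)"
proof -
  note B' = onbD[OF B]
  obtain c where c: "x = (\<Sum>e\<in>B. c e *C e)"
    using x B' cvec.span_finite[of B] by (metis (no_types, lifting) imageE)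
  have "ip H e x = c e" if e: "e \<in> B" for e
  proof -
    have "ip H e x = (\<Sum>f\<in>B. c f * ip H e f)"
      unfolding c using H B' e by (subst ip_sum_right) (auto simp: ip_scale_right)
    also have "\<dots> = (\<Sum>f\<in>B. if f = e then c f else 0)"
      using B' e by (intro sum.cong) auto
    finally show ?thesis using B' e by simp
  qed
  then show ?thesis using c by simp
qed

text \<open>Gram--Schmidt: the part of a vector orthogonal to an orthonormal set is normalised and added.\<close>

lemma onb_exists:
  assumes "fd_hilbert H"
  shows "\<exists>B. onb H B"
proof -
  have H: "prehilbert H" using assms by (rule fd_prehilbert)
  obtain A where A: "finite A" "cvec.span A = carrier H" using assms by (auto simp: fd_hilbert_iff)
  have "\<exists>B. finite B \<and> cvec.span B = cvec.span A' \<and> (\<forall>x\<in>B. \<forall>y\<in>B. ip H x y = (if x = y then 1 else 0))"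
    if "finite A'" "A' \<subseteq> carrier H" for A'
    using that
  proof (induction A' rule: finite_induct)
    case empty
    show ?case by (intro exI[of _ "{}"]) simp
  next
    case (insert a A')
    then obtain B where B: "finite B" "cvec.span B = cvec.span A'"
      "\<And>x y. x \<in> B \<Longrightarrow> y \<in> B \<Longrightarrow> ip H x y = (if x = y then 1 else 0)" by auto
    have sub: "cvec.span A' \<subseteq> carrier H"
      using insert H by (intro cvec.span_minimal) (auto simp: prehilbert_def)
    have BH: "e \<in> carrier H" if "e \<in> B" for e using B(2) sub that cvec.span_base by blast
    define w where "w = (\<Sum>e\<in>B. ip H e a *C e)"
    define z where "z = a - w"
    have wB: "w \<in> cvec.span B" unfolding w_def
      by (intro cvec.span_sum cvec.span_scale cvec.span_base)
    have a: "a \<in> carrier H" using insert by auto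
    have w: "w \<in> carrier H" using wB B(2) sub by auto
    have z: "z \<in> carrier H" using H a w by (simp add: z_def)
    have ez: "ip H e z = 0" if e: "e \<in> B" for e
    proof -
      have "ip H e w = (\<Sum>f\<in>B. ip H f a * ip H e f)"
        unfolding w_def using H BH e by (subst ip_sum_right) (auto simp: ip_scale_right)
      also have "\<dots> = (\<Sum>f\<in>B. if f = e then ip H f a else 0)"
        using B(3) e by (intro sum.cong) auto
      finally show ?thesis using B(1) e H a w BH by (simp add: z_def ip_diff_right)
    qed
    show ?case
    proof (cases "z = 0")
      case True
      then have "a \<in> cvec.span A'" using wB B(2) by (simp add: z_def)
      then show ?thesis using B by (metis cvec.span_redundant)
    next
      case False
      define u where "u = complex_of_real (1 / hnorm H z) *C z"
      have nz: "hnorm H z > 0" using False H z hnorm_eq_zero[of H z] hnorm_nonneg[of H z] by linarith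
      have uu: "ip H u u = 1" unfolding u_def using H z nz
        by (simp add: ip_scale_left ip_scale_right ip_self[of H z] power2_eq_square)
      have eu: "ip H e u = 0" if "e \<in> B" for e unfolding u_def using H z ez[OF that] BH[OF that]
        by (simp add: ip_scale_right)
      have u: "u \<in> carrier H" using H z by (simp add: u_def)
      have ue: "ip H u e = 0" if "e \<in> B" for e
        using ip_cnj[OF H BH[OF that] u] eu[OF that] by simp
      have "u \<notin> B" using uu eu[of u] by auto
      have ax: "a = w + complex_of_real (hnorm H z) *C u"
        unfolding u_def using nz by (simp add: cvec.scale_scale z_def scaleC_one)
      have "cvec.span (insert u B) = cvec.span (insert a A')"
      proof (rule cvec.span_eq[THEN iffD2], intro conjI subsetI)
        fix x assume "x \<in> insert u B"
        moreover have "w \<in> cvec.span (insert a A')" using wB B(2) cvec.span_mono[of A' "insert a A'"] by auto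
        moreover have "a \<in> cvec.span (insert a A')" by (simp add: cvec.span_base)
        ultimately show "x \<in> cvec.span (insert a A')"
          using B(2) cvec.span_mono[of A' "insert a A'"] cvec.span_base[of x B]
          by (auto simp: u_def z_def intro!: cvec.span_scale cvec.span_diff)
      next
        fix x assume "x \<in> insert a A'"
        moreover have "w \<in> cvec.span (insert u B)" using wB cvec.span_mono[of B "insert u B"] by auto
        moreover have "u \<in> cvec.span (insert u B)" by (simp add: cvec.span_base)
        moreover have "A' \<subseteq> cvec.span (insert u B)"
          using B(2) cvec.span_mono[of B "insert u B"] cvec.span_superset[of A'] by auto
        ultimately show "x \<in> cvec.span (insert u B)"
          using ax by (auto intro!: cvec.span_scale cvec.span_add)
      qed
      then show ?thesis using B(1,3) uu eu ue \<open>u \<notin> B\<close>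
        by (intro exI[of _ "insert u B"]) auto
    qed
  qed
  from this[of A] show ?thesis using A cvec.span_superset[of A] by (auto simp: onb_def)
qed

lemma some_onb: "fd_hilbert H \<Longrightarrow> onb H (some_onb H)"
  unfolding some_onb_def using onb_exists by (metis someI_ex)

lemma fd_hilbert_subspace:
  assumes H: "fd_hilbert H" and S: "cvec.subspace S" "S \<subseteq> carrier H"
  shows "fd_hilbert \<lparr>carrier = S, ip = ip H\<rparr>"
proof -
  obtain A where A: "finite A" "cvec.span A = carrier H" using H by (auto simp: fd_hilbert_iff)
  note pH = fd_prehilbert[OF H]
  obtain B where B: "B \<subseteq> S" "cvec.independent B" "S \<subseteq> cvec.span B"
    using cvec.maximal_independent_subset[of S] by blast
  have "finite B" using cvec.independent_span_bound[OF A(1) B(2)] A(2) B(1) S(2) by blast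
  moreover have "cvec.span B = S" using B S(1) by (metis cvec.span_minimal subset_antisym)
  moreover have "prehilbert \<lparr>carrier = S, ip = ip H\<rparr>"
    unfolding prehilbert_def hspace.select_convs
    by (intro conjI ballI allI impI S(1) ip_add_right[OF pH] ip_scale_right[OF pH] ip_pos[OF pH]
        ip_cnj[OF pH] subsetD[OF S(2)])
  ultimately show ?thesis unfolding fd_hilbert_iff by auto
qed

lemma orthogonal_projection:
  assumes H: "fd_hilbert H" and S: "cvec.subspace S" "S \<subseteq> carrier H" and a: "a \<in> carrier H"
  obtains a' where "a' \<in> S" "\<And>b. b \<in> S \<Longrightarrow> ip H b (a - a') = 0"
proof -
  let ?S = "\<lparr>carrier = S, ip = ip H\<rparr>"
  have fd: "fd_hilbert ?S" by (rule fd_hilbert_subspace[OF H S])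
  obtain B where B: "onb ?S B" using onb_exists[OF fd] by blast
  note B' = onbD[OF B, simplified]
  have pH: "prehilbert H" using H by (rule fd_prehilbert)
  have BH: "e \<in> carrier H" if "e \<in> B" for e using B'(3)[OF that] S by auto
  define w where "w = (\<Sum>e\<in>B. ip H e a *C e)"
  have wS: "w \<in> S" unfolding w_def
    using S(1) B' by (intro cvec.subspace_sum cvec.subspace_scale) auto
  have w: "w \<in> carrier H" using wS S by auto
  have 1: "ip H e (a - w) = 0" if e: "e \<in> B" for e
  proof -
    have "ip H e w = (\<Sum>f\<in>B. ip H f a * ip H e f)"
      unfolding w_def using pH BH e by (subst ip_sum_right) (auto simp: ip_scale_right)
    also have "\<dots> = (\<Sum>f\<in>B. if f = e then ip H f a else 0)"
      using B'(4) e by (intro sum.cong) auto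
    finally show ?thesis using B'(1) e pH a w BH by (simp add: ip_diff_right)
  qed
  have "ip H b (a - w) = 0" if b: "b \<in> S" for b
  proof -
    have "b = (\<Sum>e\<in>B. ip H e b *C e)" using onb_expansion[OF fd_prehilbert[OF fd] B] b by simp
    then have "ip H b (a - w) = (\<Sum>e\<in>B. ip H (ip H e b *C e) (a - w))"
      using pH a w BH ip_sum_left[of H "a - w" B "\<lambda>e. ip H e b *C e"] by auto
    also have "\<dots> = 0" using pH a w BH 1 by (intro sum.neutral) (simp add: ip_scale_left)
    finally show ?thesis .
  qed
  with wS that show ?thesis by blast
qed

text \<open>The inclusion \<open>S\<^sup>\<bottom>\<^sup>\<bottom> \<subseteq> S\<close>: the component of \<open>a\<close> orthogonal to \<open>S\<close> is itself one of the vectors that \<open>a\<close> is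
  tested against.\<close>

lemma mem_subspace_by_orthogonality:
  assumes H: "fd_hilbert H" and S: "cvec.subspace S" "S \<subseteq> carrier H" and a: "a \<in> carrier H"
    and ort: "\<And>k. k \<in> carrier H \<Longrightarrow> (\<And>b. b \<in> S \<Longrightarrow> ip H b k = 0) \<Longrightarrow> ip H k a = 0"
  shows "a \<in> S"
proof -
  obtain a' where a': "a' \<in> S" "\<And>b. b \<in> S \<Longrightarrow> ip H b (a - a') = 0"
    using orthogonal_projection[OF H S a] by blast
  have pH: "prehilbert H" using H by (rule fd_prehilbert)
  have a'H: "a' \<in> carrier H" using a' S by auto
  have d: "a - a' \<in> carrier H" using pH a a'H by simp
  have "ip H (a - a') a = 0" using ort[OF d] a'(2) by blast
  moreover have "ip H (a - a') a' = 0" using a' ip_cnj[OF pH a'H d] by simp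
  ultimately have "ip H (a - a') (a - a') = 0" using pH a a'H d by (simp add: ip_diff_right)
  then have "a - a' = 0" using ip_self_zero[OF pH d] by simp
  then show ?thesis using a' by simp
qed

section \<open>Bounded operators\<close>

lemma scalars_prehilbert: "prehilbert scalars"
proof -
  have "0 < Re (cnj x * x)" if "x \<noteq> 0" for x
  proof -
    have "cnj x * x = complex_of_real ((cmod x)\<^sup>2)" using complex_norm_square[of x] by (simp add: mult.commute)
    then show ?thesis using that by (simp only: Re_complex_of_real) simp
  qed
  then show ?thesis
    unfolding prehilbert_def scalars_def hspace.select_convs
    by (intro conjI ballI allI impI) (simp_all add: cvec.subspace_UNIV scaleC_complex_def distrib_left)
qed

lemma opsD:
  assumes "a \<in> ops H K"
  shows "x \<in> carrier H \<Longrightarrow> a x \<in> carrier K"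
    "x \<in> carrier H \<Longrightarrow> y \<in> carrier H \<Longrightarrow> a (x + y) = a x + a y"
    "x \<in> carrier H \<Longrightarrow> a (c *C x) = c *C a x"
    "x \<notin> carrier H \<Longrightarrow> a x = 0"
  using assms unfolding ops_def by blast+

lemma ops_zero [simp]: "prehilbert H \<Longrightarrow> a \<in> ops H K \<Longrightarrow> a 0 = 0"
  using opsD(3)[of a H K 0 0] by auto

lemma ops_sum: "prehilbert H \<Longrightarrow> a \<in> ops H K \<Longrightarrow> (\<And>i. i \<in> I \<Longrightarrow> f i \<in> carrier H) \<Longrightarrow>
    a (sum f I) = (\<Sum>i\<in>I. a (f i))"
  by (induction I rule: infinite_finite_induct) (auto simp: opsD(2) carrier_sum)

lemma ops_diff: "prehilbert H \<Longrightarrow> a \<in> ops H K \<Longrightarrow> x \<in> carrier H \<Longrightarrow> y \<in> carrier H \<Longrightarrow> a (x - y) = a x - a y"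
  using opsD(2)[of a H K "x - y" y] by simp

lemma ops_bound:
  assumes "a \<in> ops H K" "prehilbert H"
  obtains C where "C \<ge> 0" "\<And>x. x \<in> carrier H \<Longrightarrow> hnorm K (a x) \<le> C * hnorm H x"
proof -
  obtain C where C: "\<forall>x\<in>carrier H. hnorm K (a x) \<le> C * hnorm H x"
    using assms unfolding ops_def by blast
  have "hnorm K (a x) \<le> max C 0 * hnorm H x" if "x \<in> carrier H" for x
    using C that mult_right_mono[of C "max C 0" "hnorm H x"] hnorm_nonneg[OF assms(2) that] by fastforce
  then show ?thesis using that[of "max C 0"] by auto
qed

lemma opsI:
  assumes "\<And>x. x \<in> carrier H \<Longrightarrow> a x \<in> carrier K"
    "\<And>x y. x \<in> carrier H \<Longrightarrow> y \<in> carrier H \<Longrightarrow> a (x + y) = a x + a y"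
    "\<And>c x. x \<in> carrier H \<Longrightarrow> a (c *C x) = c *C a x"
    "\<And>x. x \<notin> carrier H \<Longrightarrow> a x = 0"
    "\<And>x. x \<in> carrier H \<Longrightarrow> hnorm K (a x) \<le> C * hnorm H x"
  shows "a \<in> ops H K"
  using assms unfolding ops_def by blast

lemma ops_subspace:
  assumes H: "prehilbert H" and K: "prehilbert K"
  shows "cvec.subspace (ops H K)"
proof (rule cvec.subspaceI)
  show "0 \<in> ops H K" using H K by (intro opsI[where C=0]) auto
next
  fix a b assume a: "a \<in> ops H K" and b: "b \<in> ops H K"
  obtain C where C: "\<And>x. x \<in> carrier H \<Longrightarrow> hnorm K (a x) \<le> C * hnorm H x" using ops_bound[OF a H] by blast
  obtain D where D: "\<And>x. x \<in> carrier H \<Longrightarrow> hnorm K (b x) \<le> D * hnorm H x" using ops_bound[OF b H] by blast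
  show "a + b \<in> ops H K"
  proof (rule opsI[where C="C + D"])
    fix x assume x: "x \<in> carrier H"
    have "hnorm K (a x + b x) \<le> hnorm K (a x) + hnorm K (b x)"
      using K x a b by (intro hnorm_triangle) (auto simp: opsD(1))
    then show "hnorm K ((a + b) x) \<le> (C + D) * hnorm H x"
      using C[OF x] D[OF x] by (simp add: distrib_right)
  qed (use K a b in \<open>auto simp: opsD cvec.scale_right_distrib\<close>)
next
  fix c a assume a: "a \<in> ops H K"
  obtain C where C: "\<And>x. x \<in> carrier H \<Longrightarrow> hnorm K (a x) \<le> C * hnorm H x" using ops_bound[OF a H] by blast
  show "c *C a \<in> ops H K"
  proof (rule opsI[where C="cmod c * C"])
    fix x assume x: "x \<in> carrier H"
    show "hnorm K ((c *C a) x) \<le> cmod c * C * hnorm H x"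
      using C[OF x] K a x by (simp add: scaleC_fun_def hnorm_scale opsD(1) mult.assoc mult_left_mono)
  qed (use K a in \<open>auto simp: scaleC_fun_def opsD cvec.scale_right_distrib cvec.scale_left_commute\<close>)
qed

lemma ops_comp:
  assumes H: "prehilbert H" and K: "prehilbert K" and L: "prehilbert L" and a: "a \<in> ops K L" and b: "b \<in> ops H K"
  shows "a \<circ> b \<in> ops H L"
proof -
  obtain C where C: "C \<ge> 0" "\<And>x. x \<in> carrier K \<Longrightarrow> hnorm L (a x) \<le> C * hnorm K x" using ops_bound[OF a K] by blast
  obtain D where D: "\<And>x. x \<in> carrier H \<Longrightarrow> hnorm K (b x) \<le> D * hnorm H x" using ops_bound[OF b H] by blast
  show ?thesis
  proof (rule opsI[where C="C * D"])
    fix x assume x: "x \<in> carrier H"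
    have "hnorm L (a (b x)) \<le> C * hnorm K (b x)" using C b x by (simp add: opsD)
    also have "\<dots> \<le> C * (D * hnorm H x)" using D[OF x] C(1) by (rule mult_left_mono)
    finally show "hnorm L ((a \<circ> b) x) \<le> C * D * hnorm H x" by (simp add: mult.assoc)
  qed (use a b K in \<open>auto simp: opsD\<close>)
qed

lemma ops_eqI:
  "a \<in> ops H K \<Longrightarrow> b \<in> ops H K \<Longrightarrow> (\<And>x. x \<in> carrier H \<Longrightarrow> a x = b x) \<Longrightarrow> a = b"
  by (metis opsD(4) ext)

lemma id_op_in_ops: "prehilbert H \<Longrightarrow> id_op H \<in> ops H H"
  by (rule opsI[where C=1]) (auto simp: id_op_def)

text \<open>The bound comes from expanding the argument in an orthonormal basis.\<close>

lemma fd_opsI: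
  assumes H: "fd_hilbert H" and K: "prehilbert K"
    and 1: "\<And>x. x \<in> carrier H \<Longrightarrow> a x \<in> carrier K"
    "\<And>x y. x \<in> carrier H \<Longrightarrow> y \<in> carrier H \<Longrightarrow> a (x + y) = a x + a y"
    "\<And>c x. x \<in> carrier H \<Longrightarrow> a (c *C x) = c *C a x"
    "\<And>x. x \<notin> carrier H \<Longrightarrow> a x = 0"
  shows "a \<in> ops H K"
proof -
  note pH = fd_prehilbert[OF H]
  obtain B where B: "onb H B" using onb_exists[OF H] by blast
  note B' = onbD[OF B]
  have a0: "a 0 = 0" using 1(3)[of 0 0] pH by simp
  have asum: "a (sum f I) = (\<Sum>i\<in>I. a (f i))" if "\<And>i. i \<in> I \<Longrightarrow> f i \<in> carrier H" for f :: "'a \<Rightarrow> 'a" and I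
    using that by (induction I rule: infinite_finite_induct) (auto simp: 1 a0 carrier_sum pH)
  show ?thesis
  proof (rule opsI[where C="\<Sum>e\<in>B. hnorm H e * hnorm K (a e)"])
    fix x assume x: "x \<in> carrier H"
    have "a x = a (\<Sum>e\<in>B. ip H e x *C e)" using onb_expansion[OF pH B x] by simp
    also have "\<dots> = (\<Sum>e\<in>B. ip H e x *C a e)" using B' pH by (subst asum) (auto simp: 1)
    finally have "hnorm K (a x) \<le> (\<Sum>e\<in>B. hnorm K (ip H e x *C a e))"
      using hnorm_sum[OF K, of B "\<lambda>e. ip H e x *C a e"] B' K 1 by simp
    also have "\<dots> \<le> (\<Sum>e\<in>B. hnorm H e * hnorm K (a e) * hnorm H x)"
    proof (rule sum_mono)
      fix e assume "e \<in> B"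
      then show "hnorm K (ip H e x *C a e) \<le> hnorm H e * hnorm K (a e) * hnorm H x"
        using Cauchy_Schwarz[OF pH _ x, of e] B' K 1
          mult_right_mono[of "cmod (ip H e x)" "hnorm H e * hnorm H x" "hnorm K (a e)"]
        by (simp add: hnorm_scale mult_ac)
    qed
    finally show "hnorm K (a x) \<le> (\<Sum>e\<in>B. hnorm H e * hnorm K (a e)) * hnorm H x"
      by (simp add: sum_distrib_right)
  qed (use 1 in auto)
qed

lemma adj_eqI:
  assumes "prehilbert H" "b \<in> ops K H"
    "\<And>x y. x \<in> carrier H \<Longrightarrow> y \<in> carrier K \<Longrightarrow> ip K (a x) y = ip H x (b y)"
  shows "adj H K a = b"
  unfolding adj_def
proof (rule the_equality)
  fix b' assume b': "b' \<in> ops K H \<and> (\<forall>x\<in>carrier H. \<forall>y\<in>carrier K. ip K (a x) y = ip H x (b' y))"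
  show "b' = b"
  proof (rule ops_eqI)
    show "b' \<in> ops K H" using b' by simp
    fix y assume "y \<in> carrier K"
    with assms b' show "b' y = b y"
      by (intro ip_nondegenerate[OF assms(1)]) (auto simp: opsD)
  qed (use assms in simp)
qed (use assms in auto)

text \<open>Out of a finite-dimensional space, \<open>a\<^sup>\<dagger> y\<close> is \<open>\<Sum>e. \<langle>a e | y\<rangle> e\<close> over an orthonormal basis.\<close>

lemma fd_adj:
  assumes H: "fd_hilbert H" and K: "prehilbert K" and a: "a \<in> ops H K"
  shows "adj H K a \<in> ops K H" (is ?A)
    and "\<And>x y. x \<in> carrier H \<Longrightarrow> y \<in> carrier K \<Longrightarrow> ip K (a x) y = ip H x (adj H K a y)"
proof -
  note pH = fd_prehilbert[OF H]
  obtain B where B: "onb H B" using onb_exists[OF H] by blast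
  note B' = onbD[OF B]
  define b where "b y = (if y \<in> carrier K then \<Sum>e\<in>B. ip K (a e) y *C e else 0)" for y
  have aB: "a e \<in> carrier K" if "e \<in> B" for e using a B' that by (auto simp: opsD)
  have b: "b \<in> ops K H"
  proof (rule opsI[where C="\<Sum>e\<in>B. hnorm K (a e) * hnorm H e"])
    fix y assume y: "y \<in> carrier K"
    have "hnorm H (b y) \<le> (\<Sum>e\<in>B. hnorm H (ip K (a e) y *C e))"
      using y B' pH by (simp add: b_def) (intro hnorm_sum, auto)
    also have "\<dots> \<le> (\<Sum>e\<in>B. hnorm K (a e) * hnorm H e * hnorm K y)"
    proof (rule sum_mono)
      fix e assume e: "e \<in> B"
      then show "hnorm H (ip K (a e) y *C e) \<le> hnorm K (a e) * hnorm H e * hnorm K y"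
        using Cauchy_Schwarz[OF K aB[OF e] y] B' pH
          mult_right_mono[of "cmod (ip K (a e) y)" "hnorm K (a e) * hnorm K y" "hnorm H e"]
        by (simp add: hnorm_scale mult_ac)
    qed
    finally show "hnorm H (b y) \<le> (\<Sum>e\<in>B. hnorm K (a e) * hnorm H e) * hnorm K y"
      by (simp add: sum_distrib_right)
  next
    fix y assume y: "y \<in> carrier K"
    then show "b y \<in> carrier H" using B' pH by (auto simp: b_def intro!: carrier_sum)
  next
    fix y z assume y: "y \<in> carrier K" "z \<in> carrier K"
    then show "b (y + z) = b y + b z" using K aB
      by (simp add: b_def ip_add_right cvec.scale_left_distrib sum.distrib)
  next
    fix c y assume y: "y \<in> carrier K"
    then show "b (c *C y) = c *C b y" using K aB
      by (simp add: b_def ip_scale_right cvec.scale_sum_right)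
  qed (simp add: b_def)
  have eq: "ip K (a x) y = ip H x (b y)" if x: "x \<in> carrier H" and y: "y \<in> carrier K" for x y
  proof -
    have "a x = a (\<Sum>e\<in>B. ip H e x *C e)" using onb_expansion[OF pH B x] by simp
    also have "\<dots> = (\<Sum>e\<in>B. ip H e x *C a e)"
      using B' pH a by (subst ops_sum[OF pH a]) (auto simp: opsD)
    finally have "ip K (a x) y = (\<Sum>e\<in>B. cnj (ip H e x) * ip K (a e) y)"
      using K y aB by (simp add: ip_sum_left ip_scale_left)
    also have "\<dots> = (\<Sum>e\<in>B. ip K (a e) y * ip H x e)"
      using ip_cnj[OF pH B'(3) x] by (intro sum.cong) (simp_all add: mult.commute)
    also have "\<dots> = ip H x (b y)"
      using y x B' pH by (simp add: b_def) (subst ip_sum_right, auto simp: ip_scale_right)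
    finally show ?thesis .
  qed
  have "adj H K a = b" by (rule adj_eqI[OF pH b eq])
  with b eq show ?A "\<And>x y. x \<in> carrier H \<Longrightarrow> y \<in> carrier K \<Longrightarrow> ip K (a x) y = ip H x (adj H K a y)"
    by auto
qed


section \<open>Atoms and the duality pairing\<close>

lemma sum_fun_apply: "(sum f I) x = (\<Sum>i\<in>I. f i x)"
  for f :: "'i \<Rightarrow> 'a \<Rightarrow> 'b::comm_monoid_add"
  by (induction I rule: infinite_finite_induct) auto

lemma dual_dual [simp]: "dual (dual X) = X"
  by (cases X) auto

lemma inj_dual: "inj dual"
  by (metis dual_dual injI)

lemma underlying_dual [simp]: "underlying (dual X) = underlying X"
  by (cases X) auto

text \<open>The representing vector is \<open>f\<^sup>\<dagger> 1\<close>.\<close>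

lemma riesz_ex1:
  assumes H: "fd_hilbert H" and f: "f \<in> ops H scalars"
  shows "\<exists>!v. v \<in> carrier H \<and> (\<forall>x\<in>carrier H. f x = ip H v x)"
proof -
  note pH = fd_prehilbert[OF H]
  note A = fd_adj[OF H scalars_prehilbert f]
  let ?v = "adj H scalars f 1"
  have 1: "(1::complex) \<in> carrier scalars" by (simp add: scalars_def)
  have v: "?v \<in> carrier H" using A(1) 1 by (rule opsD(1))
  have "f x = ip H ?v x" if x: "x \<in> carrier H" for x
  proof -
    have "cnj (f x) = ip H x ?v" using A(2)[OF x 1] by (simp add: scalars_def)
    then show ?thesis using ip_cnj[OF pH x v] by (metis complex_cnj_cnj)
  qed
  moreover have "w = ?v" if "w \<in> carrier H" "\<forall>x\<in>carrier H. f x = ip H w x" for w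
  proof (rule ip_nondegenerate[OF pH that(1) v])
    fix z assume z: "z \<in> carrier H"
    then show "ip H z w = ip H z ?v"
      using ip_cnj[OF pH that(1) z] ip_cnj[OF pH v z] that(2) calculation[OF z] by simp
  qed
  ultimately show ?thesis using v by blast
qed

lemma riesz:
  assumes "fd_hilbert H" "f \<in> ops H scalars"
  shows "riesz H f \<in> carrier H" "x \<in> carrier H \<Longrightarrow> ip H (riesz H f) x = f x"
  using theI'[OF riesz_ex1[OF assms]] by (auto simp: riesz_def)

lemma riesz_eqI:
  assumes "fd_hilbert H" "f \<in> ops H scalars" "v \<in> carrier H" "\<And>x. x \<in> carrier H \<Longrightarrow> f x = ip H v x"
  shows "riesz H f = v"
  using riesz_ex1[OF assms(1,2)] riesz[OF assms(1,2)] assms(3,4) by metis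

text \<open>The functional \<open>\<langle>v|\<close> of bra-ket notation, extended by \<open>0\<close>.\<close>

definition bra :: "'u::cvector hspace \<Rightarrow> 'u \<Rightarrow> 'u \<Rightarrow> complex" where
  "bra H v x = (if x \<in> carrier H then ip H v x else 0)"

lemma bra_in_ops:
  assumes "fd_hilbert H" "v \<in> carrier H"
  shows "bra H v \<in> ops H scalars"
  using fd_prehilbert[OF assms(1)] assms(2)
  by (intro fd_opsI assms(1) scalars_prehilbert)
    (auto simp: bra_def ip_add_right ip_scale_right scaleC_complex_def scalars_def)

lemma riesz_bra: "fd_hilbert H \<Longrightarrow> v \<in> carrier H \<Longrightarrow> riesz H (bra H v) = v"
  by (intro riesz_eqI bra_in_ops) (auto simp: bra_def)

definition fd_atom :: "'v::cvector atom \<Rightarrow> bool" where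
  "fd_atom X \<longleftrightarrow> fd_hilbert (underlying X)"

lemma fd_atom_dual [simp]: "fd_atom (dual X) = fd_atom X"
  by (simp add: fd_atom_def)

text \<open>The inner product of the dual is transported along the Riesz map, which is conjugate linear; this is why its
  arguments are exchanged.  The functionals \<open>\<langle>e|\<close>, for \<open>e\<close> in an orthonormal basis, span.\<close>

lemma hs_Dual_fd:
  assumes H: "fd_hilbert H"
  shows "fd_hilbert (hs (Dual H))"
proof -
  note pH = fd_prehilbert[OF H]
  have sub: "cvec.subspace (ops H scalars)" by (intro ops_subspace pH scalars_prehilbert)
  note rc = riesz(1)[OF H]
  have add: "riesz H (f + g) = riesz H f + riesz H g" if "f \<in> ops H scalars" "g \<in> ops H scalars" for f g
    using that H pH rc by (intro riesz_eqI cvec.subspace_add[OF sub]) (auto simp: ip_add_left riesz)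
  have scale: "riesz H (c *C f) = cnj c *C riesz H f" if "f \<in> ops H scalars" for f c
    using that H pH rc
    by (intro riesz_eqI cvec.subspace_scale[OF sub])
      (auto simp: ip_scale_left riesz scaleC_fun_def scaleC_complex_def)
  have S: "cvec.subspace ({0} \<times> ops H scalars :: ('a \<times> ('a \<Rightarrow> complex)) set)"
    using sub by (auto simp: cvec.subspace_def scaleC_prod_def zero_prod_def)
  have "prehilbert (hs (Dual H))"
    unfolding prehilbert_def hs.simps hspace.select_convs
  proof (intro conjI ballI allI impI S)
    fix f g :: "'a vec" assume "f \<in> {0} \<times> ops H scalars" "g \<in> {0} \<times> ops H scalars"
    then show "ip H (riesz H (snd f)) (riesz H (snd g)) = cnj (ip H (riesz H (snd g)) (riesz H (snd f)))"
      by (intro ip_cnj[OF pH]) (auto intro: rc)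
  next
    fix f :: "'a vec" assume f: "f \<in> {0} \<times> ops H scalars" "f \<noteq> 0"
    have "riesz H (snd f) \<noteq> 0"
    proof
      assume "riesz H (snd f) = 0"
      then have "snd f x = 0" for x
        using riesz(2)[OF H, of "snd f" x] opsD(4)[of "snd f" H scalars x] f pH by (cases "x \<in> carrier H") auto
      then have "f = 0" using f by (auto simp: prod_eq_iff)
      then show False using f by simp
    qed
    then show "0 < Re (ip H (riesz H (snd f)) (riesz H (snd f)))"
      using f by (intro ip_pos pH) (auto intro: rc)
  qed (auto simp: add scale rc ip_add_left[OF pH] ip_scale_left[OF pH] scaleC_prod_def)
  moreover
  obtain B where B: "onb H B" using onb_exists[OF H] by blast
  note B' = onbD[OF B]
  let ?B = "(\<lambda>e. (0::'a, bra H e)) ` B"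
  have "cvec.span ?B = {0} \<times> ops H scalars"
  proof (rule antisym)
    show "cvec.span ?B \<subseteq> {0} \<times> ops H scalars"
      using S B' by (intro cvec.span_minimal) (auto intro!: bra_in_ops H)
    show "{0} \<times> ops H scalars \<subseteq> cvec.span ?B"
    proof
      fix p :: "'a vec" assume p: "p \<in> {0} \<times> ops H scalars"
      define f where "f = snd p"
      have f: "f \<in> ops H scalars" "p = (0, f)" using p by (auto simp: f_def prod_eq_iff)
      have "f = (\<Sum>e\<in>B. f e *C bra H e)"
      proof
        fix x
        show "f x = (\<Sum>e\<in>B. f e *C bra H e) x"
        proof (cases "x \<in> carrier H")
          case True
          have "f x = f (\<Sum>e\<in>B. ip H e x *C e)" using onb_expansion[OF pH B True] by simp
          also have "\<dots> = (\<Sum>e\<in>B. ip H e x *C f e)"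
            using B' pH f by (subst ops_sum[OF pH f(1)]) (auto simp: opsD)
          finally show ?thesis using True
            by (simp add: sum_fun_apply scaleC_fun_def bra_def scaleC_complex_def mult.commute)
        qed (use f in \<open>simp add: sum_fun_apply scaleC_fun_def bra_def scaleC_complex_def opsD\<close>)
      qed
      moreover have "fst (\<Sum>e\<in>B. f e *C (0::'a, bra H e)) = 0"
        by (simp add: fst_sum scaleC_prod_def)
      moreover have "snd (\<Sum>e\<in>B. f e *C (0::'a, bra H e)) = (\<Sum>e\<in>B. f e *C bra H e)"
        by (simp add: snd_sum scaleC_prod_def)
      ultimately have p_eq: "p = (\<Sum>e\<in>B. f e *C (0, bra H e))"
        using f(2) by (simp add: prod_eq_iff)
      show "p \<in> cvec.span ?B" unfolding p_eq
        by (intro cvec.span_sum cvec.span_scale cvec.span_base imageI)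
    qed
  qed
  then have "\<exists>B. finite B \<and> cvec.span B = carrier (hs (Dual H))"
    using B' by (intro exI[of _ ?B]) simp
  ultimately show ?thesis by (simp only: fd_hilbert_iff)
qed

lemma hs_Space_fd:
  assumes H: "fd_hilbert H"
  shows "fd_hilbert (hs (Space H))"
proof -
  note pH = fd_prehilbert[OF H]
  have S: "cvec.subspace (carrier H \<times> {0} :: ('a \<times> ('a \<Rightarrow> complex)) set)"
    using pH by (auto simp: cvec.subspace_def scaleC_prod_def zero_prod_def)
  have "prehilbert (hs (Space H))"
    unfolding prehilbert_def hs.simps hspace.select_convs
  proof (intro conjI ballI allI impI S)
    fix f g :: "'a vec" assume "f \<in> carrier H \<times> {0}" "g \<in> carrier H \<times> {0}"
    then show "ip H (fst g) (fst f) = cnj (ip H (fst f) (fst g))"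
      by (intro ip_cnj[OF pH]) auto
  qed (auto simp: ip_add_right[OF pH] ip_scale_right[OF pH] scaleC_prod_def prod_eq_iff intro: ip_pos[OF pH])
  moreover
  obtain B where B: "finite B" "cvec.span B = carrier H" using H by (auto simp: fd_hilbert_iff)
  let ?B = "(\<lambda>e. (e, 0::'a \<Rightarrow> complex)) ` B"
  have "cvec.span ?B = carrier H \<times> {0}"
  proof (rule antisym)
    show "cvec.span ?B \<subseteq> carrier H \<times> {0}"
      using S B cvec.span_superset[of B] by (intro cvec.span_minimal) auto
    show "carrier H \<times> {0} \<subseteq> cvec.span ?B"
    proof
      fix p :: "'a vec" assume p: "p \<in> carrier H \<times> {0}"
      then have p': "fst p \<in> cvec.span B" "snd p = 0" by (simp_all only: B(2) mem_Times_iff singleton_iff)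
      obtain c where c: "fst p = (\<Sum>e\<in>B. c e *C e)"
        using p'(1) unfolding cvec.span_finite[OF B(1)] by (rule imageE)
      have p_eq: "p = (\<Sum>e\<in>B. c e *C (e, 0))"
        using c p'(2) by (simp add: prod_eq_iff fst_sum snd_sum scaleC_prod_def)
      show "p \<in> cvec.span ?B" unfolding p_eq
        by (intro cvec.span_sum cvec.span_scale cvec.span_base imageI)
    qed
  qed
  then have "\<exists>B. finite B \<and> cvec.span B = carrier (hs (Space H))"
    using B by (intro exI[of _ ?B]) simp
  ultimately show ?thesis by (simp only: fd_hilbert_iff)
qed

lemma hs_fd: "fd_atom X \<Longrightarrow> fd_hilbert (hs X)"
  by (cases X) (simp_all only: fd_atom_def underlying.simps hs_Space_fd hs_Dual_fd)

lemma hs_prehilbert: "fd_atom X \<Longrightarrow> prehilbert (hs X)"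
  by (intro fd_prehilbert hs_fd)

lemma pairing_dual: "pairing (dual X) f x = pairing X x f"
  by (cases X) auto

lemma pairing_left:
  assumes "fd_atom X" "f \<in> carrier (hs (dual X))"
  shows "x \<in> carrier (hs X) \<Longrightarrow> y \<in> carrier (hs X) \<Longrightarrow> pairing X (x + y) f = pairing X x f + pairing X y f"
    "x \<in> carrier (hs X) \<Longrightarrow> pairing X (c *C x) f = c * pairing X x f"
  using assms
  by (cases X; auto simp: opsD scaleC_prod_def scaleC_complex_def scaleC_fun_def)+

lemma pairing_right:
  assumes "fd_atom X" "x \<in> carrier (hs X)"
  shows "f \<in> carrier (hs (dual X)) \<Longrightarrow> g \<in> carrier (hs (dual X)) \<Longrightarrow> pairing X x (f + g) = pairing X x f + pairing X x g"
    "f \<in> carrier (hs (dual X)) \<Longrightarrow> pairing X x (c *C f) = c * pairing X x f"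
  using pairing_left[of "dual X" x] assms by (simp_all add: pairing_dual)

lemma riesz_vec_ex1:
  assumes X: "fd_atom X" and f: "f \<in> carrier (hs (dual X))"
  shows "\<exists>!v. v \<in> carrier (hs X) \<and> (\<forall>x\<in>carrier (hs X). pairing X x f = ip (hs X) v x)"
proof -
  let ?f = "\<lambda>x. if x \<in> carrier (hs X) then pairing X x f else 0"
  note pX = hs_prehilbert[OF X]
  have "?f \<in> ops (hs X) scalars"
    by (intro fd_opsI hs_fd X scalars_prehilbert)
      (auto simp: pairing_left[OF X f] scaleC_complex_def pX, simp add: scalars_def)
  from riesz_ex1[OF hs_fd[OF X] this] show ?thesis by simp
qed

lemma riesz_vec:
  assumes "fd_atom X" "f \<in> carrier (hs (dual X))"
  shows "riesz_vec X f \<in> carrier (hs X)" "x \<in> carrier (hs X) \<Longrightarrow> ip (hs X) (riesz_vec X f) x = pairing X x f"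
  using theI'[OF riesz_vec_ex1[OF assms]] by (auto simp: riesz_vec_def)

lemma riesz_vec_eqI:
  assumes "fd_atom X" "f \<in> carrier (hs (dual X))"
    "v \<in> carrier (hs X)" "\<And>x. x \<in> carrier (hs X) \<Longrightarrow> pairing X x f = ip (hs X) v x"
  shows "riesz_vec X f = v"
  using riesz_vec_ex1[OF assms(1,2)] riesz_vec[OF assms(1,2)] assms(3,4) by metis

lemma ip_riesz_vec_right:
  assumes "fd_atom X" "f \<in> carrier (hs (dual X))" "x \<in> carrier (hs X)"
  shows "ip (hs X) x (riesz_vec X f) = cnj (pairing X x f)"
  using ip_cnj[OF hs_prehilbert[OF assms(1)] riesz_vec(1)[OF assms(1,2)] assms(3)]
    riesz_vec(2)[OF assms] by simp

text \<open>For an atom \<open>H\<close> this is the definition of the inner product of \<open>H\<^sup>*\<close>; for an atom \<open>H\<^sup>*\<close>, the correspondence is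
  \<open>v \<mapsto> \<langle>v|\<close>, the inverse of the map that this definition uses.\<close>

lemma riesz_vec_ip:
  assumes X: "fd_atom X" and f: "f \<in> carrier (hs (dual X))" and g: "g \<in> carrier (hs (dual X))"
  shows "ip (hs (dual X)) f g = ip (hs X) (riesz_vec X g) (riesz_vec X f)"
proof (cases X)
  case (Space H)
  have H: "fd_hilbert H" using X Space by (simp add: fd_atom_def)
  have "riesz_vec X f = (riesz H (snd f), 0)" if "f \<in> carrier (hs (dual X))" for f
    using that Space H by (intro riesz_vec_eqI X) (auto simp: riesz)
  then show ?thesis using Space f g by simp
next
  case (Dual H)
  have H: "fd_hilbert H" using X Dual by (simp add: fd_atom_def)
  have "riesz_vec X f = (0, bra H (fst f))" if f: "f \<in> carrier (hs (dual X))" for f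
  proof (intro riesz_vec_eqI X f)
    show "(0, bra H (fst f)) \<in> carrier (hs X)" using f Dual H by (auto intro: bra_in_ops)
    fix x assume x: "x \<in> carrier (hs X)"
    then show "pairing X x f = ip (hs X) (0, bra H (fst f)) x"
      using f Dual H by (auto simp: riesz_bra riesz)
  qed
  then show ?thesis using Dual f g H by (auto simp: riesz_bra)
qed

lemma pairing_separates:
  assumes X: "fd_atom X" and "z \<in> carrier (hs X)" "w \<in> carrier (hs X)"
    and eq: "\<And>g. g \<in> carrier (hs (dual X)) \<Longrightarrow> pairing X z g = pairing X w g"
  shows "z = w"
proof (cases X)
  case (Space H)
  then have H: "fd_hilbert H" using X by (simp add: fd_atom_def)
  have "fst z = fst w"
  proof (rule ip_nondegenerate[OF fd_prehilbert[OF H]])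
    fix v assume v: "v \<in> carrier H"
    then show "ip H v (fst z) = ip H v (fst w)"
      using eq[of "(0, bra H v)"] Space assms(2,3) bra_in_ops[OF H v] by (auto simp: bra_def)
  qed (use Space assms in auto)
  then show ?thesis using Space assms by (auto simp: prod_eq_iff)
next
  case (Dual H)
  then have "snd z = snd w" using assms eq[of "(v, 0)" for v]
    by (intro ops_eqI[of _ H scalars]) auto
  then show ?thesis using Dual assms by (auto simp: prod_eq_iff)
qed

text \<open>By antiunitarity, the vectors that represent an orthonormal basis of \<open>X\<^sup>*\<close> form an orthonormal basis of \<open>X\<close>.  This
  resolution of the identity is what makes a contraction over \<open>X \<otimes> X\<^sup>*\<close> a composition of operators.\<close>

lemma dual_onb_expansion:
  assumes X: "fd_atom X" and F: "onb (hs (dual X)) F" and z: "z \<in> carrier (hs X)"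
  shows "z = (\<Sum>f\<in>F. pairing X z f *C riesz_vec X f)"
proof (rule pairing_separates[OF X z])
  note pX = hs_prehilbert[OF X] and pX' = hs_prehilbert[of "dual X"]
  note F' = onbD[OF F]
  have rF: "riesz_vec X f \<in> carrier (hs X)" if "f \<in> F" for f
    using F' that X by (simp add: riesz_vec)
  show "(\<Sum>f\<in>F. pairing X z f *C riesz_vec X f) \<in> carrier (hs X)"
    using pX rF by (intro carrier_sum) auto
  fix g assume g: "g \<in> carrier (hs (dual X))"
  have rg: "riesz_vec X g \<in> carrier (hs X)" using X g by (simp add: riesz_vec)
  have "g = (\<Sum>f\<in>F. ip (hs (dual X)) f g *C f)"
    using onb_expansion[OF _ F g] pX' X by simp
  then have "pairing X z g = pairing X z (\<Sum>f\<in>F. ip (hs (dual X)) f g *C f)" by simp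
  also have "\<dots> = (\<Sum>f\<in>F. ip (hs (dual X)) f g * pairing X z f)"
  proof -
    have "pairing X z (\<Sum>f\<in>F'. h f) = (\<Sum>f\<in>F'. pairing X z (h f))"
      if "\<And>f. f \<in> F' \<Longrightarrow> h f \<in> carrier (hs (dual X))" for F' :: "'a vec set" and h
      using that
    proof (induction F' rule: infinite_finite_induct)
      case empty show ?case using pairing_right(2)[OF X z, of 0 0] pX' X by simp
    next
      case (infinite A) then show ?case using pairing_right(2)[OF X z, of 0 0] pX' X by simp
    next
      case (insert f F')
      then show ?case using pX' X by (simp add: pairing_right[OF X z] carrier_sum)
    qed
    then show ?thesis using F' pX' X by (simp add: pairing_right[OF X z])
  qed
  also have "\<dots> = (\<Sum>f\<in>F. pairing X z f * ip (hs X) (riesz_vec X g) (riesz_vec X f))"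
    using F' g by (intro sum.cong refl) (simp add: riesz_vec_ip[OF X] mult.commute)
  also have "\<dots> = ip (hs X) (riesz_vec X g) (\<Sum>f\<in>F. pairing X z f *C riesz_vec X f)"
    using pX rg rF by (subst ip_sum_right) (auto simp: ip_scale_right)
  also have "\<dots> = pairing X (\<Sum>f\<in>F. pairing X z f *C riesz_vec X f) g"
    using pX rF by (intro riesz_vec(2)[OF X g] carrier_sum) auto
  finally show "pairing X z g = pairing X (\<Sum>f\<in>F. pairing X z f *C riesz_vec X f) g" .
qed

lemma riesz_vec_expansion:
  assumes X: "fd_atom X" and B: "onb (hs X) B" and g: "g \<in> carrier (hs (dual X))"
  shows "riesz_vec X g = (\<Sum>e\<in>B. cnj (pairing X e g) *C e)"
proof -
  have "riesz_vec X g = (\<Sum>e\<in>B. ip (hs X) e (riesz_vec X g) *C e)"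
    by (intro onb_expansion[OF hs_prehilbert B] X riesz_vec(1) g)
  also have "\<dots> = (\<Sum>e\<in>B. cnj (pairing X e g) *C e)"
    using onbD[OF B] by (intro sum.cong refl) (simp add: ip_riesz_vec_right[OF X g])
  finally show ?thesis .
qed


section \<open>Multilinear forms\<close>

lemma in_listset_iff: "xs \<in> listset As \<longleftrightarrow> list_all2 (\<in>) xs As"
  by (induction As arbitrary: xs) (auto simp: set_Cons_def list_all2_Cons2)

lemma listset_Cons: "listset (A # As) = (\<lambda>p. fst p # snd p) ` (A \<times> listset As)"
  by (force simp: set_Cons_def)

lemma sum_listset_Cons:
  "(\<Sum>es\<in>listset (A # As). f es) = (\<Sum>e\<in>A. \<Sum>es\<in>listset As. f (e # es))"
proof -
  have "inj_on (\<lambda>p. fst p # snd p) (A \<times> listset As)"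
    by (auto intro: inj_onI)
  then show ?thesis
    by (simp add: listset_Cons sum.reindex sum.cartesian_product case_prod_beta del: listset.simps(2))
qed

lemma sum_listset_append:
  "(\<Sum>es\<in>listset (As @ Bs). f es) = (\<Sum>es\<in>listset As. \<Sum>fs\<in>listset Bs. f (es @ fs))"
  by (induction As arbitrary: f) (simp_all add: sum_listset_Cons del: listset.simps(2))

lemma finite_listset: "(\<And>A. A \<in> set As \<Longrightarrow> finite A) \<Longrightarrow> finite (listset As)"
  by (induction As) (simp_all add: listset_Cons del: listset.simps(2))

lemma tuples_iff: "xs \<in> tuples Xs \<longleftrightarrow> list_all2 (\<lambda>x X. x \<in> carrier (hs X)) xs Xs"
  by (simp add: tuples_def in_listset_iff list_all2_map2)

lemma tuples_nth: "xs \<in> tuples Xs \<longleftrightarrow> length xs = length Xs \<and> (\<forall>i<length Xs. xs ! i \<in> carrier (hs (Xs ! i)))"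
  by (auto simp: tuples_iff list_all2_conv_all_nth)

lemma tuples_simps [simp]:
  "xs \<in> tuples [] \<longleftrightarrow> xs = []"
  "x # xs \<in> tuples (X # Xs) \<longleftrightarrow> x \<in> carrier (hs X) \<and> xs \<in> tuples Xs"
  "[] \<notin> tuples (X # Xs)"
  by (auto simp: tuples_iff)

lemma tuples_Cons: "xs \<in> tuples (X # Xs) \<longleftrightarrow> (\<exists>y ys. xs = y # ys \<and> y \<in> carrier (hs X) \<and> ys \<in> tuples Xs)"
  by (auto simp: tuples_iff list_all2_Cons2)

lemma tuples_length: "xs \<in> tuples Xs \<Longrightarrow> length xs = length Xs"
  by (simp add: tuples_nth)

lemma tuples_append: "length xs = length Xs \<Longrightarrow> xs @ ys \<in> tuples (Xs @ Ys) \<longleftrightarrow> xs \<in> tuples Xs \<and> ys \<in> tuples Ys"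
  by (simp add: tuples_iff list_all2_append)

lemma tuples_append_right: "ys \<in> tuples Ys \<Longrightarrow> xs @ ys \<in> tuples (Xs @ Ys) \<longleftrightarrow> xs \<in> tuples Xs"
  by (metis append_eq_append_conv tuples_length tuples_append length_append add_right_cancel)

lemma tuples_split: "xs \<in> tuples (Xs @ Ys) \<longleftrightarrow> take (length Xs) xs \<in> tuples Xs \<and> drop (length Xs) xs \<in> tuples Ys"
proof
  assume xs: "xs \<in> tuples (Xs @ Ys)"
  then have "length (take (length Xs) xs) = length Xs" using tuples_length[OF xs] by simp
  then show "take (length Xs) xs \<in> tuples Xs \<and> drop (length Xs) xs \<in> tuples Ys"
    using tuples_append[of "take (length Xs) xs" Xs "drop (length Xs) xs" Ys] xs by simp
next
  assume a: "take (length Xs) xs \<in> tuples Xs \<and> drop (length Xs) xs \<in> tuples Ys"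
  then show "xs \<in> tuples (Xs @ Ys)"
    using tuples_append[OF tuples_length, of "take (length Xs) xs" Xs "drop (length Xs) xs" Ys] by simp
qed

lemma tuples_update: "xs \<in> tuples Xs \<Longrightarrow> i < length Xs \<Longrightarrow> y \<in> carrier (hs (Xs ! i)) \<Longrightarrow> xs[i := y] \<in> tuples Xs"
  by (auto simp: tuples_nth nth_list_update)

text \<open>The definition of forms perturbs the entry that a tuple already has.  The following two rules speak about replacing
  an entry instead, and so compose with slicing, tensor products and permutations of the arguments.\<close>

lemma formsI:
  assumes "\<And>xs. xs \<notin> tuples Xs \<Longrightarrow> r xs = 0"
    and "\<And>xs i y z. xs \<in> tuples Xs \<Longrightarrow> i < length Xs \<Longrightarrow> y \<in> carrier (hs (Xs ! i)) \<Longrightarrow> z \<in> carrier (hs (Xs ! i)) \<Longrightarrow>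
      r (xs[i := y + z]) = r (xs[i := y]) + r (xs[i := z])"
    and "\<And>xs i y c. xs \<in> tuples Xs \<Longrightarrow> i < length Xs \<Longrightarrow> y \<in> carrier (hs (Xs ! i)) \<Longrightarrow>
      r (xs[i := c *C y]) = c * r (xs[i := y])"
  shows "r \<in> forms Xs"
  unfolding forms_def
proof (intro CollectI conjI ballI allI impI)
  fix xs i y c assume "xs \<in> tuples Xs" "i < length Xs" "y \<in> carrier (hs (Xs ! i))"
  moreover from this have "xs ! i \<in> carrier (hs (Xs ! i))" by (simp add: tuples_nth)
  ultimately show "r (xs[i := xs ! i + y]) = r xs + r (xs[i := y])" "r (xs[i := c *C xs ! i]) = c * r xs"
    using assms(2)[of xs i "xs ! i" y] assms(3)[of xs i "xs ! i" c] by simp_all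
qed (use assms(1) in blast)

lemma formsD:
  assumes r: "r \<in> forms Xs"
  shows "xs \<notin> tuples Xs \<Longrightarrow> r xs = 0"
    "xs \<in> tuples Xs \<Longrightarrow> i < length Xs \<Longrightarrow> y \<in> carrier (hs (Xs ! i)) \<Longrightarrow> z \<in> carrier (hs (Xs ! i)) \<Longrightarrow>
      r (xs[i := y + z]) = r (xs[i := y]) + r (xs[i := z])"
    "xs \<in> tuples Xs \<Longrightarrow> i < length Xs \<Longrightarrow> y \<in> carrier (hs (Xs ! i)) \<Longrightarrow>
      r (xs[i := c *C y]) = c * r (xs[i := y])"
proof -
  show "xs \<notin> tuples Xs \<Longrightarrow> r xs = 0" using r by (simp add: forms_def)
  assume xs: "xs \<in> tuples Xs" and i: "i < length Xs" and y: "y \<in> carrier (hs (Xs ! i))"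
  have u: "xs[i := y] \<in> tuples Xs" using xs i y by (rule tuples_update)
  have n: "xs[i := y] ! i = y" using i tuples_length[OF xs] by simp
  have *: "\<forall>z\<in>carrier (hs (Xs ! i)). \<forall>c. r ((xs[i := y])[i := xs[i := y] ! i + z]) = r (xs[i := y]) + r ((xs[i := y])[i := z]) \<and>
        r ((xs[i := y])[i := c *C xs[i := y] ! i]) = c * r (xs[i := y])"
    using r u i unfolding forms_def by blast
  show "r (xs[i := c *C y]) = c * r (xs[i := y])" using bspec[OF * y] n by simp
  assume z: "z \<in> carrier (hs (Xs ! i))"
  show "r (xs[i := y + z]) = r (xs[i := y]) + r (xs[i := z])" using bspec[OF * z] n by simp
qed

lemma forms_subspace: "cvec.subspace (forms Xs)"
  by (rule cvec.subspaceI; rule formsI)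
    (simp_all add: formsD scaleC_fun_def scaleC_complex_def algebra_simps)

lemma forms_prefix_slice:
  assumes r: "r \<in> forms (Xs @ Ys)" and ys: "ys \<in> tuples Ys"
  shows "(\<lambda>xs. r (xs @ ys)) \<in> forms Xs"
proof (rule formsI)
  fix xs assume "xs \<notin> tuples Xs"
  then show "r (xs @ ys) = 0" using formsD(1)[OF r] tuples_append_right[OF ys] by blast
next
  fix xs i y z assume a: "xs \<in> tuples Xs" "i < length Xs" "y \<in> carrier (hs (Xs ! i))" "z \<in> carrier (hs (Xs ! i))"
  then show "r (xs[i := y + z] @ ys) = r (xs[i := y] @ ys) + r (xs[i := z] @ ys)"
    using formsD(2)[OF r, of "xs @ ys" i y z] ys tuples_length[OF a(1)]
    by (simp add: tuples_append nth_append list_update_append)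
next
  fix xs i y c assume a: "xs \<in> tuples Xs" "i < length Xs" "y \<in> carrier (hs (Xs ! i))"
  then show "r (xs[i := c *C y] @ ys) = c * r (xs[i := y] @ ys)"
    using formsD(3)[OF r, of "xs @ ys" i y c] ys tuples_length[OF a(1)]
    by (simp add: tuples_append nth_append list_update_append)
qed

lemma forms_suffix_slice:
  assumes r: "r \<in> forms (Xs @ Ys)" and xs: "xs \<in> tuples Xs"
  shows "(\<lambda>ys. r (xs @ ys)) \<in> forms Ys"
proof (rule formsI)
  fix ys assume "ys \<notin> tuples Ys"
  then show "r (xs @ ys) = 0" using formsD(1)[OF r] tuples_append[OF tuples_length[OF xs]] by blast
next
  fix ys i y z assume a: "ys \<in> tuples Ys" "i < length Ys" "y \<in> carrier (hs (Ys ! i))" "z \<in> carrier (hs (Ys ! i))"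
  then show "r (xs @ ys[i := y + z]) = r (xs @ ys[i := y]) + r (xs @ ys[i := z])"
    using formsD(2)[OF r, of "xs @ ys" "length Xs + i" y z] xs tuples_length[OF xs]
    by (simp add: tuples_append nth_append list_update_append)
next
  fix ys i y c assume a: "ys \<in> tuples Ys" "i < length Ys" "y \<in> carrier (hs (Ys ! i))"
  then show "r (xs @ ys[i := c *C y]) = c * r (xs @ ys[i := y])"
    using formsD(3)[OF r, of "xs @ ys" "length Xs + i" y c] xs tuples_length[OF xs]
    by (simp add: tuples_append nth_append list_update_append)
qed

subsection \<open>Tensor products of forms\<close>

definition tensor :: "nat \<Rightarrow> 'v::cvector form \<Rightarrow> 'v form \<Rightarrow> 'v form" where
  "tensor n r s = (\<lambda>xs. r (take n xs) * s (drop n xs))"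

lemma tensor_append [simp]: "length xs = n \<Longrightarrow> tensor n r s (xs @ ys) = r xs * s ys"
  by (simp add: tensor_def)

lemma tensor_in_forms:
  assumes r: "r \<in> forms Xs" and s: "s \<in> forms Ys" and n: "n = length Xs"
  shows "tensor n r s \<in> forms (Xs @ Ys)"
proof (rule formsI)
  fix xs assume "xs \<notin> tuples (Xs @ Ys)"
  then show "tensor n r s xs = 0"
    using formsD(1)[OF r] formsD(1)[OF s] n by (auto simp: tensor_def tuples_split)
next
  fix xs i y z assume a: "xs \<in> tuples (Xs @ Ys)" "i < length (Xs @ Ys)"
    "y \<in> carrier (hs ((Xs @ Ys) ! i))" "z \<in> carrier (hs ((Xs @ Ys) ! i))"
  show "tensor n r s (xs[i := y + z]) = tensor n r s (xs[i := y]) + tensor n r s (xs[i := z])"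
  proof (cases "i < n")
    case True
    then show ?thesis using a formsD(2)[OF r, of "take n xs" i y z] n
      by (simp add: tensor_def tuples_split nth_append take_update_swap algebra_simps)
  next
    case False
    then have "i - n < length Ys" using a n by auto
    then show ?thesis using False a formsD(2)[OF s, of "drop n xs" "i - n" y z] n
      by (simp add: tensor_def tuples_split nth_append drop_update_swap algebra_simps)
  qed
next
  fix xs i y c assume a: "xs \<in> tuples (Xs @ Ys)" "i < length (Xs @ Ys)" "y \<in> carrier (hs ((Xs @ Ys) ! i))"
  show "tensor n r s (xs[i := c *C y]) = c * tensor n r s (xs[i := y])"
  proof (cases "i < n")
    case True
    then show ?thesis using a formsD(3)[OF r, of "take n xs" i y c] n
      by (simp add: tensor_def tuples_split nth_append take_update_swap)
  next
    case False
    then have "i - n < length Ys" using a n by auto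
    then show ?thesis using False a formsD(3)[OF s, of "drop n xs" "i - n" y c] n
      by (simp add: tensor_def tuples_split nth_append drop_update_swap)
  qed
qed

lemma tensor_linear:
  "tensor n (r + r') s = tensor n r s + tensor n r' s" "tensor n r (s + s') = tensor n r s + tensor n r s'"
  "tensor n (c *C r) s = c *C tensor n r s" "tensor n r (c *C s) = c *C tensor n r s"
  by (auto simp: tensor_def scaleC_fun_def scaleC_complex_def algebra_simps)

lemma tensor_zero [simp]: "tensor n 0 s = 0" "tensor n r 0 = 0"
  by (auto simp: tensor_def)

lemma times_rel_tensor: "times_rel n R S Xs = cvec.span {tensor n r s | r s. r \<in> R (take n Xs) \<and> s \<in> S (drop n Xs)}"
  by (simp add: times_rel_def tensor_def)

subsection \<open>The inner product of forms\<close>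

abbreviation fd_atoms :: "'v::cvector atom list \<Rightarrow> bool" where
  "fd_atoms Xs \<equiv> list_all fd_atom Xs"

abbreviation basis :: "'v::cvector atom \<Rightarrow> 'v vec set" where
  "basis X \<equiv> some_onb (hs X)"

definition bases :: "'v::cvector atom list \<Rightarrow> 'v vec list set" where
  "bases Xs = listset (map basis Xs)"

lemma onb_basis: "fd_atom X \<Longrightarrow> onb (hs X) (basis X)"
  by (intro some_onb hs_fd)

lemma basis_carrier: "fd_atom X \<Longrightarrow> e \<in> basis X \<Longrightarrow> e \<in> carrier (hs X)"
  using onbD(3)[OF onb_basis] by blast

lemma finite_basis: "fd_atom X \<Longrightarrow> finite (basis X)"
  using onbD(1)[OF onb_basis] by blast

lemma finite_bases: "fd_atoms Xs \<Longrightarrow> finite (bases Xs)"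
  unfolding bases_def by (rule finite_listset) (auto simp: list_all_iff finite_basis)

lemma bases_tuples: "fd_atoms Xs \<Longrightarrow> es \<in> bases Xs \<Longrightarrow> es \<in> tuples Xs"
  unfolding bases_def tuples_iff in_listset_iff list_all2_map2
  by (auto simp: list_all2_conv_all_nth list_all_length basis_carrier)

lemma sum_bases_Nil [simp]: "(\<Sum>es\<in>bases []. f es) = f []"
  and sum_bases_Cons [simp]: "(\<Sum>es\<in>bases (X # Xs). f es) = (\<Sum>e\<in>basis X. \<Sum>es\<in>bases Xs. f (e # es))"
  and sum_bases_append: "(\<Sum>es\<in>bases (Xs @ Ys). f es) = (\<Sum>es\<in>bases Xs. \<Sum>fs\<in>bases Ys. f (es @ fs))"
  by (simp_all add: bases_def sum_listset_Cons sum_listset_append del: listset.simps(2))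

lemma form_ip_bases: "form_ip Xs a b = (\<Sum>es\<in>bases Xs. cnj (a es) * b es)"
  by (simp add: form_ip_def bases_def)

text \<open>For \<open>es\<close> in the product basis these are the elements of the dual basis, so they span the space of forms.\<close>

fun elementary :: "'v::cvector atom list \<Rightarrow> 'v vec list \<Rightarrow> 'v form" where
  "elementary (X # Xs) (e # es) (x # xs) = bra (hs X) e x * elementary Xs es xs"
| "elementary [] [] [] = 1"
| "elementary _ _ _ = 0"

lemma elementary_in_forms:
  assumes "fd_atoms Xs" "es \<in> tuples Xs"
  shows "elementary Xs es \<in> forms Xs"
  using assms
proof (induction Xs arbitrary: es)
  case Nil
  have "elementary [] [] xs = 0" if "xs \<noteq> []" for xs using that by (cases xs) auto
  then show ?case using Nil by (intro formsI) auto
next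
  case (Cons X Xs)
  then obtain e es' where es: "es = e # es'" "e \<in> carrier (hs X)" "es' \<in> tuples Xs" by (auto simp: tuples_Cons)
  have X: "fd_atom X" using Cons by simp
  have b: "bra (hs X) e \<in> ops (hs X) scalars" by (intro bra_in_ops hs_fd X es)
  define r where "r = (\<lambda>xs. case xs of [x] \<Rightarrow> bra (hs X) e x | _ \<Rightarrow> 0)"
  have r: "r \<in> forms [X]"
  proof (rule formsI)
    fix xs assume "xs \<notin> tuples [X]"
    then show "r xs = 0" using opsD(4)[OF b]
      by (auto simp: r_def tuples_Cons split: list.splits)
  qed (use opsD[OF b] in \<open>auto simp: r_def tuples_Cons scaleC_complex_def\<close>)
  have "elementary (X # Xs) (e # es') = tensor 1 r (elementary Xs es')"
  proof
    fix xs show "elementary (X # Xs) (e # es') xs = tensor 1 r (elementary Xs es') xs"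
      by (cases xs) (auto simp: tensor_def r_def)
  qed
  then show ?case using tensor_in_forms[OF r Cons.IH[of es'], of 1] Cons es by simp
qed

lemma form_expansion:
  assumes "fd_atoms Xs" "a \<in> forms Xs" "xs \<in> tuples Xs"
  shows "a xs = (\<Sum>es\<in>bases Xs. elementary Xs es xs * a es)"
  using assms
proof (induction Xs arbitrary: a xs)
  case (Cons X Xs)
  then obtain x xs' where xs: "xs = x # xs'" "x \<in> carrier (hs X)" "xs' \<in> tuples Xs" by (auto simp: tuples_Cons)
  have X: "fd_atom X" and Xs: "fd_atoms Xs" using Cons by simp_all
  note pX = hs_prehilbert[OF X]
  have add: "a ((y + z) # xs') = a (y # xs') + a (z # xs')" if "y \<in> carrier (hs X)" "z \<in> carrier (hs X)" for y z
    using formsD(2)[OF Cons.prems(2,3), of 0 y z] xs that by simp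
  have scale: "a ((c *C y) # xs') = c * a (y # xs')" if "y \<in> carrier (hs X)" for c y
    using formsD(3)[OF Cons.prems(2,3), of 0 y c] xs that by simp
  have a0: "a (0 # xs') = 0" using scale[of 0 0] pX by simp
  have asum: "a (sum f I # xs') = (\<Sum>i\<in>I. a (f i # xs'))" if "\<And>i. i \<in> I \<Longrightarrow> f i \<in> carrier (hs X)"
    for f :: "'a vec \<Rightarrow> 'a vec" and I
    using that by (induction I rule: infinite_finite_induct) (auto simp: add a0 carrier_sum pX)
  have "a xs = a ((\<Sum>e\<in>basis X. ip (hs X) e x *C e) # xs')"
    using onb_expansion[OF pX onb_basis[OF X] xs(2)] xs by simp
  also have "\<dots> = (\<Sum>e\<in>basis X. ip (hs X) e x * a (e # xs'))"
    using basis_carrier[OF X] pX by (subst asum) (auto simp: scale)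
  also have "\<dots> = (\<Sum>e\<in>basis X. ip (hs X) e x * (\<Sum>es\<in>bases Xs. elementary Xs es xs' * a (e # es)))"
  proof (intro sum.cong refl arg_cong2[where f = "(*)"])
    fix e assume e: "e \<in> basis X"
    have "(\<lambda>ys. a ([e] @ ys)) \<in> forms Xs"
      using Cons.prems(2) basis_carrier[OF X e] by (intro forms_suffix_slice[of _ "[X]"]) auto
    from Cons.IH[OF Xs this xs(3)]
    show "a (e # xs') = (\<Sum>es\<in>bases Xs. elementary Xs es xs' * a (e # es))" by simp
  qed
  also have "\<dots> = (\<Sum>es\<in>bases (X # Xs). elementary (X # Xs) es xs * a es)"
    using xs by (simp add: sum_distrib_left bra_def mult.assoc)
  finally show ?case .
qed simp

lemma forms_eqI:
  assumes Xs: "fd_atoms Xs" and a: "a \<in> forms Xs" and b: "b \<in> forms Xs"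
    and eq: "\<And>es. es \<in> bases Xs \<Longrightarrow> a es = b es"
  shows "a = b"
proof
  fix xs show "a xs = b xs"
    using form_expansion[OF Xs a, of xs] form_expansion[OF Xs b, of xs] formsD(1)[OF a, of xs] formsD(1)[OF b, of xs] eq
    by (cases "xs \<in> tuples Xs") (auto intro: sum.cong)
qed

definition form_space :: "'v::cvector atom list \<Rightarrow> 'v form hspace" where
  "form_space Xs = \<lparr>carrier = forms Xs, ip = form_ip Xs\<rparr>"

lemma form_space_sel [simp]: "carrier (form_space Xs) = forms Xs" "ip (form_space Xs) = form_ip Xs"
  by (simp_all add: form_space_def)

lemma form_space_fd:
  assumes Xs: "fd_atoms Xs"
  shows "fd_hilbert (form_space Xs)"
proof -
  have "prehilbert (form_space Xs)"
    unfolding prehilbert_def form_space_sel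
  proof (intro conjI ballI allI impI forms_subspace)
    fix a :: "'a form" assume a: "a \<in> forms Xs" "a \<noteq> 0"
    have "form_ip Xs a a = complex_of_real (\<Sum>es\<in>bases Xs. (cmod (a es))\<^sup>2)"
      using complex_norm_square by (simp add: form_ip_bases mult.commute flip: of_real_power)
    moreover have "(\<Sum>es\<in>bases Xs. (cmod (a es))\<^sup>2) \<noteq> 0"
    proof
      assume "(\<Sum>es\<in>bases Xs. (cmod (a es))\<^sup>2) = 0"
      then have "a es = 0" if "es \<in> bases Xs" for es
        using that finite_bases[OF Xs] by (subst (asm) sum_nonneg_eq_0_iff) auto
      then have "a = 0" by (intro forms_eqI[OF Xs a(1)] cvec.subspace_0 forms_subspace) auto
      then show False using a by simp
    qed
    moreover have "(\<Sum>es\<in>bases Xs. (cmod (a es))\<^sup>2) \<ge> 0" by (intro sum_nonneg) auto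
    ultimately show "0 < Re (form_ip Xs a a)" by simp
  qed (simp_all add: form_ip_bases distrib_left sum.distrib scaleC_fun_def scaleC_complex_def
        sum_distrib_left mult.commute mult.left_commute)
  moreover have "cvec.span (elementary Xs ` bases Xs) = forms Xs"
  proof (rule antisym)
    show "cvec.span (elementary Xs ` bases Xs) \<subseteq> forms Xs"
      using bases_tuples[OF Xs] by (intro cvec.span_minimal forms_subspace) (auto intro: elementary_in_forms Xs)
    show "forms Xs \<subseteq> cvec.span (elementary Xs ` bases Xs)"
    proof
      fix a assume a: "a \<in> forms Xs"
      have a_eq: "a = (\<Sum>es\<in>bases Xs. a es *C elementary Xs es)"
      proof
        fix xs show "a xs = (\<Sum>es\<in>bases Xs. a es *C elementary Xs es) xs"
        proof (cases "xs \<in> tuples Xs")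
          case True
          then show ?thesis using form_expansion[OF Xs a True]
            by (simp add: sum_fun_apply scaleC_fun_def scaleC_complex_def mult.commute)
        next
          case False
          then show ?thesis using formsD(1)[OF a] formsD(1)[OF elementary_in_forms[OF Xs bases_tuples[OF Xs]]]
            by (simp add: sum_fun_apply scaleC_fun_def scaleC_complex_def)
        qed
      qed
      have "(\<Sum>es\<in>bases Xs. a es *C elementary Xs es) \<in> cvec.span (elementary Xs ` bases Xs)"
        by (intro cvec.span_sum cvec.span_scale cvec.span_base imageI)
      then show "a \<in> cvec.span (elementary Xs ` bases Xs)" by (simp only: a_eq[symmetric])
    qed
  qed
  then have "\<exists>B. finite B \<and> cvec.span B = carrier (form_space Xs)"
    using finite_bases[OF Xs] by (intro exI[of _ "elementary Xs ` bases Xs"]) simp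
  ultimately show ?thesis by (simp only: fd_hilbert_iff)
qed

lemma form_space_prehilbert: "fd_atoms Xs \<Longrightarrow> prehilbert (form_space Xs)"
  by (intro fd_prehilbert form_space_fd)

lemma form_ip_tensor:
  assumes "n = length Xs"
  shows "form_ip (Xs @ Ys) (tensor n r s) (tensor n r' s') = form_ip Xs r r' * form_ip Ys s s'"
proof -
  have l: "length es = n" if "es \<in> bases Xs" for es
    using that assms by (auto simp: bases_def in_listset_iff dest: list_all2_lengthD)
  show ?thesis
    unfolding form_ip_bases sum_bases_append sum_product
    by (intro sum.cong refl) (simp add: l mult_ac)
qed

lemma form_expansion_tensor:
  fixes a :: "'v::cvector form"
  assumes Xs: "fd_atoms Xs" and a: "a \<in> forms (Xs @ Ys)" and n: "n = length Xs"
  shows "a = (\<Sum>es\<in>bases Xs. tensor n (elementary Xs es) (\<lambda>ys. a (es @ ys)))"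
proof
  fix xs :: "'v vec list"
  let ?x = "take n xs" and ?y = "drop n xs"
  show "a xs = (\<Sum>es\<in>bases Xs. tensor n (elementary Xs es) (\<lambda>ys. a (es @ ys))) xs"
  proof (cases "xs \<in> tuples (Xs @ Ys)")
    case True
    then have t: "?x \<in> tuples Xs" "?y \<in> tuples Ys" using n by (auto simp: tuples_split)
    from form_expansion[OF Xs forms_prefix_slice[OF a t(2)] t(1)] show ?thesis
      by (simp add: sum_fun_apply tensor_def)
  next
    case False
    have "tensor n (elementary Xs es) (\<lambda>ys. a (es @ ys)) \<in> forms (Xs @ Ys)" if "es \<in> bases Xs" for es
      using bases_tuples[OF Xs that] by (intro tensor_in_forms elementary_in_forms Xs forms_suffix_slice[OF a] n)
    from formsD(1)[OF this False] show ?thesis using formsD(1)[OF a False] by (simp add: sum_fun_apply)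
  qed
qed

lemma form_expansion_tensor_right:
  fixes a :: "'v::cvector form"
  assumes Ys: "fd_atoms Ys" and a: "a \<in> forms (Xs @ Ys)" and n: "n = length Xs"
  shows "a = (\<Sum>es\<in>bases Ys. tensor n (\<lambda>xs. a (xs @ es)) (elementary Ys es))"
proof
  fix xs :: "'v vec list"
  let ?x = "take n xs" and ?y = "drop n xs"
  show "a xs = (\<Sum>es\<in>bases Ys. tensor n (\<lambda>xs. a (xs @ es)) (elementary Ys es)) xs"
  proof (cases "xs \<in> tuples (Xs @ Ys)")
    case True
    then have t: "?x \<in> tuples Xs" "?y \<in> tuples Ys" using n by (auto simp: tuples_split)
    from form_expansion[OF Ys forms_suffix_slice[OF a t(1)] t(2)] show ?thesis
      by (simp add: sum_fun_apply tensor_def mult.commute)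
  next
    case False
    have "tensor n (\<lambda>xs. a (xs @ es)) (elementary Ys es) \<in> forms (Xs @ Ys)" if "es \<in> bases Ys" for es
      using bases_tuples[OF Ys that] by (intro tensor_in_forms elementary_in_forms Ys forms_prefix_slice[OF a] n)
    from formsD(1)[OF this False] show ?thesis using formsD(1)[OF a False] by (simp add: sum_fun_apply)
  qed
qed

text \<open>\<open>R \<otimes> \<top>\<close> consists of the forms all of whose slices, at fixed values of the remaining arguments, are
  in \<open>R\<close>.  If all slices are in \<open>R\<close>, then the expansion of \<open>t\<close> in the remaining arguments writes it as a sum of products.
  Membership in an intersection of such subspaces is thus checked one slice at a time.\<close>

lemma times_top_iff_slices:
  assumes R: "cvec.subspace (R Ys)" "R Ys \<subseteq> forms Ys" and Zs: "fd_atoms Zs" "Zs \<in> listset Ss"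
    and n: "n = length Ys"
  shows "t \<in> times_rel n R (top_rel Ss) (Ys @ Zs) \<longleftrightarrow>
    t \<in> forms (Ys @ Zs) \<and> (\<forall>zs\<in>tuples Zs. (\<lambda>ys. t (ys @ zs)) \<in> R Ys)"
proof -
  have sp: "times_rel n R (top_rel Ss) (Ys @ Zs) = cvec.span {tensor n r s | r s. r \<in> R Ys \<and> s \<in> forms Zs}"
    using Zs n by (simp add: times_rel_tensor top_rel_def)
  let ?S = "{t \<in> forms (Ys @ Zs). \<forall>zs\<in>tuples Zs. (\<lambda>ys. t (ys @ zs)) \<in> R Ys}"
  show ?thesis
  proof (intro iffI conjI)
    assume t: "t \<in> times_rel n R (top_rel Ss) (Ys @ Zs)"
    have "cvec.subspace ?S"
    proof (rule cvec.subspaceI)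
      show "0 \<in> ?S" using cvec.subspace_0[OF forms_subspace] cvec.subspace_0[OF R(1)]
        by (simp add: zero_fun_def)
      fix x y assume "x \<in> ?S" "y \<in> ?S"
      then show "x + y \<in> ?S"
        using cvec.subspace_add[OF R(1), of "\<lambda>ys. x (ys @ zs)" "\<lambda>ys. y (ys @ zs)" for zs]
        by (auto simp: plus_fun_def intro!: cvec.subspace_add[OF forms_subspace, unfolded plus_fun_def])
    next
      fix c x assume "x \<in> ?S"
      then show "c *C x \<in> ?S" using cvec.subspace_scale[OF R(1), of "\<lambda>ys. x (ys @ zs)" for zs]
        by (auto simp: scaleC_fun_def intro!: cvec.subspace_scale[OF forms_subspace, unfolded scaleC_fun_def])
    qed
    moreover have "{tensor n r s | r s. r \<in> R Ys \<and> s \<in> forms Zs} \<subseteq> ?S"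
    proof safe
      fix r s assume r: "r \<in> R Ys" and s: "s \<in> forms Zs"
      then have rf: "r \<in> forms Ys" using R(2) by blast
      then show "tensor n r s \<in> forms (Ys @ Zs)" using s n by (intro tensor_in_forms)
      fix zs assume zs: "zs \<in> tuples Zs"
      have "(\<lambda>ys. tensor n r s (ys @ zs)) = s zs *C r"
      proof
        fix ys
        have "tensor n r s (ys @ zs) = 0" if "ys \<notin> tuples Ys"
          using formsD(1)[OF \<open>tensor n r s \<in> forms (Ys @ Zs)\<close>] tuples_append_right[OF zs] that by blast
        then show "tensor n r s (ys @ zs) = (s zs *C r) ys"
          using formsD(1)[OF rf, of ys] tuples_length[of ys Ys] n
          by (cases "ys \<in> tuples Ys") (auto simp: scaleC_fun_def scaleC_complex_def)
      qed
      then show "(\<lambda>ys. tensor n r s (ys @ zs)) \<in> R Ys"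
        using cvec.subspace_scale[OF R(1) r] by simp
    qed
    ultimately have "t \<in> ?S" using t cvec.span_minimal unfolding sp by blast
    then show "t \<in> forms (Ys @ Zs)" "\<forall>zs\<in>tuples Zs. (\<lambda>ys. t (ys @ zs)) \<in> R Ys" by auto
  next
    assume t: "t \<in> forms (Ys @ Zs) \<and> (\<forall>zs\<in>tuples Zs. (\<lambda>ys. t (ys @ zs)) \<in> R Ys)"
    have "(\<Sum>es\<in>bases Zs. tensor n (\<lambda>ys. t (ys @ es)) (elementary Zs es)) \<in> times_rel n R (top_rel Ss) (Ys @ Zs)"
      unfolding sp using t bases_tuples[OF Zs(1)]
      by (intro cvec.span_sum cvec.span_base) (auto intro: elementary_in_forms Zs)
    then show "t \<in> times_rel n R (top_rel Ss) (Ys @ Zs)"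
      by (simp only: form_expansion_tensor_right[OF Zs(1) conjunct1[OF t] n, symmetric])
  qed
qed


section \<open>Atomic formulas\<close>

lemma lookup_nth:
  "distinct ctx \<Longrightarrow> length zs = length ctx \<Longrightarrow> i < length ctx \<Longrightarrow> the (map_of (zip ctx zs) (ctx ! i)) = zs ! i"
  by (simp add: map_of_zip_nth)

lemma length_arrange [simp]: "length (arrange ctx ys zs) = length ys"
  by (simp add: arrange_def)

lemma arrange_append: "arrange ctx (ys @ ws) zs = arrange ctx ys zs @ arrange ctx ws zs"
  by (simp add: arrange_def)

lemma arrange_self: "distinct ctx \<Longrightarrow> length zs = length ctx \<Longrightarrow> arrange ctx ctx zs = zs"
  by (rule nth_equalityI) (simp_all add: arrange_def lookup_nth)

lemma arrange_arrange: "set ys \<subseteq> set ws \<Longrightarrow> arrange ws ys (arrange ctx ws zs) = arrange ctx ys zs"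
  by (auto simp: arrange_def map_of_zip_map)

lemma arrange_tuples:
  assumes "distinct ctx" "length Xs = length ctx" "set ys \<subseteq> set ctx" "xs \<in> tuples Xs"
  shows "arrange ctx ys xs \<in> tuples (arrange ctx ys Xs)"
proof -
  have "the (map_of (zip ctx xs) y) \<in> carrier (hs (the (map_of (zip ctx Xs) y)))" if y: "y \<in> set ys" for y
  proof -
    obtain i where "i < length ctx" "y = ctx ! i" using y assms(3) by (metis in_set_conv_nth subsetD)
    then show ?thesis using assms(1,2,4) tuples_length[OF assms(4)]
      by (simp add: lookup_nth tuples_nth)
  qed
  then show ?thesis by (simp add: tuples_iff arrange_def list_all2_map1 list_all2_map2 list_all2_same)
qed

lemma arrange_update:
  assumes "distinct ctx" "distinct \<pi>" "set \<pi> \<subseteq> set ctx" "length xs = length ctx"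
    and "i < length ctx" "j < length \<pi>" "\<pi> ! j = ctx ! i"
  shows "arrange ctx \<pi> (xs[i := y]) = (arrange ctx \<pi> xs)[j := y]"
proof (rule nth_equalityI)
  fix k assume k: "k < length (arrange ctx \<pi> (xs[i := y]))"
  then obtain i' where i': "i' < length ctx" "\<pi> ! k = ctx ! i'"
    using assms(3) by (metis in_set_conv_nth length_arrange subsetD)
  have "i' = i \<longleftrightarrow> k = j" using assms i' k by (metis length_arrange nth_eq_iff_index_eq)
  then show "arrange ctx \<pi> (xs[i := y]) ! k = (arrange ctx \<pi> xs)[j := y] ! k"
    using k i' assms by (cases "k = j") (auto simp: arrange_def nth_list_update lookup_nth)
qed simp

text \<open>Composition with the unitary \<open>u\<^sub>\<pi>\<close> that permutes tensor factors.\<close>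

definition reorder :: "'x list \<Rightarrow> 'x list \<Rightarrow> 'v::cvector form \<Rightarrow> 'v form" where
  "reorder ctx \<pi> t = (\<lambda>xs. if length xs = length ctx then t (arrange ctx \<pi> xs) else 0)"

lemma reorder_in_forms:
  assumes "distinct ctx" "distinct \<pi>" "set \<pi> = set ctx" "length Xs = length ctx"
    and t: "t \<in> forms (arrange ctx \<pi> Xs)"
  shows "reorder ctx \<pi> t \<in> forms Xs"
proof -
  have len: "length \<pi> = length ctx" using assms by (metis distinct_card)
  have tup: "arrange ctx \<pi> xs \<in> tuples (arrange ctx \<pi> Xs) \<longleftrightarrow> xs \<in> tuples Xs" if "length xs = length ctx" for xs
  proof
    assume "arrange ctx \<pi> xs \<in> tuples (arrange ctx \<pi> Xs)"
    from arrange_tuples[OF assms(2) _ _ this, of ctx]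
    show "xs \<in> tuples Xs" using assms that by (simp add: arrange_arrange arrange_self)
  qed (use assms in \<open>simp add: arrange_tuples\<close>)
  have idx: "\<exists>j<length \<pi>. \<pi> ! j = ctx ! i" if "i < length ctx" for i
    using that assms(3) by (metis in_set_conv_nth)
  have nth: "arrange ctx \<pi> Xs ! j = Xs ! i" if "i < length ctx" "j < length \<pi>" "\<pi> ! j = ctx ! i" for i j
    using that assms by (simp add: arrange_def lookup_nth)
  show ?thesis
  proof (rule formsI)
    fix xs assume "xs \<notin> tuples Xs"
    then show "reorder ctx \<pi> t xs = 0" using formsD(1)[OF t] tup by (simp add: reorder_def)
  next
    fix xs i y z assume a: "xs \<in> tuples Xs" "i < length Xs" "y \<in> carrier (hs (Xs ! i))" "z \<in> carrier (hs (Xs ! i))"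
    obtain j where j: "j < length \<pi>" "\<pi> ! j = ctx ! i" using idx a assms by auto
    have l: "length xs = length ctx" using tuples_length[OF a(1)] assms by simp
    note u = arrange_update[OF assms(1,2) equalityD1[OF assms(3)] l _ j]
    show "reorder ctx \<pi> t (xs[i := y + z]) = reorder ctx \<pi> t (xs[i := y]) + reorder ctx \<pi> t (xs[i := z])"
      using formsD(2)[OF t, of "arrange ctx \<pi> xs" j y z] a l assms(4) tup[OF l] nth[OF _ j] j
      by (simp add: reorder_def u)
  next
    fix xs i y c assume a: "xs \<in> tuples Xs" "i < length Xs" "y \<in> carrier (hs (Xs ! i))"
    obtain j where j: "j < length \<pi>" "\<pi> ! j = ctx ! i" using idx a assms by auto
    have l: "length xs = length ctx" using tuples_length[OF a(1)] assms by simp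
    note u = arrange_update[OF assms(1,2) equalityD1[OF assms(3)] l _ j]
    show "reorder ctx \<pi> t (xs[i := c *C y]) = c * reorder ctx \<pi> t (xs[i := y])"
      using formsD(3)[OF t, of "arrange ctx \<pi> xs" j y c] a l assms(4) tup[OF l] nth[OF _ j] j
      by (simp add: reorder_def u)
  qed
qed

lemma reorder_reorder:
  assumes "distinct ctx" "distinct \<pi>" "set \<pi> = set ctx" "length Xs = length ctx" "t \<in> forms Xs"
  shows "reorder ctx \<pi> (reorder \<pi> ctx t) = t"
proof
  fix xs
  have len: "length \<pi> = length ctx" using assms by (metis distinct_card)
  show "reorder ctx \<pi> (reorder \<pi> ctx t) xs = t xs"
    using assms len formsD(1)[OF assms(5), of xs] tuples_length[of xs Xs]
    by (auto simp: reorder_def arrange_arrange arrange_self)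
qed

lemma atomic_reorder:
  assumes "length Xs = length ctx" "\<pi> = ys @ filter (\<lambda>y. y \<notin> set ys) ctx"
  shows "atomic ctx R ys Xs = reorder ctx \<pi> `
    times_rel (length ys) R (top_rel (map sort_of (filter (\<lambda>y. y \<notin> set ys) ctx))) (arrange ctx \<pi> Xs)"
  using assms by (simp add: atomic_def reorder_def Let_def)

text \<open>Once \<open>ys\<close> are the first arguments, this is the description of \<open>R \<times> \<top>\<close> by slices.  The condition on the length
  excludes lists that are not tuples; for those, \<open>arrange\<close> yields arbitrary values.\<close>

lemma atomic_iff_slices:
  fixes ctx ys :: "'v::cvector var list"
  defines "rest \<equiv> filter (\<lambda>y. y \<notin> set ys) ctx"
  assumes ctx: "distinct ctx" and ys: "distinct ys" "set ys \<subseteq> set ctx"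
    and Xs: "Xs \<in> listset (map sort_of ctx)" "fd_atoms Xs"
    and R: "cvec.subspace (R (arrange ctx ys Xs))" "R (arrange ctx ys Xs) \<subseteq> forms (arrange ctx ys Xs)"
  shows "a \<in> atomic ctx R ys Xs \<longleftrightarrow> a \<in> forms Xs \<and>
    (\<forall>zs\<in>tuples (arrange ctx rest Xs).
       (\<lambda>ws. if length ws = length ys then a (arrange (ys @ rest) ctx (ws @ zs)) else 0) \<in> R (arrange ctx ys Xs))"
    (is "_ \<longleftrightarrow> _ \<and> ?slices a")
proof -
  let ?\<pi> = "ys @ rest" let ?Ys = "arrange ctx ys Xs" let ?Zs = "arrange ctx rest Xs"
  have l: "length Xs = length ctx" using Xs by (auto simp: in_listset_iff dest: list_all2_lengthD)
  have \<pi>: "distinct ?\<pi>" "set ?\<pi> = set ctx" using ctx ys by (auto simp: rest_def)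
  have len: "length ?\<pi> = length ctx" using \<pi> ctx by (metis distinct_card)
  have X: "the (map_of (zip ctx Xs) y) \<in> sort_of y \<and> fd_atom (the (map_of (zip ctx Xs) y))" if y: "y \<in> set ctx" for y
  proof -
    obtain i where "i < length ctx" "y = ctx ! i" using y by (metis in_set_conv_nth)
    then show ?thesis using Xs ctx l
      by (auto simp: lookup_nth in_listset_iff list_all2_conv_all_nth list_all_length)
  qed
  have Zs: "fd_atoms ?Zs" "?Zs \<in> listset (map sort_of rest)"
    using X by (auto simp: arrange_def rest_def list_all_iff in_listset_iff list_all2_map1 list_all2_map2 list_all2_same)
  have XsYsZs: "arrange ctx ?\<pi> Xs = ?Ys @ ?Zs" by (simp add: arrange_append)
  have times: "t \<in> times_rel (length ys) R (top_rel (map sort_of rest)) (?Ys @ ?Zs) \<longleftrightarrow>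
    t \<in> forms (?Ys @ ?Zs) \<and> (\<forall>zs\<in>tuples ?Zs. (\<lambda>ws. t (ws @ zs)) \<in> R ?Ys)" for t
    using times_top_iff_slices[of R ?Ys ?Zs "map sort_of rest" "length ys" t] R Zs by simp
  have atomic: "atomic ctx R ys Xs = reorder ctx ?\<pi> ` times_rel (length ys) R (top_rel (map sort_of rest)) (?Ys @ ?Zs)"
    using atomic_reorder[OF l, of ?\<pi> ys R] by (simp add: rest_def XsYsZs[unfolded rest_def])
  have sl: "(\<lambda>ws. if length ws = length ys then reorder ctx ?\<pi> t (arrange ?\<pi> ctx (ws @ zs)) else 0) = (\<lambda>ws. t (ws @ zs))"
    if t: "t \<in> forms (?Ys @ ?Zs)" and zs: "zs \<in> tuples ?Zs" for t zs
  proof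
    fix ws
    have lz: "length zs = length rest" using tuples_length[OF zs] by simp
    show "(if length ws = length ys then reorder ctx ?\<pi> t (arrange ?\<pi> ctx (ws @ zs)) else 0) = t (ws @ zs)"
    proof (cases "length ws = length ys")
      case True
      then have "arrange ctx ?\<pi> (arrange ?\<pi> ctx (ws @ zs)) = ws @ zs"
        using \<pi> lz by (simp add: arrange_arrange arrange_self)
      then show ?thesis using True by (simp add: reorder_def)
    next
      case False
      then have "ws @ zs \<notin> tuples (?Ys @ ?Zs)" using lz tuples_length[of "ws @ zs" "?Ys @ ?Zs"] by auto
      then show ?thesis using False formsD(1)[OF t] by simp
    qed
  qed
  show ?thesis
  proof
    assume "a \<in> atomic ctx R ys Xs"
    then obtain t where t: "a = reorder ctx ?\<pi> t" "t \<in> forms (?Ys @ ?Zs)" "\<forall>zs\<in>tuples ?Zs. (\<lambda>ws. t (ws @ zs)) \<in> R ?Ys"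
      unfolding atomic using times by blast
    show "a \<in> forms Xs \<and> ?slices a"
      unfolding t(1) using t(2,3) sl[OF t(2)] reorder_in_forms[OF ctx \<pi> l, of t] by (simp add: XsYsZs)
  next
    assume a: "a \<in> forms Xs \<and> ?slices a"
    define t where "t = reorder ?\<pi> ctx a"
    have inv: "arrange ?\<pi> ctx (?Ys @ ?Zs) = Xs"
      using arrange_arrange[of ctx ?\<pi> ctx Xs] \<pi> ctx l by (simp add: XsYsZs[symmetric] arrange_self)
    have t: "t \<in> forms (?Ys @ ?Zs)" unfolding t_def
      using a ctx \<pi> len by (intro reorder_in_forms) (auto simp: inv XsYsZs)
    have at: "a = reorder ctx ?\<pi> t" unfolding t_def using reorder_reorder[OF ctx \<pi> l, of a] a by simp
    have "\<forall>zs\<in>tuples ?Zs. (\<lambda>ws. t (ws @ zs)) \<in> R ?Ys" using a sl[OF t] unfolding at by simp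
    then show "a \<in> atomic ctx R ys Xs" unfolding atomic using t at times by blast
  qed
qed

lemma atomic_prefix:
  assumes ctx: "distinct (ys @ ctx)" and Zs: "Zs \<in> listset (map sort_of ctx)" and Ys: "length Ys = length ys"
    and R: "R Ys \<subseteq> forms Ys"
  shows "atomic (ys @ ctx) R ys (Ys @ Zs) = cvec.span {tensor (length ys) r s | r s. r \<in> R Ys \<and> s \<in> forms Zs}"
    (is "_ = ?S")
proof -
  have lZ: "length Zs = length ctx" using Zs by (auto simp: in_listset_iff dest: list_all2_lengthD)
  have f: "filter (\<lambda>y. y \<notin> set ys) (ys @ ctx) = ctx" using ctx by (auto simp: filter_id_conv)
  have times: "times_rel (length ys) R (top_rel (map sort_of ctx)) (Ys @ Zs) = ?S"
    using Ys Zs by (simp add: times_rel_tensor top_rel_def)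
  have "?S \<subseteq> forms (Ys @ Zs)"
    using R Ys by (intro cvec.span_minimal forms_subspace) (auto intro!: tensor_in_forms)
  then have "reorder (ys @ ctx) (ys @ ctx) t = t" if "t \<in> ?S" for t
    using that ctx lZ Ys formsD(1)[of t "Ys @ Zs"] tuples_length[of _ "Ys @ Zs"]
    by (force simp: reorder_def arrange_self fun_eq_iff)
  then have "reorder (ys @ ctx) (ys @ ctx) ` ?S = ?S" by force
  then show ?thesis
    using atomic_reorder[of "Ys @ Zs" "ys @ ctx" "ys @ ctx" ys R] lZ Ys ctx
    by (simp only: f times) (simp add: arrange_self times)
qed

section \<open>Connectives\<close>

definition perp :: "'v::cvector atom list \<Rightarrow> 'v form set \<Rightarrow> 'v form set" where
  "perp Xs S = {a \<in> forms Xs. \<forall>b\<in>S. form_ip Xs b a = 0}"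

lemma form_ip_linear:
  "form_ip Xs (a + b) c = form_ip Xs a c + form_ip Xs b c"
  "form_ip Xs a (b + c) = form_ip Xs a b + form_ip Xs a c"
  "form_ip Xs (k *C a) b = cnj k * form_ip Xs a b"
  "form_ip Xs a (k *C b) = k * form_ip Xs a b"
  "form_ip Xs 0 b = 0" "form_ip Xs b 0 = 0"
  by (simp_all add: form_ip_bases distrib_left distrib_right sum.distrib scaleC_fun_def scaleC_complex_def
      sum_distrib_left mult_ac)

lemma form_ip_cnj: "form_ip Xs b a = cnj (form_ip Xs a b)"
  by (simp add: form_ip_bases mult.commute)

lemma perp_subspace: "cvec.subspace (perp Xs S)"
  using forms_subspace[of Xs] by (auto simp: perp_def cvec.subspace_def form_ip_linear)

lemma form_ip_span:
  assumes "\<And>b. b \<in> G \<Longrightarrow> form_ip Xs b a = 0" "b \<in> cvec.span G"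
  shows "form_ip Xs b a = 0"
proof -
  have "cvec.subspace {b. form_ip Xs b a = 0}"
    by (auto simp: cvec.subspace_def form_ip_linear)
  then have "cvec.span G \<subseteq> {b. form_ip Xs b a = 0}" using assms(1) by (intro cvec.span_minimal) auto
  then show ?thesis using assms(2) by auto
qed

text \<open>The implication \<open>\<not>\<phi> \<or> (\<phi> \<and> \<psi>)\<close>, with the disjunction spelled out by negations.\<close>

definition sasaki :: "'v::cvector atom list \<Rightarrow> 'v form set \<Rightarrow> 'v form set \<Rightarrow> 'v form set" where
  "sasaki Xs P Q = perp Xs (perp Xs (perp Xs P) \<inter> perp Xs (P \<inter> Q))"

lemma sasaki_subspace: "cvec.subspace (sasaki Xs P Q)"
  unfolding sasaki_def by (rule perp_subspace)

lemma meet_le_sasaki: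
  assumes "P \<subseteq> forms Xs" shows "P \<inter> Q \<subseteq> sasaki Xs P Q"
proof
  fix a assume a: "a \<in> P \<inter> Q"
  have "form_ip Xs b a = 0" if "b \<in> perp Xs (P \<inter> Q)" for b
    using that a form_ip_cnj[of Xs b a] by (auto simp: perp_def)
  then show "a \<in> sasaki Xs P Q" using a assms by (auto simp: sasaki_def perp_def[of Xs "_ \<inter> _"])
qed

lemma perp_le_sasaki: "perp Xs P \<subseteq> sasaki Xs P Q"
proof
  fix a assume a: "a \<in> perp Xs P"
  have "form_ip Xs b a = 0" if "b \<in> perp Xs (perp Xs P)" for b
    using that a form_ip_cnj[of Xs b a] by (auto simp: perp_def)
  then show "a \<in> sasaki Xs P Q" using a by (auto simp: sasaki_def perp_def)
qed

lemma perp_perp: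
  assumes "P \<subseteq> forms Xs" shows "P \<subseteq> perp Xs (perp Xs P)"
proof
  fix a assume a: "a \<in> P"
  have "form_ip Xs b a = 0" if "b \<in> perp Xs P" for b
    using that a form_ip_cnj[of Xs b a] by (auto simp: perp_def)
  then show "a \<in> perp Xs (perp Xs P)" using a assms by (auto simp: perp_def)
qed

text \<open>Because of \<open>P \<subseteq> P\<^sup>\<bottom>\<^sup>\<bottom>\<close>, such a vector \<open>b\<close> is among those whose orthogonal complement is the implication.  It is the
  test vector by which information is extracted from an implication.\<close>

lemma sasaki_orthogonal:
  assumes "a \<in> sasaki Xs P Q" "P \<subseteq> forms Xs" "b \<in> P" "b \<in> perp Xs (P \<inter> Q)"
  shows "form_ip Xs b a = 0"
  using assms perp_perp[OF assms(2)] by (auto simp: sasaki_def perp_def[of Xs "_ \<inter> _"])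

text \<open>Modus ponens: the component of \<open>a \<in> P\<close> orthogonal to \<open>P \<inter> Q\<close> is orthogonal to \<open>a\<close>, so it vanishes.\<close>

lemma sasaki_modus_ponens:
  assumes Xs: "fd_atoms Xs" and P: "cvec.subspace P" "P \<subseteq> forms Xs" and Q: "cvec.subspace Q"
    and a: "a \<in> sasaki Xs P Q" "a \<in> P"
  shows "a \<in> Q"
proof -
  have S: "cvec.subspace (P \<inter> Q)" using P Q by (simp add: cvec.subspace_inter)
  obtain a' where a': "a' \<in> P \<inter> Q" "\<And>b. b \<in> P \<inter> Q \<Longrightarrow> form_ip Xs b (a - a') = 0"
    using orthogonal_projection[OF form_space_fd[OF Xs] S, of a] P a by auto
  have d: "a - a' \<in> P" using P(1) a a' by (auto intro: cvec.subspace_diff)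
  then have "a - a' \<in> perp Xs (P \<inter> Q)" using a' P by (auto simp: perp_def)
  then have "form_ip Xs (a - a') a = 0" by (rule sasaki_orthogonal[OF a(1) P(2) d])
  moreover have "form_ip Xs (a - a') a' = 0" using a' form_ip_cnj[of Xs "a - a'" a'] by simp
  ultimately have "form_ip Xs (a - a') (a - a') = 0"
    using form_ip_linear(2)[of Xs "a - a'" "a - a'" a'] by simp
  then have "a - a' = 0"
    using ip_self_zero[OF form_space_prehilbert[OF Xs], of "a - a'"] d P by auto
  then show ?thesis using a' by simp
qed

lemma neg_rel_perp: "Xs \<in> listset \<X>s \<Longrightarrow> neg_rel \<X>s R Xs = perp Xs (R Xs)"
  by (auto simp: neg_rel_def perp_def top_rel_def)

lemma interp_Imp:
  "Xs \<in> listset (map sort_of ctx) \<Longrightarrow> interp (Imp \<phi> \<psi>) ctx Xs = sasaki Xs (interp \<phi> ctx Xs) (interp \<psi> ctx Xs)"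
  by (simp add: neg_rel_perp sasaki_def)

section \<open>Quantifiers\<close>

lemma top_rel_subspace: "cvec.subspace (top_rel \<X>s Xs)"
  by (simp add: top_rel_def forms_subspace)

lemma neg_rel_subspace: "cvec.subspace (neg_rel \<X>s R Xs)"
  using top_rel_subspace[of \<X>s Xs]
  by (auto simp: neg_rel_def cvec.subspace_def form_ip_linear)

lemma atomic_subspace: "cvec.subspace (atomic ctx R ys Xs)"
proof (cases "length Xs = length ctx")
  case True
  let ?\<pi> = "ys @ filter (\<lambda>y. y \<notin> set ys) ctx"
  let ?T = "times_rel (length ys) R (top_rel (map sort_of (filter (\<lambda>y. y \<notin> set ys) ctx))) (arrange ctx ?\<pi> Xs)"
  have T: "cvec.subspace ?T" by (simp add: times_rel_def)
  have lin: "reorder ctx ?\<pi> 0 = 0" "reorder ctx ?\<pi> (s + t) = reorder ctx ?\<pi> s + reorder ctx ?\<pi> t"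
    "reorder ctx ?\<pi> (c *C t) = c *C reorder ctx ?\<pi> t" for s t :: "'a form" and c
    by (auto simp: reorder_def fun_eq_iff scaleC_fun_def)
  have "cvec.subspace (reorder ctx ?\<pi> ` ?T)"
  proof (rule cvec.subspaceI)
    show "0 \<in> reorder ctx ?\<pi> ` ?T"
      using imageI[OF cvec.subspace_0[OF T], of "reorder ctx ?\<pi>"] by (simp only: lin)
    fix x y assume "x \<in> reorder ctx ?\<pi> ` ?T" "y \<in> reorder ctx ?\<pi> ` ?T"
    then obtain s t where st: "x = reorder ctx ?\<pi> s" "y = reorder ctx ?\<pi> t" "s \<in> ?T" "t \<in> ?T" by blast
    show "x + y \<in> reorder ctx ?\<pi> ` ?T"
      unfolding st(1,2) lin(2)[symmetric] by (intro imageI cvec.subspace_add[OF T] st)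
  next
    fix c x assume "x \<in> reorder ctx ?\<pi> ` ?T"
    then obtain t where t: "x = reorder ctx ?\<pi> t" "t \<in> ?T" by blast
    show "c *C x \<in> reorder ctx ?\<pi> ` ?T"
      unfolding t(1) lin(3)[symmetric] by (intro imageI cvec.subspace_scale[OF T] t)
  qed
  then show ?thesis using atomic_reorder[OF True refl] by simp
next
  case False
  then show ?thesis by (simp add: atomic_def Let_def)
qed

lemma interp_subspace: "cvec.subspace (interp \<phi> ctx Xs)"
  by (induction \<phi> arbitrary: ctx Xs)
    (auto simp: atomic_subspace neg_rel_subspace cvec.subspace_inter Sup_rel_def)

text \<open>The forms on the right, placed at \<open>Zs\<close> with all other components \<open>0\<close>, constitute one of the relations \<open>R\<close> with
  \<open>\<top> \<times> R \<le> \<phi>\<close>, hence they are contained in the supremum.\<close>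

lemma mem_Forall_iff:
  "a \<in> interp (Forall x \<phi>) ctx Zs \<longleftrightarrow> a \<in> top_rel (map sort_of ctx) Zs \<and>
    (\<forall>X\<in>sort_of x. \<forall>t\<in>forms [X]. tensor 1 t a \<in> interp \<phi> (x # ctx) (X # Zs))"
proof -
  let ?P = "\<lambda>R. relation (map sort_of ctx) R \<and> times_rel 1 (top_rel [sort_of x]) R \<le> interp \<phi> (x # ctx)"
  define S where "S = {a \<in> top_rel (map sort_of ctx) Zs.
    \<forall>X\<in>sort_of x. \<forall>t\<in>forms [X]. tensor 1 t a \<in> interp \<phi> (x # ctx) (X # Zs)}"
  note sub = interp_subspace[of \<phi> "x # ctx"]
  have S: "cvec.subspace S"
    unfolding S_def
  proof (rule cvec.subspaceI, safe)
    fix X t assume "X \<in> sort_of x" "t \<in> forms [X]"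
    show "tensor 1 t 0 \<in> interp \<phi> (x # ctx) (X # Zs)" using cvec.subspace_0[OF sub] by simp
  qed (auto simp: tensor_linear intro: cvec.subspace_add[OF sub] cvec.subspace_scale[OF sub]
      cvec.subspace_add[OF top_rel_subspace] cvec.subspace_scale[OF top_rel_subspace] cvec.subspace_0[OF top_rel_subspace])
  have "interp (Forall x \<phi>) ctx Zs = S"
  proof
    show "interp (Forall x \<phi>) ctx Zs \<subseteq> S"
      unfolding interp.simps Sup_rel_def
    proof (intro cvec.span_minimal S UN_least)
      fix R assume "R \<in> {R. ?P R}"
      then have R: "R \<le> top_rel (map sort_of ctx)" "times_rel 1 (top_rel [sort_of x]) R \<le> interp \<phi> (x # ctx)"
        by (auto simp: relation_def)
      show "R Zs \<subseteq> S"
      proof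
        fix b assume b: "b \<in> R Zs"
        have "tensor 1 t b \<in> interp \<phi> (x # ctx) (X # Zs)" if "X \<in> sort_of x" "t \<in> forms [X]" for X t
        proof -
          have "tensor 1 t b \<in> times_rel 1 (top_rel [sort_of x]) R (X # Zs)"
            unfolding times_rel_tensor using that b
            by (intro cvec.span_base CollectI exI[of _ t] exI[of _ b]) (auto simp: top_rel_def in_listset_iff)
          then show ?thesis using R(2) by (auto simp: le_fun_def)
        qed
        then show "b \<in> S" using b R(1) unfolding S_def by (auto simp: le_fun_def)
      qed
    qed
    define R where "R Ws = (if Ws = Zs then S else {0})" for Ws
    have "relation (map sort_of ctx) R"
      unfolding relation_def le_fun_def R_def using S cvec.subspace_0[OF top_rel_subspace]
      by (auto simp: S_def)
    moreover have "times_rel 1 (top_rel [sort_of x]) R Ws \<subseteq> interp \<phi> (x # ctx) Ws" for Ws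
      unfolding times_rel_tensor
    proof (intro cvec.span_minimal sub subsetI)
      fix u assume "u \<in> {tensor 1 r s | r s. r \<in> top_rel [sort_of x] (take 1 Ws) \<and> s \<in> R (drop 1 Ws)}"
      then obtain r s where u: "u = tensor 1 r s" "r \<in> top_rel [sort_of x] (take 1 Ws)" "s \<in> R (drop 1 Ws)" by blast
      show "u \<in> interp \<phi> (x # ctx) Ws"
      proof (cases "r = 0 \<or> s = 0")
        case True
        then show ?thesis using u cvec.subspace_0[OF sub] by auto
      next
        case False
        then obtain X where X: "take 1 Ws = [X]" "X \<in> sort_of x" "r \<in> forms [X]"
          using u(2) by (auto simp: top_rel_def in_listset_iff list_all2_Cons2 split: if_splits)
        then have "drop 1 Ws = Zs" "s \<in> S" using u(3) False by (auto simp: R_def split: if_splits)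
        then show ?thesis using u(1) X append_take_drop_id[of 1 Ws] unfolding S_def by auto
      qed
    qed
    ultimately have "?P R" by (simp add: le_fun_def)
    then show "S \<subseteq> interp (Forall x \<phi>) ctx Zs"
      unfolding interp.simps Sup_rel_def by (auto intro!: cvec.span_base bexI[of _ R] simp: R_def)
  qed
  then show ?thesis by (simp add: S_def)
qed

text \<open>The generator of \<open>L(\<complex>, \<complex>)\<close>, where \<open>\<complex>\<close> is the empty tensor product.\<close>

definition unit_form :: "'v::cvector form" where
  "unit_form xs = (if xs = [] then 1 else 0)"

lemma forms_Nil: "a \<in> forms [] \<longleftrightarrow> a = a [] *C unit_form"
proof
  assume "a \<in> forms []"
  then show "a = a [] *C unit_form"
    by (auto simp: unit_form_def scaleC_fun_def scaleC_complex_def fun_eq_iff formsD(1))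
next
  assume a: "a = a [] *C unit_form"
  have "a xs = 0" if "xs \<noteq> []" for xs
    using that by (subst a) (simp add: unit_form_def scaleC_fun_def scaleC_complex_def)
  then show "a \<in> forms []" by (intro formsI) auto
qed

lemma unit_form_in_forms: "unit_form \<in> forms []"
  unfolding forms_Nil by (simp add: unit_form_def scaleC_fun_def scaleC_complex_def fun_eq_iff)

lemma holds_Forall_iff: "holds (Forall x \<phi>) \<longleftrightarrow> unit_form \<in> interp (Forall x \<phi>) [] []"
proof
  assume "holds (Forall x \<phi>)"
  then show "unit_form \<in> interp (Forall x \<phi>) [] []" by (simp add: holds_def top_rel_def unit_form_in_forms)
next
  assume u: "unit_form \<in> interp (Forall x \<phi>) [] []"
  have "interp (Forall x \<phi>) [] Xs = top_rel [] Xs" for Xs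
  proof
    show "interp (Forall x \<phi>) [] Xs \<subseteq> top_rel [] Xs" using mem_Forall_iff[of _ x \<phi> "[]" Xs] by auto
    show "top_rel [] Xs \<subseteq> interp (Forall x \<phi>) [] Xs"
    proof
      fix a assume a: "a \<in> top_rel [] Xs"
      show "a \<in> interp (Forall x \<phi>) [] Xs"
      proof (cases "Xs = []")
        case True
        then have "a = a [] *C unit_form" using a forms_Nil[of a] by (simp add: top_rel_def)
        then show ?thesis using cvec.subspace_scale[OF interp_subspace u, of "a []"] True by simp
      next
        case False
        then show ?thesis using a cvec.subspace_0[OF interp_subspace[of "Forall x \<phi>" "[]" Xs]]
          by (simp add: top_rel_def del: interp.simps)
      qed
    qed
  qed
  then show "holds (Forall x \<phi>)" by (auto simp: holds_def)
qed

lemma qset_fd: "quantum_set \<X> \<Longrightarrow> X \<in> \<X> \<Longrightarrow> fd_atom X"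
  by (simp add: quantum_set_def fd_atom_def)

lemma qset_dual_fd: "quantum_set \<X> \<Longrightarrow> X \<in> dual_qset \<X> \<Longrightarrow> fd_atom X"
  by (auto simp: dual_qset_def qset_fd)

lemma dual_in_dual_qset [simp]: "dual X \<in> dual_qset \<X> \<longleftrightarrow> X \<in> \<X>"
  by (auto simp: dual_qset_def dest: injD[OF inj_dual])

lemma ev_in_forms:
  assumes X: "fd_atom X" shows "ev X \<in> forms [X, dual X]"
proof (rule formsI)
  note pX = hs_prehilbert[OF X] hs_prehilbert[of "dual X", unfolded fd_atom_dual, OF X]
  fix xs i y assume a: "xs \<in> tuples [X, dual X]" "i < length [X, dual X]" "y \<in> carrier (hs ([X, dual X] ! i))"
  then obtain x f where xs: "xs = [x, f]" "x \<in> carrier (hs X)" "f \<in> carrier (hs (dual X))"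
    unfolding tuples_Cons by auto
  note p = pairing_left[OF X xs(3)] pairing_right[OF X xs(2)]
  consider "i = 0" | "i = 1" using a(2) by fastforce
  note i_cases = this
  show "ev X (xs[i := c *C y]) = c * ev X (xs[i := y])" for c
    using i_cases a(3) xs pX p by cases (simp_all add: ev_def)
  fix z assume z: "z \<in> carrier (hs ([X, dual X] ! i))"
  show "ev X (xs[i := y + z]) = ev X (xs[i := y]) + ev X (xs[i := z])"
    using i_cases z a(3) xs pX p by cases (simp_all add: ev_def)
qed (simp add: ev_def)

lemma eq_rel_subspace: "cvec.subspace (eq_rel \<X> Xs)"
  by (simp add: eq_rel_def)

lemma eq_rel_forms: "quantum_set \<X> \<Longrightarrow> eq_rel \<X> Xs \<subseteq> forms Xs"
proof (cases "\<exists>X\<in>\<X>. Xs = [X, dual X]")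
  case True
  assume "quantum_set \<X>"
  then have "ev (hd Xs) \<in> forms Xs" using True by (auto simp: ev_in_forms qset_fd)
  then have "cvec.span {ev (hd Xs)} \<subseteq> forms Xs" by (intro cvec.span_minimal forms_subspace) simp
  then show ?thesis using True by (simp add: eq_rel_def)
qed (simp add: eq_rel_def cvec.subspace_0[OF forms_subspace])

lemma eq_rel_ev: "X \<in> \<X> \<Longrightarrow> r \<in> eq_rel \<X> [X, Y] \<Longrightarrow> r = 0 \<or> Y = dual X \<and> (\<exists>c. r = c *C ev X)"
  by (auto simp: eq_rel_def cvec.span_singleton split: if_splits)

lemma forms_spanned_by_tensors:
  assumes Xs: "fd_atoms Xs" and W: "cvec.subspace W" and n: "n = length Xs"
    and "\<And>r s. r \<in> forms Xs \<Longrightarrow> s \<in> forms Ys \<Longrightarrow> tensor n r s \<in> W"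
  shows "forms (Xs @ Ys) \<subseteq> W"
proof
  fix a assume a: "a \<in> forms (Xs @ Ys)"
  have "(\<Sum>es\<in>bases Xs. tensor n (elementary Xs es) (\<lambda>ys. a (es @ ys))) \<in> W"
    using bases_tuples[OF Xs]
    by (intro cvec.subspace_sum[OF W] assms(4) elementary_in_forms[OF Xs] forms_suffix_slice[OF a]) auto
  then show "a \<in> W" by (simp only: form_expansion_tensor[OF Xs a n, symmetric])
qed

lemma tensor_assoc: "tensor m r (tensor n s t) = tensor (m + n) (tensor m r s) t"
  by (auto simp: tensor_def fun_eq_iff add.commute take_drop mult.assoc min_def)

text \<open>Quantifying over \<open>x = y\<close> amounts to inserting \<open>\<epsilon>\<^sub>X\<close>.  If all \<open>t \<otimes> s \<otimes> a\<close> satisfy the implication, then so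
  does \<open>\<epsilon>\<^sub>X \<otimes> a\<close>, by linearity, and modus ponens applies.  Conversely, \<open>t \<otimes> s\<close> is the sum of a multiple
  of \<open>\<epsilon>\<^sub>X\<close> and a form orthogonal to \<open>\<epsilon>\<^sub>X\<close>; the Sasaki implication holds for the two parts for different reasons.\<close>

lemma mem_ForallEq_iff:
  assumes \<X>: "quantum_set \<X>" and x: "sort_of x = \<X>" and y: "sort_of y = dual_qset \<X>"
    and dist: "distinct (x # y # ctx)" and Zs: "Zs \<in> listset (map sort_of ctx)" "fd_atoms Zs"
  shows "a \<in> interp (ForallEq x y \<phi>) ctx Zs \<longleftrightarrow>
    a \<in> forms Zs \<and> (\<forall>X\<in>\<X>. tensor 2 (ev X) a \<in> interp \<phi> (x # y # ctx) (X # dual X # Zs))"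
proof -
  let ?imp = "Imp (Rel (eq_rel \<X>) [x, y]) \<phi>"
  define E where "E X Y = cvec.span {tensor 2 r s | r s. r \<in> eq_rel \<X> [X, Y] \<and> s \<in> forms Zs}" for X Y
  define F where "F X Y = interp \<phi> (x # y # ctx) (X # Y # Zs)" for X Y
  have F: "cvec.subspace (F X Y)" for X Y by (simp add: F_def interp_subspace)
  have E: "cvec.subspace (E X Y)" "E X Y \<subseteq> forms (X # Y # Zs)" for X Y
  proof -
    show "cvec.subspace (E X Y)" by (simp add: E_def)
    show "E X Y \<subseteq> forms (X # Y # Zs)" unfolding E_def
      using tensor_in_forms[of _ "[X, Y]" _ Zs 2] eq_rel_forms[OF \<X>, of "[X, Y]"]
      by (intro cvec.span_minimal forms_subspace) auto
  qed
  have imp: "interp ?imp (x # y # ctx) (X # Y # Zs) = sasaki (X # Y # Zs) (E X Y) (F X Y)"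
    if "X \<in> \<X>" "Y \<in> dual_qset \<X>" for X Y
  proof -
    have "X # Y # Zs \<in> listset (map sort_of (x # y # ctx))" using that x y Zs by (simp add: in_listset_iff del: listset.simps)
    moreover have "interp (Rel (eq_rel \<X>) [x, y]) (x # y # ctx) (X # Y # Zs) = E X Y"
      using atomic_prefix[of "[x, y]" ctx Zs "[X, Y]" "eq_rel \<X>"] dist Zs eq_rel_forms[OF \<X>]
      by (simp add: E_def numeral_2_eq_2)
    ultimately show ?thesis by (simp only: interp_Imp F_def)
  qed
  have mem: "a \<in> interp (ForallEq x y \<phi>) ctx Zs \<longleftrightarrow> a \<in> forms Zs \<and>
    (\<forall>Y\<in>dual_qset \<X>. \<forall>s\<in>forms [Y]. \<forall>X\<in>\<X>. \<forall>t\<in>forms [X].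
      tensor 2 (tensor 1 t s) a \<in> sasaki (X # Y # Zs) (E X Y) (F X Y))"
  proof -
    have 1: "tensor 1 s a \<in> top_rel (map sort_of (y # ctx)) (Y # Zs)"
      if "a \<in> forms Zs" "Y \<in> dual_qset \<X>" "s \<in> forms [Y]" for s Y
      using tensor_in_forms[of s "[Y]" a Zs 1] that y Zs
      by (simp add: top_rel_def in_listset_iff del: listset.simps)
    have 2: "tensor 1 t (tensor 1 s a) = tensor 2 (tensor 1 t s) a" for t s
      by (simp add: tensor_assoc numeral_2_eq_2)
    have 3: "top_rel (map sort_of ctx) Zs = forms Zs" using Zs(1) by (simp add: top_rel_def)
    show ?thesis
      unfolding mem_Forall_iff[of _ y] mem_Forall_iff[of _ x] x y 2 3
      by (intro conj_cong ball_cong refl) (simp add: 1 imp del: One_nat_def interp.simps list.map)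
  qed
  show ?thesis unfolding mem F_def[symmetric]
  proof (intro conj_cong refl iffI ballI)
    fix X assume a: "a \<in> forms Zs" and X: "X \<in> \<X>"
      and all: "\<forall>Y\<in>dual_qset \<X>. \<forall>s\<in>forms [Y]. \<forall>X\<in>\<X>. \<forall>t\<in>forms [X].
        tensor 2 (tensor 1 t s) a \<in> sasaki (X # Y # Zs) (E X Y) (F X Y)"
    let ?Y = "dual X"
    let ?S = "sasaki (X # ?Y # Zs) (E X ?Y) (F X ?Y)"
    have fX: "fd_atom X" using qset_fd[OF \<X> X] .
    have "cvec.subspace {u. tensor 2 u a \<in> ?S}"
      using sasaki_subspace[of "X # ?Y # Zs" "E X ?Y" "F X ?Y"]
      by (auto simp: cvec.subspace_def tensor_linear)
    from forms_spanned_by_tensors[OF _ this, of "[X]" 1 "[?Y]"]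
    have "tensor 2 (ev X) a \<in> ?S" using ev_in_forms[OF fX] all X fX by auto
    moreover have "tensor 2 (ev X) a \<in> E X ?Y"
      unfolding E_def using a X
      by (intro cvec.span_base CollectI exI[of _ "ev X"] exI[of _ a]) (simp add: eq_rel_def cvec.span_base)
    ultimately show "tensor 2 (ev X) a \<in> F X ?Y"
      using sasaki_modus_ponens[OF _ E(1)[of X ?Y] E(2)[of X ?Y] F[of X ?Y]] fX Zs(2) by simp
  next
    fix Y s X t assume a: "a \<in> forms Zs" and all: "\<forall>X\<in>\<X>. tensor 2 (ev X) a \<in> F X (dual X)"
      and Y: "Y \<in> dual_qset \<X>" and s: "s \<in> forms [Y]" and X: "X \<in> \<X>" and t: "t \<in> forms [X]"
    have fd: "fd_atoms [X, Y]" using qset_fd[OF \<X> X] qset_dual_fd[OF \<X> Y] by simp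
    have u: "tensor 1 t s \<in> forms [X, Y]" using tensor_in_forms[OF t s, of 1] by simp
    obtain u' where u': "u' \<in> eq_rel \<X> [X, Y]" "\<And>r. r \<in> eq_rel \<X> [X, Y] \<Longrightarrow> form_ip [X, Y] r (tensor 1 t s - u') = 0"
      using orthogonal_projection[OF form_space_fd[OF fd] eq_rel_subspace, of \<X> "[X, Y]" "tensor 1 t s"]
        eq_rel_forms[OF \<X>, of "[X, Y]"] u by auto
    define w where "w = tensor 1 t s - u'"
    have "tensor 2 u' a \<in> F X Y"
      using eq_rel_ev[OF X u'(1)] all X cvec.subspace_0[OF F] cvec.subspace_scale[OF F]
      by (auto simp: tensor_linear)
    moreover have "tensor 2 u' a \<in> E X Y" unfolding E_def using u' a by (auto intro!: cvec.span_base)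
    ultimately have 1: "tensor 2 u' a \<in> sasaki (X # Y # Zs) (E X Y) (F X Y)"
      using meet_le_sasaki[OF E(2)] by blast
    have w: "w \<in> forms [X, Y]" unfolding w_def
      using u u' eq_rel_forms[OF \<X>] by (intro cvec.subspace_diff[OF forms_subspace]) auto
    have "form_ip (X # Y # Zs) b (tensor 2 w a) = 0" if "b \<in> E X Y" for b
      using that unfolding E_def
    proof (rule form_ip_span[rotated])
      fix b assume "b \<in> {tensor 2 r s | r s. r \<in> eq_rel \<X> [X, Y] \<and> s \<in> forms Zs}"
      then obtain r s where "b = tensor 2 r s" "r \<in> eq_rel \<X> [X, Y]" by blast
      then show "form_ip (X # Y # Zs) b (tensor 2 w a) = 0"
        using form_ip_tensor[of 2 "[X, Y]" Zs r s w a] u'(2) by (simp add: w_def)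
    qed
    then have "tensor 2 w a \<in> perp (X # Y # Zs) (E X Y)"
      using tensor_in_forms[OF w a, of 2] by (simp add: perp_def)
    then have 2: "tensor 2 w a \<in> sasaki (X # Y # Zs) (E X Y) (F X Y)" using perp_le_sasaki by blast
    have "tensor 2 (tensor 1 t s) a = tensor 2 u' a + tensor 2 w a"
      by (simp add: tensor_linear(1)[symmetric] w_def)
    then show "tensor 2 (tensor 1 t s) a \<in> sasaki (X # Y # Zs) (E X Y) (F X Y)"
      using cvec.subspace_add[OF sasaki_subspace 1 2] by simp
  qed
qed

lemma tensor_unit_form: "r \<in> forms Xs \<Longrightarrow> tensor (length Xs) r unit_form = r"
proof
  fix xs assume r: "r \<in> forms Xs"
  show "tensor (length Xs) r unit_form xs = r xs"
    using formsD(1)[OF r, of xs] tuples_length[of xs Xs] by (cases "length xs \<le> length Xs") (auto simp: tensor_def unit_form_def)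
qed

lemma holds_ForallEq_iff:
  assumes "quantum_set \<X>" "sort_of x = \<X>" "sort_of y = dual_qset \<X>" "x \<noteq> y"
  shows "holds (ForallEq x y \<phi>) \<longleftrightarrow> (\<forall>X\<in>\<X>. ev X \<in> interp \<phi> [x, y] [X, dual X])"
proof -
  have "tensor 2 (ev X) unit_form = ev X" if "X \<in> \<X>" for X
    using tensor_unit_form[OF ev_in_forms[OF qset_fd[OF assms(1) that]]] by (simp add: numeral_2_eq_2)
  then show ?thesis
    unfolding holds_Forall_iff using mem_ForallEq_iff[OF assms(1-3), of "[]" "[]" unit_form \<phi>] assms(4)
    by (simp add: unit_form_in_forms del: interp.simps)
qed


section \<open>Operators as bilinear forms\<close>

text \<open>The element of \<open>hat R(X \<otimes> Y\<^sup>*)\<close> that corresponds to \<open>r \<in> R(X, Y)\<close>.\<close>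

definition op_form :: "'v::cvector atom \<Rightarrow> ('v vec \<Rightarrow> 'v vec) \<Rightarrow> 'v form" where
  "op_form Y r xs = (case xs of [x, f] \<Rightarrow> if f \<in> carrier (hs (dual Y)) then pairing Y (r x) f else 0 | _ \<Rightarrow> 0)"

definition slice2 :: "('v::cvector vec \<Rightarrow> 'v vec \<Rightarrow> complex) \<Rightarrow> 'v form" where
  "slice2 g xs = (case xs of [x, y] \<Rightarrow> g x y | _ \<Rightarrow> 0)"

lemma slice2_simp [simp]: "slice2 g [x, y] = g x y"
  by (simp add: slice2_def)

lemma slice2_eta: "length xs \<noteq> 2 \<Longrightarrow> slice2 g xs = 0"
  by (auto simp: slice2_def split: list.splits)

lemma forms2_slice2: "r \<in> forms [X, Y] \<Longrightarrow> slice2 (\<lambda>x y. r [x, y]) = r"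
proof
  fix xs assume r: "r \<in> forms [X, Y]"
  show "slice2 (\<lambda>x y. r [x, y]) xs = r xs"
    using formsD(1)[OF r, of xs] tuples_length[of xs "[X, Y]"]
    by (auto simp: slice2_def split: list.splits)
qed

lemma slice2_linear:
  "slice2 (\<lambda>x y. g x y + h x y) = slice2 g + slice2 h" "slice2 (\<lambda>x y. c * g x y) = c *C slice2 g"
  "slice2 (\<lambda>x y. \<Sum>i\<in>I. g' i x y) = (\<Sum>i\<in>I. slice2 (g' i))"
  by (auto simp: slice2_def fun_eq_iff scaleC_fun_def scaleC_complex_def sum_fun_apply split: list.splits)

lemma slice2_in_forms:
  assumes "\<And>x y. \<not> (x \<in> carrier (hs X) \<and> y \<in> carrier (hs Y)) \<Longrightarrow> g x y = 0"
    and "\<And>x x' y. x \<in> carrier (hs X) \<Longrightarrow> x' \<in> carrier (hs X) \<Longrightarrow> y \<in> carrier (hs Y) \<Longrightarrow> g (x + x') y = g x y + g x' y"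
    and "\<And>x y y'. x \<in> carrier (hs X) \<Longrightarrow> y \<in> carrier (hs Y) \<Longrightarrow> y' \<in> carrier (hs Y) \<Longrightarrow> g x (y + y') = g x y + g x y'"
    and "\<And>x y c. x \<in> carrier (hs X) \<Longrightarrow> y \<in> carrier (hs Y) \<Longrightarrow> g (c *C x) y = c * g x y"
    and "\<And>x y c. x \<in> carrier (hs X) \<Longrightarrow> y \<in> carrier (hs Y) \<Longrightarrow> g x (c *C y) = c * g x y"
  shows "slice2 g \<in> forms [X, Y]"
proof (rule formsI)
  fix xs assume "xs \<notin> tuples [X, Y]"
  then show "slice2 g xs = 0" using assms(1) by (auto simp: slice2_def split: list.splits)
next
  fix xs i y assume a: "xs \<in> tuples [X, Y]" "i < length [X, Y]" "y \<in> carrier (hs ([X, Y] ! i))"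
  then obtain u v where xs: "xs = [u, v]" "u \<in> carrier (hs X)" "v \<in> carrier (hs Y)"
    unfolding tuples_Cons by auto
  consider "i = 0" | "i = 1" using a(2) by fastforce
  note i_cases = this
  show "slice2 g (xs[i := c *C y]) = c * slice2 g (xs[i := y])" for c
    using i_cases a(3) xs assms(4,5) by cases simp_all
  fix z assume z: "z \<in> carrier (hs ([X, Y] ! i))"
  show "slice2 g (xs[i := y + z]) = slice2 g (xs[i := y]) + slice2 g (xs[i := z])"
    using i_cases z a(3) xs assms(2,3) by cases simp_all
qed

lemma op_form_slice2: "op_form Y r = slice2 (\<lambda>x f. if f \<in> carrier (hs (dual Y)) then pairing Y (r x) f else 0)"
  by (auto simp: op_form_def slice2_def fun_eq_iff split: list.splits)

lemma op_form_apply: "f \<in> carrier (hs (dual Y)) \<Longrightarrow> op_form Y r [x, f] = pairing Y (r x) f"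
  by (simp add: op_form_def)

lemma pairing_zero_left: "fd_atom X \<Longrightarrow> f \<in> carrier (hs (dual X)) \<Longrightarrow> pairing X 0 f = 0"
  using pairing_left(2)[of X f 0 0] hs_prehilbert[of X] by simp

lemma op_form_in_forms:
  assumes X: "fd_atom X" and Y: "fd_atom Y" and r: "r \<in> ops (hs X) (hs Y)"
  shows "op_form Y r \<in> forms [X, dual Y]"
  unfolding op_form_slice2
proof (rule slice2_in_forms)
  note pY = hs_prehilbert[of "dual Y", unfolded fd_atom_dual, OF Y]
  fix x f assume "\<not> (x \<in> carrier (hs X) \<and> f \<in> carrier (hs (dual Y)))"
  then show "(if f \<in> carrier (hs (dual Y)) then pairing Y (r x) f else 0) = 0"
    using opsD(4)[OF r, of x] pairing_zero_left[OF Y, of f] by (cases "f \<in> carrier (hs (dual Y))") simp_all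
qed (use opsD[OF r] Y hs_prehilbert[of "dual Y"] in \<open>simp_all add: pairing_left pairing_right\<close>)

lemma op_form_linear:
  assumes X: "fd_atom X" and Y: "fd_atom Y" and r: "r \<in> ops (hs X) (hs Y)" and s: "s \<in> ops (hs X) (hs Y)"
  shows "op_form Y (r + s) = op_form Y r + op_form Y s" "op_form Y (c *C r) = c *C op_form Y r"
proof -
  have c: "r x \<in> carrier (hs Y)" "s x \<in> carrier (hs Y)" for x
    using opsD(1,4)[OF r, of x] opsD(1,4)[OF s, of x] hs_prehilbert[OF Y] by (cases "x \<in> carrier (hs X)", auto)+
  show "op_form Y (r + s) = op_form Y r + op_form Y s" "op_form Y (c *C r) = c *C op_form Y r"
    using c by (auto simp: op_form_def fun_eq_iff scaleC_fun_def scaleC_complex_def pairing_left[OF Y] split: list.splits)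
qed

lemma op_form_inj:
  assumes Y: "fd_atom Y" and r: "r \<in> ops (hs X) (hs Y)" and s: "s \<in> ops (hs X) (hs Y)"
    and eq: "op_form Y r = op_form Y s"
  shows "r = s"
proof (rule ops_eqI[OF r s])
  fix x assume x: "x \<in> carrier (hs X)"
  show "r x = s x"
  proof (rule pairing_separates[OF Y opsD(1)[OF r x] opsD(1)[OF s x]])
    fix f assume "f \<in> carrier (hs (dual Y))"
    then show "pairing Y (r x) f = pairing Y (s x) f"
      using fun_cong[OF eq, of "[x, f]"] by (simp add: op_form_apply)
  qed
qed

lemma op_form_image_subspace:
  assumes X: "fd_atom X" and Y: "fd_atom Y" and S: "cvec.subspace S" "S \<subseteq> ops (hs X) (hs Y)"
  shows "cvec.subspace (op_form Y ` S)" "op_form Y ` S \<subseteq> forms [X, dual Y]"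
proof -
  show "op_form Y ` S \<subseteq> forms [X, dual Y]" using S(2) op_form_in_forms[OF X Y] by auto
  have 0: "op_form Y 0 = 0"
    using cvec.subspace_0[OF S(1)] S(2) op_form_linear(2)[OF X Y, of 0 0 0] by auto
  show "cvec.subspace (op_form Y ` S)"
  proof (rule cvec.subspaceI)
    show "0 \<in> op_form Y ` S" using imageI[OF cvec.subspace_0[OF S(1)], of "op_form Y"] by (simp only: 0)
    fix u v assume "u \<in> op_form Y ` S" "v \<in> op_form Y ` S"
    then obtain r s where rs: "u = op_form Y r" "v = op_form Y s" "r \<in> S" "s \<in> S" by blast
    have "u + v = op_form Y (r + s)"
      using op_form_linear(1)[OF X Y subsetD[OF S(2) rs(3)] subsetD[OF S(2) rs(4)]] rs(1,2) by simp
    then show "u + v \<in> op_form Y ` S" using cvec.subspace_add[OF S(1) rs(3,4)] by simp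
  next
    fix c u assume "u \<in> op_form Y ` S"
    then obtain r where r: "u = op_form Y r" "r \<in> S" by blast
    have "c *C u = op_form Y (c *C r)"
      using op_form_linear(2)[OF X Y subsetD[OF S(2) r(2)] subsetD[OF S(2) r(2)]] r(1) by simp
    then show "c *C u \<in> op_form Y ` S" using cvec.subspace_scale[OF S(1) r(2)] by simp
  qed
qed

lemma binary_relationD:
  assumes "binary_relation \<X> \<Y> R"
  shows "cvec.subspace (R X Y)" "X \<in> \<X> \<Longrightarrow> Y \<in> \<Y> \<Longrightarrow> R X Y \<subseteq> ops (hs X) (hs Y)"
    "\<not> (X \<in> \<X> \<and> Y \<in> \<Y>) \<Longrightarrow> R X Y = {0}"
proof -
  have *: "cvec.subspace (R X Y)" "R X Y \<subseteq> (if X \<in> \<X> \<and> Y \<in> \<Y> then ops (hs X) (hs Y) else {0})"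
    using assms by (auto simp: binary_relation_def)
  then show "cvec.subspace (R X Y)" "X \<in> \<X> \<Longrightarrow> Y \<in> \<Y> \<Longrightarrow> R X Y \<subseteq> ops (hs X) (hs Y)" by auto
  assume "\<not> (X \<in> \<X> \<and> Y \<in> \<Y>)"
  then show "R X Y = {0}" using * cvec.subspace_0[OF *(1)] by (auto split: if_splits)
qed

lemma ev_op_form:
  assumes X: "fd_atom X" shows "ev X = op_form X (id_op (hs X))"
proof
  fix xs
  show "ev X xs = op_form X (id_op (hs X)) xs"
    using pairing_zero_left[OF X]
    by (auto simp: ev_def op_form_def id_op_def tuples_Cons split: list.splits)
qed

lemma ev_comp:
  assumes X: "fd_atom X" and Y: "fd_atom Y" and b: "b \<in> ops (hs X) (hs Y)"
  shows "(\<lambda>xs. case xs of [x, f] \<Rightarrow> ev Y [b x, id_op (hs (dual Y)) f] | _ \<Rightarrow> 0) = op_form Y b"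
proof
  have c: "b x \<in> carrier (hs Y)" for x
    using opsD(1,4)[OF b, of x] hs_prehilbert[OF Y] by (cases "x \<in> carrier (hs X)") auto
  have z: "0 \<in> carrier (hs (dual Y))" "pairing Y (b x) 0 = 0" for x
    using hs_prehilbert[of "dual Y"] Y pairing_right(2)[OF Y c, of 0 x 0] by auto
  fix xs
  show "(case xs of [x, f] \<Rightarrow> ev Y [b x, id_op (hs (dual Y)) f] | _ \<Rightarrow> 0) = op_form Y b xs"
    using c z by (auto simp: ev_def op_form_def id_op_def split: list.splits)
qed

text \<open>In the composition with the equality relation and the identity relation, only the summand at \<open>Y \<otimes> Y\<^sup>*\<close> is not zero.\<close>

lemma hat_eq:
  assumes \<X>: "quantum_set \<X>" and R: "binary_relation \<X> \<X> R" and X: "X \<in> \<X>" and Y: "Y \<in> \<X>"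
  shows "hat \<X> R [X, dual Y] = op_form Y ` R X Y"
proof -
  have fX: "fd_atom X" and fY: "fd_atom Y" using qset_fd[OF \<X>] X Y by auto
  note RXY = binary_relationD(1)[OF R, of X Y] binary_relationD(2)[OF R X Y]
  note S = op_form_image_subspace[OF fX fY RXY]
  define G where "G = {(\<lambda>xs. case xs of [x, x'] \<Rightarrow> s [b x, c x'] | _ \<Rightarrow> (0::complex)) | s b c Z Z'.
          s \<in> eq_rel \<X> [Z, Z'] \<and> b \<in> R X Z \<and> c \<in> id_rel (dual_qset \<X>) (dual Y) Z'}"
  have "G \<subseteq> op_form Y ` R X Y"
  proof
    fix u assume "u \<in> G"
    then obtain s b c Z Z' where u: "u = (\<lambda>xs. case xs of [x, x'] \<Rightarrow> s [b x, c x'] | _ \<Rightarrow> 0)"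
      and s: "s \<in> eq_rel \<X> [Z, Z']" and b: "b \<in> R X Z" and c: "c \<in> id_rel (dual_qset \<X>) (dual Y) Z'"
      unfolding G_def by blast
    have zero: "u \<in> op_form Y ` R X Y" if "u = 0" using cvec.subspace_0[OF S(1)] that by simp
    show "u \<in> op_form Y ` R X Y"
    proof (cases "s = 0")
      case True
      then have "u = 0" by (auto simp: u fun_eq_iff split: list.splits)
      then show ?thesis by (rule zero)
    next
      case False
      then have "Z \<in> \<X>" "Z' = dual Z" using s by (auto simp: eq_rel_def split: if_splits)
      with s False obtain k where s_eq: "s = k *C ev Z" using eq_rel_ev[of Z \<X> s Z'] by auto
      have sz: "s [b x, 0] = 0" for x
      proof -
        have fZ: "fd_atom Z" using qset_fd[OF \<X> \<open>Z \<in> \<X>\<close>] .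
        show ?thesis unfolding s_eq using pairing_right(2)[OF fZ, of "b x" 0 0] hs_prehilbert[of "dual Z"] fZ
          by (auto simp: ev_def scaleC_fun_def scaleC_complex_def)
      qed
      show ?thesis
      proof (cases "c = 0")
        case True
        then have "u = 0" using sz by (auto simp: u fun_eq_iff split: list.splits)
        then show ?thesis by (rule zero)
      next
        case False
        then have "Z' = dual Y" using c by (auto simp: id_rel_def split: if_splits)
        then have "Z = Y" using \<open>Z' = dual Z\<close> injD[OF inj_dual] by metis
        obtain l where c_eq: "c = l *C id_op (hs (dual Y))"
          using c False by (auto simp: id_rel_def cvec.span_singleton split: if_splits)
        have bo: "b \<in> ops (hs X) (hs Y)" using b RXY \<open>Z = Y\<close> by auto
        have bc: "b x \<in> carrier (hs Y)" for x
          using opsD(1,4)[OF bo, of x] hs_prehilbert[OF fY] by (cases "x \<in> carrier (hs X)") auto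
        have pD: "prehilbert (hs (dual Y))" using hs_prehilbert[of "dual Y"] fY by simp
        have "ev Y [b x, l *C id_op (hs (dual Y)) f] = l * ev Y [b x, id_op (hs (dual Y)) f]" for x f
          using bc pD pairing_right(2)[OF fY bc, of "id_op (hs (dual Y)) f" x l]
          by (simp add: ev_def id_op_def)
        then have "u = (k * l) *C op_form Y b"
          unfolding ev_comp[OF fX fY bo, symmetric]
          by (auto simp: u s_eq c_eq \<open>Z = Y\<close> fun_eq_iff scaleC_fun_def scaleC_complex_def split: list.splits)
        then show ?thesis using b \<open>Z = Y\<close> cvec.subspace_scale[OF S(1)] by auto
      qed
    qed
  qed
  moreover have "op_form Y ` R X Y \<subseteq> G"
  proof
    fix u assume "u \<in> op_form Y ` R X Y"
    then obtain b where b: "b \<in> R X Y" "u = op_form Y b" by blast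
    have "u = (\<lambda>xs. case xs of [x, x'] \<Rightarrow> ev Y [b x, id_op (hs (dual Y)) x'] | _ \<Rightarrow> 0)"
      using ev_comp[OF fX fY, of b] b RXY by auto
    moreover have "ev Y \<in> eq_rel \<X> [Y, dual Y]" using Y by (simp add: eq_rel_def cvec.span_base)
    moreover have "id_op (hs (dual Y)) \<in> id_rel (dual_qset \<X>) (dual Y) (dual Y)"
      using Y by (simp add: id_rel_def cvec.span_base)
    ultimately show "u \<in> G" unfolding G_def using b(1) by blast
  qed
  moreover have "hat \<X> R [X, dual Y] = cvec.span G"
    by (simp add: hat_def comp_times_def G_def)
  ultimately show ?thesis using S(1) cvec.span_eq_iff[of "op_form Y ` R X Y"] by (metis subset_antisym)
qed

subsection \<open>Conjugate forms\<close>

lemma riesz_vec_linear: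
  assumes X: "fd_atom X" and f: "f \<in> carrier (hs (dual X))"
  shows "g \<in> carrier (hs (dual X)) \<Longrightarrow> riesz_vec X (f + g) = riesz_vec X f + riesz_vec X g"
    "riesz_vec X (c *C f) = cnj c *C riesz_vec X f"
proof -
  note pX = hs_prehilbert[OF X] and pD = hs_prehilbert[of "dual X", unfolded fd_atom_dual, OF X]
  show "riesz_vec X (c *C f) = cnj c *C riesz_vec X f"
    using pX pD f riesz_vec[OF X f]
    by (intro riesz_vec_eqI X) (simp_all add: pairing_right[OF X] ip_scale_left)
  assume g: "g \<in> carrier (hs (dual X))"
  show "riesz_vec X (f + g) = riesz_vec X f + riesz_vec X g"
    using pX pD f g riesz_vec[OF X f] riesz_vec[OF X g]
    by (intro riesz_vec_eqI X) (simp_all add: pairing_right[OF X] ip_add_left)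
qed

lemma riesz_vec_riesz_vec:
  assumes X: "fd_atom X" and v: "v \<in> carrier (hs X)"
  shows "riesz_vec X (riesz_vec (dual X) v) = v" "riesz_vec (dual X) v \<in> carrier (hs (dual X))"
proof -
  have X': "fd_atom (dual X)" "v \<in> carrier (hs (dual (dual X)))" using X v by simp_all
  note r = riesz_vec[OF X']
  show f: "riesz_vec (dual X) v \<in> carrier (hs (dual X))" by (rule r(1))
  show "riesz_vec X (riesz_vec (dual X) v) = v"
  proof (rule pairing_separates[OF X riesz_vec(1)[OF X f] v])
    fix g assume g: "g \<in> carrier (hs (dual X))"
    have "pairing X (riesz_vec X (riesz_vec (dual X) v)) g = ip (hs (dual X)) (riesz_vec (dual X) v) g"
      using riesz_vec_ip[OF X f g] riesz_vec(2)[OF X g riesz_vec(1)[OF X f]] by simp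
    also have "\<dots> = pairing X v g" using r(2)[OF g] by (simp add: pairing_dual)
    finally show "pairing X (riesz_vec X (riesz_vec (dual X) v)) g = pairing X v g" .
  qed
qed

lemma pairing_riesz_vec_dual:
  assumes X: "fd_atom X" and z: "z \<in> carrier (hs X)" and x: "x \<in> carrier (hs X)"
  shows "pairing X z (riesz_vec (dual X) x) = ip (hs X) x z"
  using riesz_vec(2)[OF X riesz_vec_riesz_vec(2)[OF X x] z] riesz_vec_riesz_vec(1)[OF X x] by simp

text \<open>The operation \<open>r \<mapsto> r\<^sub>*\<close> for forms on \<open>X \<otimes> Y\<^sup>*\<close>.\<close>

definition conj2 :: "'v::cvector atom \<Rightarrow> 'v atom \<Rightarrow> 'v form \<Rightarrow> 'v form" where
  "conj2 X Y r = slice2 (\<lambda>f y. if f \<in> carrier (hs (dual X)) \<and> y \<in> carrier (hs Y)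
     then cnj (r [riesz_vec X f, riesz_vec (dual Y) y]) else 0)"

lemma conj_form_conj2: "conj_form [X, dual Y] = conj2 X Y"
proof (intro ext)
  fix r and fs :: "'a vec list"
  show "conj_form [X, dual Y] r fs = conj2 X Y r fs"
  proof (cases "\<exists>f y. fs = [f, y]")
    case True
    then obtain f y where "fs = [f, y]" by blast
    then show ?thesis by (simp add: conj_form_def conj2_def)
  next
    case False
    then have "length fs \<noteq> 2" by (auto simp: length_Suc_conv numeral_2_eq_2)
    then show ?thesis
      using tuples_length[of fs "map dual [X, dual Y]"] by (auto simp: conj_form_def conj2_def slice2_eta)
  qed
qed

lemma forms2D:
  assumes r: "r \<in> forms [X, Y]"
  shows "x \<in> carrier (hs X) \<Longrightarrow> x' \<in> carrier (hs X) \<Longrightarrow> y \<in> carrier (hs Y) \<Longrightarrow> r [x + x', y] = r [x, y] + r [x', y]"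
    "x \<in> carrier (hs X) \<Longrightarrow> y \<in> carrier (hs Y) \<Longrightarrow> y' \<in> carrier (hs Y) \<Longrightarrow> r [x, y + y'] = r [x, y] + r [x, y']"
    "x \<in> carrier (hs X) \<Longrightarrow> y \<in> carrier (hs Y) \<Longrightarrow> r [c *C x, y] = c * r [x, y]"
    "x \<in> carrier (hs X) \<Longrightarrow> y \<in> carrier (hs Y) \<Longrightarrow> r [x, c *C y] = c * r [x, y]"
  using formsD(2,3)[OF r, of "[x, y]" 0] formsD(2,3)[OF r, of "[x, y]" 1] by simp_all

lemma conj2_in_forms:
  assumes X: "fd_atom X" and Y: "fd_atom Y" and r: "r \<in> forms [X, dual Y]"
  shows "conj2 X Y r \<in> forms [dual X, Y]"
proof -
  have Y': "fd_atom (dual Y)" using Y by simp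
  note lX = riesz_vec_linear[OF X] riesz_vec(1)[OF X]
  note lY = riesz_vec_linear[OF Y', unfolded dual_dual] riesz_vec(1)[OF Y', unfolded dual_dual]
  show ?thesis unfolding conj2_def
    using hs_prehilbert[OF Y] hs_prehilbert[of "dual X", unfolded fd_atom_dual, OF X]
    by - (rule slice2_in_forms, erule if_not_P, simp_all add: lX lY forms2D[OF r])
qed

lemma conj2_apply:
  "f \<in> carrier (hs (dual X)) \<Longrightarrow> y \<in> carrier (hs Y) \<Longrightarrow> conj2 X Y r [f, y] = cnj (r [riesz_vec X f, riesz_vec (dual Y) y])"
  by (simp add: conj2_def)

lemma conj2_inj:
  assumes X: "fd_atom X" and Y: "fd_atom Y" and r: "r \<in> forms [X, dual Y]" and s: "s \<in> forms [X, dual Y]"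
    and eq: "conj2 X Y r = conj2 X Y s"
  shows "r = s"
proof
  fix xs
  show "r xs = s xs"
  proof (cases "xs \<in> tuples [X, dual Y]")
    case True
    then obtain x g where xs: "xs = [x, g]" "x \<in> carrier (hs X)" "g \<in> carrier (hs (dual Y))"
      unfolding tuples_Cons by auto
    have Y': "fd_atom (dual Y)" using Y by simp
    note x' = riesz_vec_riesz_vec[OF X xs(2)] and g' = riesz_vec_riesz_vec[OF Y' xs(3), unfolded dual_dual]
    show ?thesis
      using fun_cong[OF eq, of "[riesz_vec (dual X) x, riesz_vec Y g]"] x' g' xs(1) by (simp add: conj2_apply)
  qed (simp add: formsD(1)[OF r] formsD(1)[OF s])
qed

lemma conj2_image_subspace:
  assumes X: "fd_atom X" and Y: "fd_atom Y" and S: "cvec.subspace S" "S \<subseteq> forms [X, dual Y]"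
  shows "cvec.subspace (conj2 X Y ` S)" "conj2 X Y ` S \<subseteq> forms [dual X, Y]"
proof -
  show "conj2 X Y ` S \<subseteq> forms [dual X, Y]" using S(2) conj2_in_forms[OF X Y] by auto
  have lin: "conj2 X Y 0 = 0" "conj2 X Y (r + s) = conj2 X Y r + conj2 X Y s" "conj2 X Y (cnj c *C r) = c *C conj2 X Y r" for r s c
    by (auto simp: conj2_def slice2_def fun_eq_iff scaleC_fun_def scaleC_complex_def split: list.splits)
  show "cvec.subspace (conj2 X Y ` S)"
  proof (rule cvec.subspaceI)
    show "0 \<in> conj2 X Y ` S" using imageI[OF cvec.subspace_0[OF S(1)], of "conj2 X Y"] by (simp only: lin)
    fix u v assume "u \<in> conj2 X Y ` S" "v \<in> conj2 X Y ` S"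
    then obtain r s where rs: "u = conj2 X Y r" "v = conj2 X Y s" "r \<in> S" "s \<in> S" by blast
    show "u + v \<in> conj2 X Y ` S"
      unfolding rs(1,2) lin(2)[symmetric] by (intro imageI cvec.subspace_add[OF S(1)] rs)
  next
    fix c u assume "u \<in> conj2 X Y ` S"
    then obtain r where r: "u = conj2 X Y r" "r \<in> S" by blast
    show "c *C u \<in> conj2 X Y ` S"
      unfolding r(1) lin(3)[symmetric] by (intro imageI cvec.subspace_scale[OF S(1)] r)
  qed
qed

lemma conj_rel_hat:
  assumes "quantum_set \<X>" "binary_relation \<X> \<X> R" "X \<in> \<X>" "Y \<in> \<X>"
  shows "conj_rel (hat \<X> R) [dual X, Y] = conj2 X Y ` op_form Y ` R X Y"
  using hat_eq[OF assms] by (simp add: conj_rel_def conj_form_conj2)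

lemma ball_tuples:
  "(\<forall>zs\<in>tuples []. P zs) \<longleftrightarrow> P []"
  "(\<forall>zs\<in>tuples (X # Xs). P zs) \<longleftrightarrow> (\<forall>z\<in>carrier (hs X). \<forall>zs\<in>tuples Xs. P (z # zs))"
  unfolding Ball_def tuples_Cons by auto

section \<open>Reflexivity\<close>

lemma atomic_self:
  assumes ctx: "distinct [x, y]" and Xs: "[X, Y] \<in> listset [sort_of x, sort_of y]" "fd_atoms [X, Y]"
    and R: "cvec.subspace (R [X, Y])" "R [X, Y] \<subseteq> forms [X, Y]"
  shows "atomic [x, y] R [x, y] [X, Y] = R [X, Y]"
proof -
  have "a \<in> atomic [x, y] R [x, y] [X, Y] \<longleftrightarrow> a \<in> R [X, Y]" for a
  proof -
    have "(\<lambda>ws. if length ws = 2 then a (arrange [x, y] [x, y] ws) else 0) = a" if a: "a \<in> forms [X, Y]"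
    proof
      fix ws show "(if length ws = 2 then a (arrange [x, y] [x, y] ws) else 0) = a ws"
        using formsD(1)[OF a, of ws] tuples_length[of ws "[X, Y]"] ctx
        by (cases "length ws = 2") (auto simp: arrange_self)
    qed
    moreover have "arrange [x, y] [x, y] [X, Y] = [X, Y]" using ctx by (simp add: arrange_self)
    moreover have "a \<in> atomic [x, y] R [x, y] [X, Y] \<longleftrightarrow> a \<in> forms [X, Y] \<and>
        (\<lambda>ws. if length ws = 2 then a (arrange [x, y] [x, y] ws) else 0) \<in> R [X, Y]"
    proof -
      have rest: "filter (\<lambda>z. z \<notin> set [x, y]) [x, y] = []" by simp
      have nil: "arrange [x, y] [] [X, Y] = []" by (simp add: arrange_def)
      have len: "length [x, y] = 2" by simp
      from atomic_iff_slices[of "[x, y]" "[x, y]" "[X, Y]" R a, unfolded rest nil calculation(2) append_Nil2 len]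
      show ?thesis using ctx Xs R by (simp add: ball_tuples del: listset.simps cong: if_cong)
    qed
    ultimately show ?thesis using R(2) by (cases "a \<in> forms [X, Y]") auto
  qed
  then show ?thesis by blast
qed

lemma reflexivity_iff:
  assumes \<X>: "quantum_set \<X>" and x: "sort_of x = \<X>" and y: "sort_of y = dual_qset \<X>" and xy: "x \<noteq> y"
    and R: "binary_relation \<X> \<X> R"
  shows "holds (ForallEq x y (Rel (hat \<X> R) [x, y])) \<longleftrightarrow> (\<forall>X\<in>\<X>. id_op (hs X) \<in> R X X)"
proof -
  have "ev X \<in> interp (Rel (hat \<X> R) [x, y]) [x, y] [X, dual X] \<longleftrightarrow> id_op (hs X) \<in> R X X" if X: "X \<in> \<X>" for X
  proof -
    have fX: "fd_atom X" using qset_fd[OF \<X> X] .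
    note RXX = binary_relationD(1)[OF R, of X X] binary_relationD(2)[OF R X X]
    note S = op_form_image_subspace[OF fX fX RXX]
    have "interp (Rel (hat \<X> R) [x, y]) [x, y] [X, dual X] = op_form X ` R X X"
      using atomic_self[of x y X "dual X" "hat \<X> R"] xy X x y fX S hat_eq[OF \<X> R X X]
      by (simp add: in_listset_iff del: listset.simps)
    moreover have "op_form X (id_op (hs X)) \<in> op_form X ` R X X \<longleftrightarrow> id_op (hs X) \<in> R X X"
      using op_form_inj[OF fX id_op_in_ops[OF hs_prehilbert[OF fX]]] RXX(2) by blast
    ultimately show ?thesis by (simp only: ev_op_form[OF fX])
  qed
  then show ?thesis using holds_ForallEq_iff[OF \<X> x y xy] by simp
qed


text \<open>The case of two argument variables.  The slices are given as functions of two vectors, so that \<open>arrange\<close> is applied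
  to explicit lists only and can be evaluated.\<close>

lemma atomic2_iff_slices:
  fixes ctx :: "'v::cvector var list" and u v :: "'v var"
  defines "rest \<equiv> filter (\<lambda>z. z \<notin> {u, v}) ctx"
  assumes ctx: "distinct ctx" "u \<noteq> v" "{u, v} \<subseteq> set ctx"
    and Xs: "Xs \<in> listset (map sort_of ctx)" "fd_atoms Xs"
    and R: "cvec.subspace (R (arrange ctx [u, v] Xs))" "R (arrange ctx [u, v] Xs) \<subseteq> forms (arrange ctx [u, v] Xs)"
  shows "a \<in> atomic ctx R [u, v] Xs \<longleftrightarrow> a \<in> forms Xs \<and>
    (\<forall>zs\<in>tuples (arrange ctx rest Xs).
       slice2 (\<lambda>p q. a (arrange (u # v # rest) ctx (p # q # zs))) \<in> R (arrange ctx [u, v] Xs))"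
proof -
  have "(\<lambda>ws. if length ws = length [u, v] then a (arrange ([u, v] @ rest) ctx (ws @ zs)) else 0)
      = slice2 (\<lambda>p q. a (arrange (u # v # rest) ctx (p # q # zs)))" for zs
  proof
    fix ws
    show "(if length ws = length [u, v] then a (arrange ([u, v] @ rest) ctx (ws @ zs)) else 0)
      = slice2 (\<lambda>p q. a (arrange (u # v # rest) ctx (p # q # zs))) ws"
    proof (cases "length ws = 2")
      case True
      then obtain p q where "ws = [p, q]" by (auto simp: numeral_2_eq_2 length_Suc_conv)
      then show ?thesis by simp
    qed (simp add: slice2_eta)
  qed
  note slice = this
  have rest: "filter (\<lambda>y. y \<notin> set [u, v]) ctx = rest" by (simp add: rest_def)
  from atomic_iff_slices[of ctx "[u, v]" Xs R a, unfolded rest slice] show ?thesis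
    using ctx Xs R by simp
qed

section \<open>Antisymmetry\<close>

text \<open>If \<open>P \<subseteq> Q\<close>, then the component of a form in \<open>P\<close> and the one orthogonal to \<open>P\<close> belong to the implication for
  different reasons; the converse is modus ponens.\<close>

lemma forms_le_sasaki_iff:
  assumes Xs: "fd_atoms Xs" and P: "cvec.subspace P" "P \<subseteq> forms Xs" and Q: "cvec.subspace Q"
  shows "forms Xs \<subseteq> sasaki Xs P Q \<longleftrightarrow> P \<subseteq> Q"
proof
  assume "forms Xs \<subseteq> sasaki Xs P Q"
  then show "P \<subseteq> Q" using sasaki_modus_ponens[OF Xs P Q] P(2) by blast
next
  assume PQ: "P \<subseteq> Q"
  show "forms Xs \<subseteq> sasaki Xs P Q"
  proof
    fix a assume a: "a \<in> forms Xs"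
    obtain a' where a': "a' \<in> P" "\<And>b. b \<in> P \<Longrightarrow> form_ip Xs b (a - a') = 0"
      using orthogonal_projection[OF form_space_fd[OF Xs] P(1), of a] P(2) a by auto
    have "a' \<in> sasaki Xs P Q" using meet_le_sasaki[OF P(2), of Q] a' PQ by blast
    moreover have "a - a' \<in> perp Xs P"
      using a' a P(2) by (auto simp: perp_def intro: cvec.subspace_diff[OF forms_subspace])
    then have "a - a' \<in> sasaki Xs P Q" using perp_le_sasaki by blast
    ultimately have "a' + (a - a') \<in> sasaki Xs P Q" by (rule cvec.subspace_add[OF sasaki_subspace])
    then show "a \<in> sasaki Xs P Q" by simp
  qed
qed

lemma holds_Forall_Forall_iff:
  assumes x: "\<And>X. X \<in> sort_of x \<Longrightarrow> fd_atom X" and y: "\<And>Y. Y \<in> sort_of y \<Longrightarrow> fd_atom Y"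
  shows "holds (Forall x (Forall y \<phi>)) \<longleftrightarrow> (\<forall>X\<in>sort_of x. \<forall>Y\<in>sort_of y. forms [Y, X] \<subseteq> interp \<phi> [y, x] [Y, X])"
proof -
  have t: "tensor 1 t unit_form = t" if "t \<in> forms [X]" for t :: "'a form" and X
    using tensor_unit_form[OF that] by simp
  have "holds (Forall x (Forall y \<phi>)) \<longleftrightarrow>
    (\<forall>X\<in>sort_of x. \<forall>t\<in>forms [X]. t \<in> interp (Forall y \<phi>) [x] [X])"
    unfolding holds_Forall_iff mem_Forall_iff[of _ x]
    by (simp add: t unit_form_in_forms top_rel_def del: interp.simps One_nat_def)
  also have "\<dots> \<longleftrightarrow> (\<forall>X\<in>sort_of x. \<forall>t\<in>forms [X]. \<forall>Y\<in>sort_of y. \<forall>s\<in>forms [Y]. tensor 1 s t \<in> interp \<phi> [y, x] [Y, X])"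
    unfolding mem_Forall_iff[of _ y]
    by (intro ball_cong refl) (simp add: top_rel_def in_listset_iff del: interp.simps One_nat_def listset.simps)
  also have "\<dots> \<longleftrightarrow> (\<forall>X\<in>sort_of x. \<forall>Y\<in>sort_of y. forms [Y, X] \<subseteq> interp \<phi> [y, x] [Y, X])"
  proof (intro iffI ballI)
    fix X Y assume "X \<in> sort_of x" "Y \<in> sort_of y" and
      "\<forall>X\<in>sort_of x. \<forall>t\<in>forms [X]. \<forall>Y\<in>sort_of y. \<forall>s\<in>forms [Y]. tensor 1 s t \<in> interp \<phi> [y, x] [Y, X]"
    then show "forms [Y, X] \<subseteq> interp \<phi> [y, x] [Y, X]"
      using forms_spanned_by_tensors[of "[Y]" "interp \<phi> [y, x] [Y, X]" 1 "[X]"]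
        interp_subspace[of \<phi> "[y, x]" "[Y, X]"] y by simp
  next
    fix X t Y s assume "\<forall>X\<in>sort_of x. \<forall>Y\<in>sort_of y. forms [Y, X] \<subseteq> interp \<phi> [y, x] [Y, X]"
      "X \<in> sort_of x" "t \<in> forms [X]" "Y \<in> sort_of y" "s \<in> forms [Y]"
    then show "tensor 1 s t \<in> interp \<phi> [y, x] [Y, X]" using tensor_in_forms[of s "[Y]" t "[X]" 1] by auto
  qed
  finally show ?thesis .
qed

text \<open>Conjugating the form of \<open>s\<close> and exchanging its two arguments yields the form of \<open>s\<^sup>\<dagger>\<close>.  For this reason, the
  conjugate relation stands for \<open>R\<^sup>\<dagger>\<close> in the antisymmetry axiom.\<close>

lemma op_form_adj:
  assumes X: "fd_atom X" and Y: "fd_atom Y" and s: "s \<in> ops (hs Y) (hs X)"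
    and x: "x \<in> carrier (hs X)" and f: "f \<in> carrier (hs (dual Y))"
  shows "conj2 Y X (op_form X s) [f, x] = op_form Y (adj (hs Y) (hs X) s) [x, f]"
proof -
  note A = fd_adj[OF hs_fd[OF Y] hs_prehilbert[OF X] s]
  have rf: "riesz_vec Y f \<in> carrier (hs Y)" using riesz_vec(1)[OF Y f] .
  have sf: "s (riesz_vec Y f) \<in> carrier (hs X)" using opsD(1)[OF s rf] .
  have ax: "adj (hs Y) (hs X) s x \<in> carrier (hs Y)" using opsD(1)[OF A(1) x] .
  have rx: "riesz_vec (dual X) x \<in> carrier (hs (dual X))" using riesz_vec_riesz_vec(2)[OF X x] .
  have "conj2 Y X (op_form X s) [f, x] = cnj (ip (hs X) x (s (riesz_vec Y f)))"
    using x f rx by (simp add: conj2_apply op_form_apply pairing_riesz_vec_dual[OF X sf x])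
  also have "\<dots> = ip (hs X) (s (riesz_vec Y f)) x" by (rule ip_cnj[OF hs_prehilbert[OF X] x sf, symmetric])
  also have "\<dots> = ip (hs Y) (riesz_vec Y f) (adj (hs Y) (hs X) s x)" by (rule A(2)[OF rf x])
  also have "\<dots> = pairing Y (adj (hs Y) (hs X) s x) f" by (rule riesz_vec(2)[OF Y f ax])
  finally show ?thesis using f by (simp add: op_form_apply)
qed

lemma forms2_ext:
  assumes "r \<in> forms [X, Y]" "s \<in> forms [X, Y]"
    "\<And>x y. x \<in> carrier (hs X) \<Longrightarrow> y \<in> carrier (hs Y) \<Longrightarrow> r [x, y] = s [x, y]"
  shows "r = s"
proof
  fix xs show "r xs = s xs"
  proof (cases "xs \<in> tuples [X, Y]")
    case True
    then show ?thesis using assms(3) unfolding tuples_Cons by auto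
  qed (simp add: formsD(1)[OF assms(1)] formsD(1)[OF assms(2)])
qed

lemma swap_in_forms:
  assumes "r \<in> forms [X, Y]"
  shows "slice2 (\<lambda>p q. r [q, p]) \<in> forms [Y, X]"
proof (rule slice2_in_forms)
  fix x y assume "\<not> (x \<in> carrier (hs Y) \<and> y \<in> carrier (hs X))"
  then have "[y, x] \<notin> tuples [X, Y]" unfolding tuples_simps by blast
  then show "r [y, x] = 0" by (rule formsD(1)[OF assms])
qed (simp_all add: forms2D[OF assms])

lemma op_form_eq_rel_iff:
  assumes \<X>: "quantum_set \<X>" and X: "X \<in> \<X>" and Y: "Y \<in> \<X>" and r: "r \<in> ops (hs X) (hs Y)"
  shows "op_form Y r \<in> eq_rel \<X> [X, dual Y] \<longleftrightarrow> r \<in> id_rel \<X> X Y"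
proof -
  have fX: "fd_atom X" and fY: "fd_atom Y" using qset_fd[OF \<X>] X Y by auto
  have d: "(\<exists>Z\<in>\<X>. [X, dual Y] = [Z, dual Z]) \<longleftrightarrow> X = Y" using X injD[OF inj_dual] by auto
  have iX: "id_op (hs X) \<in> ops (hs X) (hs X)" by (rule id_op_in_ops[OF hs_prehilbert[OF fX]])
  show ?thesis
  proof (cases "X = Y")
    case True
    have "op_form X r \<in> cvec.span {op_form X (id_op (hs X))} \<longleftrightarrow> r \<in> cvec.span {id_op (hs X)}"
    proof -
      have "op_form X r = c *C op_form X (id_op (hs X)) \<longleftrightarrow> r = c *C id_op (hs X)" for c
      proof -
        have cI: "c *C id_op (hs X) \<in> ops (hs X) (hs X)"
          by (intro cvec.subspace_scale[OF ops_subspace] iX hs_prehilbert fX)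
        show ?thesis
          using op_form_linear(2)[OF fX fX iX iX, of c] op_form_inj[OF fX _ cI, of r] r True by auto
      qed
      then show ?thesis by (auto simp: cvec.span_singleton)
    qed
    then show ?thesis using True X d by (simp add: eq_rel_def id_rel_def ev_op_form[OF fX] ev_op_form[OF fY])
  next
    case False
    have "op_form Y r = 0 \<longleftrightarrow> r = 0"
    proof -
      have z: "(0 :: 'a vec \<Rightarrow> 'a vec) \<in> ops (hs X) (hs Y)"
        by (intro cvec.subspace_0[OF ops_subspace] hs_prehilbert fX fY)
      have "op_form Y 0 = 0" using op_form_linear(2)[OF fX fY z z, of 0] by simp
      then show ?thesis using op_form_inj[OF fY r z] by auto
    qed
    then show ?thesis using False X d by (simp add: eq_rel_def id_rel_def)
  qed
qed

text \<open>Both conjuncts and the conclusion involve all the variables, so the formula says that the intersection of \<open>R(X, Y)\<close>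
  with the adjoints of \<open>R(Y, X)\<close> is contained in the component of the identity relation.\<close>

lemma antisymmetry_iff:
  assumes \<X>: "quantum_set \<X>" and x: "sort_of x = \<X>" and y: "sort_of y = dual_qset \<X>" and xy: "x \<noteq> y"
    and R: "binary_relation \<X> \<X> R"
  shows "holds (Forall x (Forall y
       (Imp (Conj (Rel (hat \<X> R) [x, y]) (Rel (conj_rel (hat \<X> R)) [y, x])) (Rel (eq_rel \<X>) [x, y])))) \<longleftrightarrow>
    (\<forall>X\<in>\<X>. \<forall>Y\<in>\<X>. \<forall>s\<in>R Y X. adj (hs Y) (hs X) s \<in> R X Y \<longrightarrow> adj (hs Y) (hs X) s \<in> id_rel \<X> X Y)"
    (is "holds (Forall x (Forall y (Imp (Conj ?A ?B) ?E))) \<longleftrightarrow> _")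
proof -
  have key: "forms [dual Y, X] \<subseteq> interp (Imp (Conj ?A ?B) ?E) [y, x] [dual Y, X] \<longleftrightarrow>
    (\<forall>s\<in>R Y X. adj (hs Y) (hs X) s \<in> R X Y \<longrightarrow> adj (hs Y) (hs X) s \<in> id_rel \<X> X Y)"
    if X: "X \<in> \<X>" and Y: "Y \<in> \<X>" for X Y
  proof -
    have fX: "fd_atom X" and fY: "fd_atom Y" using qset_fd[OF \<X>] X Y by auto
    note RXY = binary_relationD(1)[OF R, of X Y] binary_relationD(2)[OF R X Y]
    note RYX = binary_relationD(1)[OF R, of Y X] binary_relationD(2)[OF R Y X]
    note S = op_form_image_subspace[OF fX fY RXY]
    note T = conj2_image_subspace[OF fY fX op_form_image_subspace[OF fY fX RYX]]
    have Xs: "[dual Y, X] \<in> listset (map sort_of [y, x])" "fd_atoms [dual Y, X]"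
      using X Y x y fX fY by (simp_all add: in_listset_iff del: listset.simps)
    have arr: "arrange [y, x] [x, y] [dual Y, X] = [X, dual Y]" "arrange [x, y] [y, x] [p, q] = [q, p]"
      "arrange [y, x] [] [dual Y, X] = []" for p q :: "'a vec"
      using xy by (auto simp: arrange_def)
    have f: "filter (\<lambda>z. z \<notin> {x, y}) [y, x] = []" by simp
    have swap: "a \<in> atomic [y, x] Q [x, y] [dual Y, X] \<longleftrightarrow>
        a \<in> forms [dual Y, X] \<and> slice2 (\<lambda>p q. a [q, p]) \<in> Q [X, dual Y]"
      if "cvec.subspace (Q [X, dual Y])" "Q [X, dual Y] \<subseteq> forms [X, dual Y]" for a Q
      using atomic2_iff_slices[of "[y, x]" x y "[dual Y, X]" Q a, unfolded f arr ball_tuples] xy Xs that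
      by auto
    have A: "a \<in> interp ?A [y, x] [dual Y, X] \<longleftrightarrow>
        a \<in> forms [dual Y, X] \<and> slice2 (\<lambda>p q. a [q, p]) \<in> op_form Y ` R X Y" for a
      using swap[of "hat \<X> R"] S by (simp add: hat_eq[OF \<X> R X Y])
    have E: "a \<in> interp ?E [y, x] [dual Y, X] \<longleftrightarrow>
        a \<in> forms [dual Y, X] \<and> slice2 (\<lambda>p q. a [q, p]) \<in> eq_rel \<X> [X, dual Y]" for a
      using swap[of "eq_rel \<X>"] eq_rel_subspace[of \<X> "[X, dual Y]"] eq_rel_forms[OF \<X>, of "[X, dual Y]"]
      by simp
    have B: "interp ?B [y, x] [dual Y, X] = conj2 Y X ` op_form X ` R Y X"
      using atomic_self[of y x "dual Y" X "conj_rel (hat \<X> R)"] xy Xs T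
      by (simp add: conj_rel_hat[OF \<X> R Y X])
    let ?P = "interp (Conj ?A ?B) [y, x] [dual Y, X]" and ?Q = "interp ?E [y, x] [dual Y, X]"
    have P: "?P = interp ?A [y, x] [dual Y, X] \<inter> interp ?B [y, x] [dual Y, X]" by simp
    have "?P \<subseteq> forms [dual Y, X]" unfolding P using A by blast
    then have "forms [dual Y, X] \<subseteq> interp (Imp (Conj ?A ?B) ?E) [y, x] [dual Y, X] \<longleftrightarrow> ?P \<subseteq> ?Q"
      unfolding interp_Imp[OF Xs(1)] by (intro forms_le_sasaki_iff Xs(2) interp_subspace)
    also have "\<dots> \<longleftrightarrow> (\<forall>s\<in>R Y X. adj (hs Y) (hs X) s \<in> R X Y \<longrightarrow> adj (hs Y) (hs X) s \<in> id_rel \<X> X Y)"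
    proof -
      have sw: "slice2 (\<lambda>p q. conj2 Y X (op_form X s) [q, p]) = op_form Y (adj (hs Y) (hs X) s)"
        and ad: "adj (hs Y) (hs X) s \<in> ops (hs X) (hs Y)"
        and cf: "conj2 Y X (op_form X s) \<in> forms [dual Y, X]" if s: "s \<in> R Y X" for s
      proof -
        have so: "s \<in> ops (hs Y) (hs X)" using s RYX by auto
        show ad: "adj (hs Y) (hs X) s \<in> ops (hs X) (hs Y)" by (rule fd_adj(1)[OF hs_fd[OF fY] hs_prehilbert[OF fX] so])
        show cf: "conj2 Y X (op_form X s) \<in> forms [dual Y, X]" using T(2) s by blast
        show "slice2 (\<lambda>p q. conj2 Y X (op_form X s) [q, p]) = op_form Y (adj (hs Y) (hs X) s)"
          using op_form_adj[OF fX fY so]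
          by (intro forms2_ext[OF swap_in_forms[OF cf] op_form_in_forms[OF fX fY ad]]) simp
      qed
      have memS: "op_form Y r \<in> op_form Y ` R X Y \<longleftrightarrow> r \<in> R X Y" if "r \<in> ops (hs X) (hs Y)" for r
        using op_form_inj[OF fY that] RXY(2) by blast
      have PP: "?P = {a \<in> conj2 Y X ` op_form X ` R Y X. a \<in> forms [dual Y, X] \<and> slice2 (\<lambda>p q. a [q, p]) \<in> op_form Y ` R X Y}"
        unfolding P B using A by blast
      have "?P \<subseteq> ?Q \<longleftrightarrow> (\<forall>s\<in>R Y X. slice2 (\<lambda>p q. conj2 Y X (op_form X s) [q, p]) \<in> op_form Y ` R X Y \<longrightarrow>
           slice2 (\<lambda>p q. conj2 Y X (op_form X s) [q, p]) \<in> eq_rel \<X> [X, dual Y])"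
        unfolding PP subset_iff E using cf by auto
      also have "\<dots> \<longleftrightarrow> (\<forall>s\<in>R Y X. adj (hs Y) (hs X) s \<in> R X Y \<longrightarrow> adj (hs Y) (hs X) s \<in> id_rel \<X> X Y)"
        by (intro ball_cong refl) (simp only: sw memS[OF ad] op_form_eq_rel_iff[OF \<X> X Y ad])
      finally show ?thesis .
    qed
    finally show ?thesis .
  qed
  have "holds (Forall x (Forall y (Imp (Conj ?A ?B) ?E))) \<longleftrightarrow>
      (\<forall>X\<in>\<X>. \<forall>Y\<in>dual_qset \<X>. forms [Y, X] \<subseteq> interp (Imp (Conj ?A ?B) ?E) [y, x] [Y, X])"
    using holds_Forall_Forall_iff[of x y "Imp (Conj ?A ?B) ?E"] qset_fd[OF \<X>] qset_dual_fd[OF \<X>]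
    unfolding x y by blast
  then show ?thesis by (simp add: dual_qset_def key del: interp.simps)
qed

section \<open>Transitivity\<close>

text \<open>The form \<open>r(x\<^sub>1, y\<^sub>2) s(x\<^sub>2, y\<^sub>3) k(y\<^sub>1, x\<^sub>3)\<close>, with the arguments in the order \<open>x\<^sub>3, y\<^sub>3, x\<^sub>2, y\<^sub>2, x\<^sub>1, y\<^sub>1\<close> in which the quantifiers
  of the transitivity axiom extend the context; the numbers are positions in this list.\<close>

definition triple :: "'v::cvector form \<Rightarrow> 'v form \<Rightarrow> 'v form \<Rightarrow> 'v form" where
  "triple r s k = reorder [0, 1, 2, 3, 4, 5 :: nat] [4, 3, 2, 1, 5, 0] (tensor 2 r (tensor 2 s k))"

lemma triple_apply: "triple r s k [a3, b3, a2, b2, a1, b1] = r [a1, b2] * (s [a2, b3] * k [b1, a3])"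
  by (simp add: triple_def reorder_def arrange_def tensor_def)

lemma triple_in_forms:
  assumes "r \<in> forms [X1, Y2]" "s \<in> forms [X2, Y3]" "k \<in> forms [Y1, X3]"
  shows "triple r s k \<in> forms [X3, Y3, X2, Y2, X1, Y1]"
  unfolding triple_def
proof (rule reorder_in_forms)
  have "tensor 2 r (tensor 2 s k) \<in> forms ([X1, Y2] @ [X2, Y3] @ [Y1, X3])"
    using assms by (intro tensor_in_forms) simp_all
  then show "tensor 2 r (tensor 2 s k) \<in> forms (arrange [0, 1, 2, 3, 4, 5 :: nat] [4, 3, 2, 1, 5, 0] [X3, Y3, X2, Y2, X1, Y1])"
    by (simp add: arrange_def)
qed auto

text \<open>What the three quantifiers of the transitivity axiom insert.\<close>

definition loop :: "'v::cvector atom \<Rightarrow> 'v atom \<Rightarrow> 'v atom \<Rightarrow> 'v form" where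
  "loop X3 X2 X1 = tensor 2 (ev X3) (tensor 2 (ev X2) (ev X1))"

lemma loop_apply: "loop X3 X2 X1 [a3, b3, a2, b2, a1, b1] = ev X3 [a3, b3] * (ev X2 [a2, b2] * ev X1 [a1, b1])"
  by (simp add: loop_def tensor_def)

lemma loop_in_forms:
  assumes "fd_atom X1" "fd_atom X2" "fd_atom X3"
  shows "loop X3 X2 X1 \<in> forms [X3, dual X3, X2, dual X2, X1, dual X1]"
  using tensor_in_forms[OF ev_in_forms tensor_in_forms[OF ev_in_forms ev_in_forms], of X3 X2 X1 2 2] assms
  by (simp add: loop_def)

text \<open>Contraction with \<open>\<epsilon>\<^sub>X\<close> transfers an argument from \<open>X\<close> to \<open>X\<^sup>*\<close>, at the price of a complex conjugation.\<close>

lemma riesz_vec_contraction: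
  assumes X: "fd_atom X" and g: "g \<in> carrier (hs (dual X))"
    and add: "\<And>x y. x \<in> carrier (hs X) \<Longrightarrow> y \<in> carrier (hs X) \<Longrightarrow> L (x + y) = L x + L y"
    and scale: "\<And>c x. x \<in> carrier (hs X) \<Longrightarrow> L (c *C x) = c * L x"
  shows "(\<Sum>e\<in>basis X. cnj (L e) * pairing X e g) = cnj (L (riesz_vec X g))"
proof -
  note pX = hs_prehilbert[OF X]
  have L0: "L 0 = 0" using scale[of 0 0] pX by simp
  have Lsum: "L (sum f I) = (\<Sum>i\<in>I. L (f i))" if "\<And>i. i \<in> I \<Longrightarrow> f i \<in> carrier (hs X)" for f :: "'a vec \<Rightarrow> 'a vec" and I
    using that by (induction I rule: infinite_finite_induct) (simp_all add: add L0 carrier_sum pX)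
  have "L (riesz_vec X g) = (\<Sum>e\<in>basis X. cnj (pairing X e g) * L e)"
    unfolding riesz_vec_expansion[OF X onb_basis[OF X] g]
    using basis_carrier[OF X] pX by (subst Lsum) (simp_all add: scale)
  then show ?thesis by (simp add: mult.commute)
qed

lemma sum6_reorder:
  "(\<Sum>a\<in>A. \<Sum>b\<in>B. \<Sum>c\<in>C. \<Sum>d\<in>D. \<Sum>e\<in>E. \<Sum>f\<in>F. T a b c d e f) =
    (\<Sum>e\<in>E. \<Sum>d\<in>D. \<Sum>c\<in>C. \<Sum>b\<in>B. \<Sum>f\<in>F. \<Sum>a\<in>A. T a b c d e f)"
  "(\<Sum>a\<in>A. \<Sum>b\<in>B. \<Sum>c\<in>C. \<Sum>d\<in>D. \<Sum>e\<in>E. \<Sum>f\<in>F. T a b c d e f) =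
    (\<Sum>f\<in>F. \<Sum>a\<in>A. \<Sum>d\<in>D. \<Sum>b\<in>B. \<Sum>c\<in>C. \<Sum>e\<in>E. T a b c d e f)"
  unfolding sum.cartesian_product
  by (rule sum.reindex_bij_witness[of _ "\<lambda>(e, d, c, b, f, a). (a, b, c, d, e, f)" "\<lambda>(a, b, c, d, e, f). (e, d, c, b, f, a)"]; force)
     (rule sum.reindex_bij_witness[of _ "\<lambda>(f, a, d, b, c, e). (a, b, c, d, e, f)" "\<lambda>(a, b, c, d, e, f). (f, a, d, b, c, e)"]; force)

text \<open>Contracting \<open>x\<^sub>1\<close>, \<open>x\<^sub>2\<close> and \<open>y\<^sub>3\<close> with the factors \<open>\<epsilon>\<close> leaves a sum over a basis of \<open>X\<^sub>2\<^sup>*\<close>, in which the argument \<open>y\<^sub>2\<close> of \<open>r\<close> and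
  the argument \<open>x\<^sub>2\<close> of \<open>s\<close> are joined.  This sum composes \<open>r\<close> and \<open>s\<close>.\<close>

lemma form_ip_triple_loop:
  assumes X1: "fd_atom X1" and X2: "fd_atom X2" and X3: "fd_atom X3"
    and r: "r \<in> ops (hs X1) (hs X2)" and s: "s \<in> ops (hs X2) (hs X3)"
  shows "form_ip [X3, dual X3, X2, dual X2, X1, dual X1] (triple (op_form X2 r) (op_form X3 s) k) (loop X3 X2 X1) =
    form_ip [dual X1, X3] k (conj2 X1 X3 (op_form X3 (s \<circ> r)))"
proof -
  let ?r = "op_form X2 r" and ?s = "op_form X3 s"
  note rf = op_form_in_forms[OF X1 X2 r] and sf = op_form_in_forms[OF X2 X3 s]
  have D: "fd_atom (dual X1)" "fd_atom (dual X2)" "fd_atom (dual X3)" using X1 X2 X3 by simp_all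
  note bc = basis_carrier[OF X1] basis_carrier[OF X2] basis_carrier[OF X3]
    basis_carrier[OF D(1)] basis_carrier[OF D(2)] basis_carrier[OF D(3)]
  have "form_ip [X3, dual X3, X2, dual X2, X1, dual X1] (triple ?r ?s k) (loop X3 X2 X1) =
    (\<Sum>e3\<in>basis X3. \<Sum>f3\<in>basis (dual X3). \<Sum>e2\<in>basis X2. \<Sum>f2\<in>basis (dual X2). \<Sum>e1\<in>basis X1. \<Sum>f1\<in>basis (dual X1).
      cnj (?r [e1, f2]) * pairing X1 e1 f1 * (cnj (?s [e2, f3]) * pairing X2 e2 f2 * (pairing X3 e3 f3 * cnj (k [f1, e3]))))"
    unfolding form_ip_bases sum_bases_Cons sum_bases_Nil
    by (intro sum.cong refl) (simp add: triple_apply loop_apply ev_def bc)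
  also have "\<dots> = (\<Sum>f1\<in>basis (dual X1). \<Sum>e3\<in>basis X3. \<Sum>f2\<in>basis (dual X2). \<Sum>f3\<in>basis (dual X3). \<Sum>e2\<in>basis X2. \<Sum>e1\<in>basis X1.
      cnj (?r [e1, f2]) * pairing X1 e1 f1 * (cnj (?s [e2, f3]) * pairing X2 e2 f2 * (pairing X3 e3 f3 * cnj (k [f1, e3]))))"
    by (rule sum6_reorder(2))
  also have "\<dots> = (\<Sum>f1\<in>basis (dual X1). \<Sum>e3\<in>basis X3. \<Sum>f2\<in>basis (dual X2). \<Sum>f3\<in>basis (dual X3). \<Sum>e2\<in>basis X2.
      cnj (?s [e2, f3]) * pairing X2 e2 f2 * (pairing X3 e3 f3 * (cnj (?r [riesz_vec X1 f1, f2]) * cnj (k [f1, e3]))))"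
  proof (intro sum.cong refl)
    fix f1 e3 f2 f3 e2 assume b: "f1 \<in> basis (dual X1)" "f2 \<in> basis (dual X2)"
    have "(\<Sum>e1\<in>basis X1. cnj (?r [e1, f2]) * pairing X1 e1 f1) = cnj (?r [riesz_vec X1 f1, f2])"
      using b bc by (intro riesz_vec_contraction[OF X1]) (simp_all add: forms2D[OF rf])
    then show "(\<Sum>e1\<in>basis X1. cnj (?r [e1, f2]) * pairing X1 e1 f1 * (cnj (?s [e2, f3]) * pairing X2 e2 f2 * (pairing X3 e3 f3 * cnj (k [f1, e3]))))
      = cnj (?s [e2, f3]) * pairing X2 e2 f2 * (pairing X3 e3 f3 * (cnj (?r [riesz_vec X1 f1, f2]) * cnj (k [f1, e3])))"
      unfolding sum_distrib_right[symmetric] by simp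
  qed
  also have "\<dots> = (\<Sum>f1\<in>basis (dual X1). \<Sum>e3\<in>basis X3. \<Sum>f2\<in>basis (dual X2). \<Sum>f3\<in>basis (dual X3).
      cnj (?s [riesz_vec X2 f2, f3]) * pairing X3 e3 f3 * (cnj (?r [riesz_vec X1 f1, f2]) * cnj (k [f1, e3])))"
  proof (intro sum.cong refl)
    fix f1 e3 f2 f3 assume b: "f2 \<in> basis (dual X2)" "f3 \<in> basis (dual X3)"
    have "(\<Sum>e2\<in>basis X2. cnj (?s [e2, f3]) * pairing X2 e2 f2) = cnj (?s [riesz_vec X2 f2, f3])"
      using b bc by (intro riesz_vec_contraction[OF X2]) (simp_all add: forms2D[OF sf])
    then show "(\<Sum>e2\<in>basis X2. cnj (?s [e2, f3]) * pairing X2 e2 f2 * (pairing X3 e3 f3 * (cnj (?r [riesz_vec X1 f1, f2]) * cnj (k [f1, e3]))))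
      = cnj (?s [riesz_vec X2 f2, f3]) * pairing X3 e3 f3 * (cnj (?r [riesz_vec X1 f1, f2]) * cnj (k [f1, e3]))"
      unfolding sum_distrib_right[symmetric] by simp
  qed
  also have "\<dots> = (\<Sum>f1\<in>basis (dual X1). \<Sum>e3\<in>basis X3. \<Sum>f2\<in>basis (dual X2).
      cnj (pairing X3 (s (riesz_vec X2 f2)) (riesz_vec (dual X3) e3)) * (cnj (?r [riesz_vec X1 f1, f2]) * cnj (k [f1, e3])))"
  proof (intro sum.cong refl)
    fix f1 e3 f2 assume b: "e3 \<in> basis X3" "f2 \<in> basis (dual X2)"
    have c: "riesz_vec X2 f2 \<in> carrier (hs X2)" using riesz_vec(1)[OF X2] b bc by blast
    note r3 = riesz_vec_riesz_vec(2)[OF X3 bc(3)[OF b(1)]]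
    have "(\<Sum>f3\<in>basis (dual X3). cnj (?s [riesz_vec X2 f2, f3]) * pairing (dual X3) f3 e3) = cnj (?s [riesz_vec X2 f2, riesz_vec (dual X3) e3])"
      using b bc c by (intro riesz_vec_contraction[OF D(3)]) (simp_all add: forms2D[OF sf])
    then have "(\<Sum>f3\<in>basis (dual X3). cnj (?s [riesz_vec X2 f2, f3]) * pairing X3 e3 f3) = cnj (pairing X3 (s (riesz_vec X2 f2)) (riesz_vec (dual X3) e3))"
      using r3 by (simp add: pairing_dual op_form_apply)
    then show "(\<Sum>f3\<in>basis (dual X3). cnj (?s [riesz_vec X2 f2, f3]) * pairing X3 e3 f3 * (cnj (?r [riesz_vec X1 f1, f2]) * cnj (k [f1, e3])))
      = cnj (pairing X3 (s (riesz_vec X2 f2)) (riesz_vec (dual X3) e3)) * (cnj (?r [riesz_vec X1 f1, f2]) * cnj (k [f1, e3]))"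
      unfolding sum_distrib_right[symmetric] by simp
  qed
  also have "\<dots> = (\<Sum>f1\<in>basis (dual X1). \<Sum>e3\<in>basis X3. cnj (k [f1, e3]) * conj2 X1 X3 (op_form X3 (s \<circ> r)) [f1, e3])"
  proof (intro sum.cong refl)
    fix f1 e3 assume b: "f1 \<in> basis (dual X1)" "e3 \<in> basis X3"
    have c: "riesz_vec X1 f1 \<in> carrier (hs X1)" using riesz_vec(1)[OF X1] b bc by blast
    define z where "z = r (riesz_vec X1 f1)"
    have z: "z \<in> carrier (hs X2)" unfolding z_def using opsD(1)[OF r c] .
    note r3 = riesz_vec_riesz_vec(2)[OF X3 bc(3)[OF b(2)]]
    note p2 = hs_prehilbert[OF X2] and p3 = hs_prehilbert[OF X3]
    have rc: "riesz_vec X2 f \<in> carrier (hs X2)" if "f \<in> basis (dual X2)" for f using riesz_vec(1)[OF X2] bc that by blast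
    have psum: "pairing X3 (sum h I) (riesz_vec (dual X3) e3) = (\<Sum>i\<in>I. pairing X3 (h i) (riesz_vec (dual X3) e3))"
      if "\<And>i. i \<in> I \<Longrightarrow> h i \<in> carrier (hs X3)" for h :: "'a vec \<Rightarrow> 'a vec" and I
      using that p3 by (induction I rule: infinite_finite_induct)
        (simp_all add: pairing_left[OF X3 r3] carrier_sum pairing_zero_left[OF X3 r3])
    have "s z = s (\<Sum>f2\<in>basis (dual X2). pairing X2 z f2 *C riesz_vec X2 f2)"
      using dual_onb_expansion[OF X2 onb_basis[OF D(2)] z] by simp
    also have "\<dots> = (\<Sum>f2\<in>basis (dual X2). pairing X2 z f2 *C s (riesz_vec X2 f2))"
      using rc p2 by (subst ops_sum[OF p2 s]) (simp_all add: opsD(3)[OF s])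
    finally have "pairing X3 (s z) (riesz_vec (dual X3) e3) =
      (\<Sum>f2\<in>basis (dual X2). pairing X2 z f2 * pairing X3 (s (riesz_vec X2 f2)) (riesz_vec (dual X3) e3))"
      using rc p3 opsD(1)[OF s] by (simp add: psum pairing_left(2)[OF X3 r3])
    moreover have "?r [riesz_vec X1 f1, f2] = pairing X2 z f2" if "f2 \<in> basis (dual X2)" for f2
      using bc(5)[OF that] by (simp add: op_form_apply z_def)
    ultimately show "(\<Sum>f2\<in>basis (dual X2). cnj (pairing X3 (s (riesz_vec X2 f2)) (riesz_vec (dual X3) e3)) * (cnj (?r [riesz_vec X1 f1, f2]) * cnj (k [f1, e3])))
      = cnj (k [f1, e3]) * conj2 X1 X3 (op_form X3 (s \<circ> r)) [f1, e3]"
      using bc(3)[OF b(2)] bc(4)[OF b(1)] r3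
      by (simp add: conj2_apply op_form_apply z_def sum_distrib_left mult_ac)
  qed
  also have "\<dots> = form_ip [dual X1, X3] k (conj2 X1 X3 (op_form X3 (s \<circ> r)))"
    by (simp add: form_ip_bases)
  finally show ?thesis .
qed


lemma slice2_scaled: "r \<in> forms [X, Y] \<Longrightarrow> slice2 (\<lambda>x y. r [x, y] * c) = c *C r"
  using slice2_linear(2)[of c "\<lambda>x y. r [x, y]"] forms2_slice2[of r X Y] by (simp add: mult.commute)

lemma form_slice_outer:
  assumes a: "a \<in> forms [X3, Y3, X2, Y2, X1, Y1]"
    and c: "b3 \<in> carrier (hs Y3)" "a2 \<in> carrier (hs X2)" "b2 \<in> carrier (hs Y2)" "a1 \<in> carrier (hs X1)"
  shows "slice2 (\<lambda>p q. a [q, b3, a2, b2, a1, p]) \<in> forms [Y1, X3]"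
proof (rule slice2_in_forms)
  fix p q assume "\<not> (p \<in> carrier (hs Y1) \<and> q \<in> carrier (hs X3))"
  then have "[q, b3, a2, b2, a1, p] \<notin> tuples [X3, Y3, X2, Y2, X1, Y1]" unfolding tuples_simps by blast
  then show "a [q, b3, a2, b2, a1, p] = 0" by (rule formsD(1)[OF a])
next
  fix p q p' assume "p \<in> carrier (hs Y1)" "q \<in> carrier (hs X3)"
  then have t: "[q, b3, a2, b2, a1, p] \<in> tuples [X3, Y3, X2, Y2, X1, Y1]" using c by simp
  show "a [q, b3, a2, b2, a1, k *C p] = k * a [q, b3, a2, b2, a1, p]" if "p \<in> carrier (hs Y1)" for k
    using formsD(3)[OF a t, of 5 p k] that by simp
  show "a [k *C q, b3, a2, b2, a1, p] = k * a [q, b3, a2, b2, a1, p]" if "q \<in> carrier (hs X3)" for k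
    using formsD(3)[OF a t, of 0 q k] that by simp
  show "a [q, b3, a2, b2, a1, p + p'] = a [q, b3, a2, b2, a1, p] + a [q, b3, a2, b2, a1, p']"
    if "p \<in> carrier (hs Y1)" "p' \<in> carrier (hs Y1)" for p'
    using formsD(2)[OF a t, of 5 p p'] that by simp
  show "a [q + q', b3, a2, b2, a1, p] = a [q, b3, a2, b2, a1, p] + a [q', b3, a2, b2, a1, p]"
    if "q \<in> carrier (hs X3)" "q' \<in> carrier (hs X3)" for q'
    using formsD(2)[OF a t, of 0 q q'] that by simp
qed

text \<open>Both directions pair the loop with \<open>r \<otimes> s \<otimes> k\<close>, where \<open>k\<close> is orthogonal to the conjugate of \<open>R\<^sub>1\<^sub>3\<close>.

  If the loop belongs to the implication, then this test vector, which is in \<open>A \<inter> B\<close> and orthogonal to \<open>C\<close>, is orthogonal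
  to it; thus every such \<open>k\<close> is orthogonal to the conjugate form of \<open>s r\<close>, and \<open>s r \<in> R\<^sub>1\<^sub>3\<close>.

  Conversely, let \<open>a\<close> be the orthogonal projection of the loop to \<open>A \<inter> B\<close>.  Pairing \<open>a\<close> with \<open>k\<close> in the arguments \<open>y\<^sub>1, x\<^sub>3\<close> leaves
  an element of \<open>R\<^sub>1\<^sub>2 \<otimes> R\<^sub>2\<^sub>3\<close> that is orthogonal to all \<open>r \<otimes> s\<close>, since \<open>a\<close> and the loop have the same inner product with
  \<open>r \<otimes> s \<otimes> k\<close>, which is \<open>0\<close> because of \<open>s r \<in> R\<^sub>1\<^sub>3\<close>.  It vanishes, which shows \<open>a \<in> C\<close>, and the implication contains both \<open>a\<close> and the remainder of the loop.\<close>

lemma loop_sasaki_iff: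
  assumes X1: "fd_atom X1" and X2: "fd_atom X2" and X3: "fd_atom X3"
    and R12: "cvec.subspace R12" "R12 \<subseteq> ops (hs X1) (hs X2)"
    and R23: "cvec.subspace R23" "R23 \<subseteq> ops (hs X2) (hs X3)"
    and R13: "cvec.subspace R13" "R13 \<subseteq> ops (hs X1) (hs X3)"
  defines "Xs \<equiv> [X3, dual X3, X2, dual X2, X1, dual X1]"
  assumes A: "cvec.subspace A" "\<And>a. a \<in> A \<longleftrightarrow> a \<in> forms Xs \<and>
      (\<forall>a3\<in>carrier (hs X3). \<forall>b3\<in>carrier (hs (dual X3)). \<forall>a2\<in>carrier (hs X2). \<forall>b1\<in>carrier (hs (dual X1)).
        slice2 (\<lambda>p q. a [a3, b3, a2, q, p, b1]) \<in> op_form X2 ` R12)"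
    and B: "cvec.subspace B" "\<And>a. a \<in> B \<longleftrightarrow> a \<in> forms Xs \<and>
      (\<forall>a3\<in>carrier (hs X3). \<forall>b2\<in>carrier (hs (dual X2)). \<forall>a1\<in>carrier (hs X1). \<forall>b1\<in>carrier (hs (dual X1)).
        slice2 (\<lambda>p q. a [a3, q, p, b2, a1, b1]) \<in> op_form X3 ` R23)"
    and C: "\<And>a. a \<in> C \<longleftrightarrow> a \<in> forms Xs \<and>
      (\<forall>b3\<in>carrier (hs (dual X3)). \<forall>a2\<in>carrier (hs X2). \<forall>b2\<in>carrier (hs (dual X2)). \<forall>a1\<in>carrier (hs X1).
        slice2 (\<lambda>p q. a [q, b3, a2, b2, a1, p]) \<in> conj2 X1 X3 ` op_form X3 ` R13)"
  shows "loop X3 X2 X1 \<in> sasaki Xs (A \<inter> B) C \<longleftrightarrow> (\<forall>r\<in>R12. \<forall>s\<in>R23. s \<circ> r \<in> R13)"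
proof -
  let ?C = "conj2 X1 X3 ` op_form X3 ` R13"
  have D: "fd_atom (dual X1)" "fd_atom (dual X2)" "fd_atom (dual X3)" using X1 X2 X3 by simp_all
  have fd: "fd_atoms Xs" "fd_atoms [dual X1, X3]" "fd_atoms [X1, dual X2]" "fd_atoms [X2, dual X3]"
    using X1 X2 X3 D by (simp_all add: Xs_def)
  note bc = basis_carrier[OF X1] basis_carrier[OF X2] basis_carrier[OF X3]
    basis_carrier[OF D(1)] basis_carrier[OF D(2)] basis_carrier[OF D(3)]
  note p = hs_prehilbert[OF X1] hs_prehilbert[OF X2] hs_prehilbert[OF X3]
  note S12 = op_form_image_subspace[OF X1 X2 R12] and S23 = op_form_image_subspace[OF X2 X3 R23]
    and S13 = op_form_image_subspace[OF X1 X3 R13]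
  note SC = conj2_image_subspace[OF X1 X3 S13]
  let ?P = "A \<inter> B"
  have P: "cvec.subspace ?P" "?P \<subseteq> forms Xs" using A B by (auto intro: cvec.subspace_inter)
  have rs: "s \<circ> r \<in> ops (hs X1) (hs X3)" if "r \<in> R12" "s \<in> R23" for r s
    using ops_comp[OF p(1,2,3)] that R12 R23 by blast
  have conj_in: "conj2 X1 X3 (op_form X3 t) \<in> ?C \<longleftrightarrow> t \<in> R13" if t: "t \<in> ops (hs X1) (hs X3)" for t
  proof
    assume "conj2 X1 X3 (op_form X3 t) \<in> ?C"
    then obtain t' where t': "t' \<in> R13" "conj2 X1 X3 (op_form X3 t) = conj2 X1 X3 (op_form X3 t')" by auto
    have to: "t' \<in> ops (hs X1) (hs X3)" using t' R13 by blast
    have "op_form X3 t = op_form X3 t'"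
      by (rule conj2_inj[OF X1 X3 op_form_in_forms[OF X1 X3 t] op_form_in_forms[OF X1 X3 to] t'(2)])
    then show "t \<in> R13" using op_form_inj[OF X3 t to] t'(1) by simp
  qed simp
  have tripleP: "triple (op_form X2 r) (op_form X3 s) k \<in> ?P"
    if r: "r \<in> R12" and s: "s \<in> R23" and k: "k \<in> forms [dual X1, X3]" for r s k
  proof -
    have f: "op_form X2 r \<in> forms [X1, dual X2]" "op_form X3 s \<in> forms [X2, dual X3]" using r s S12 S23 by auto
    have t: "triple (op_form X2 r) (op_form X3 s) k \<in> forms Xs"
      unfolding Xs_def by (rule triple_in_forms[OF f k])
    have "slice2 (\<lambda>p q. triple (op_form X2 r) (op_form X3 s) k [a3, b3, a2, q, p, b1]) \<in> op_form X2 ` R12" for a3 b3 a2 b1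
      unfolding triple_apply slice2_scaled[OF f(1)] using r by (intro cvec.subspace_scale[OF S12(1)]) simp
    moreover have "slice2 (\<lambda>p q. triple (op_form X2 r) (op_form X3 s) k [a3, q, p, b2, a1, b1]) \<in> op_form X3 ` R23" for a3 b2 a1 b1
    proof -
      have "slice2 (\<lambda>p q. triple (op_form X2 r) (op_form X3 s) k [a3, q, p, b2, a1, b1]) =
          slice2 (\<lambda>p q. op_form X3 s [p, q] * (op_form X2 r [a1, b2] * k [b1, a3]))"
        by (simp add: triple_apply mult_ac)
      then show ?thesis
        unfolding slice2_scaled[OF f(2)] using s by (auto intro: cvec.subspace_scale[OF S23(1)])
    qed
    ultimately show ?thesis using t A(2) B(2) by simp
  qed
  show ?thesis
  proof (intro iffI ballI)
    fix r s assume loop: "loop X3 X2 X1 \<in> sasaki Xs ?P C" and r: "r \<in> R12" and s: "s \<in> R23"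
    let ?r = "op_form X2 r" and ?s = "op_form X3 s"
    let ?t = "conj2 X1 X3 (op_form X3 (s \<circ> r))"
    have t: "?t \<in> forms [dual X1, X3]" by (intro conj2_in_forms[OF X1 X3] op_form_in_forms[OF X1 X3] rs r s)
    have "?t \<in> ?C"
    proof (rule mem_subspace_by_orthogonality[OF form_space_fd[OF fd(2)] SC(1)])
      fix k assume "k \<in> carrier (form_space [dual X1, X3])" and "\<And>b. b \<in> ?C \<Longrightarrow> ip (form_space [dual X1, X3]) b k = 0"
      then have k: "k \<in> forms [dual X1, X3]" and ort: "\<And>b. b \<in> ?C \<Longrightarrow> form_ip [dual X1, X3] b k = 0" by simp_all
      have tr: "triple ?r ?s k \<in> ?P" by (rule tripleP[OF r s k])
      have "form_ip Xs c (triple ?r ?s k) = 0" if c: "c \<in> C" for c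
      proof -
        have z: "(\<Sum>f1\<in>basis (dual X1). \<Sum>e3\<in>basis X3. cnj (c [e3, b3, a2, b2, a1, f1]) * k [f1, e3]) = 0"
          if "b3 \<in> basis (dual X3)" "a2 \<in> basis X2" "b2 \<in> basis (dual X2)" "a1 \<in> basis X1" for b3 a2 b2 a1
          using ort[of "slice2 (\<lambda>p q. c [q, b3, a2, b2, a1, p])"] c that bc unfolding C by (simp add: form_ip_bases)
        have "form_ip Xs c (triple ?r ?s k) =
          (\<Sum>e3\<in>basis X3. \<Sum>f3\<in>basis (dual X3). \<Sum>e2\<in>basis X2. \<Sum>f2\<in>basis (dual X2). \<Sum>e1\<in>basis X1. \<Sum>f1\<in>basis (dual X1).
            ?r [e1, f2] * ?s [e2, f3] * (cnj (c [e3, f3, e2, f2, e1, f1]) * k [f1, e3]))"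
          unfolding form_ip_bases Xs_def sum_bases_Cons sum_bases_Nil
          by (intro sum.cong refl) (simp add: triple_apply)
        also have "\<dots> = (\<Sum>e1\<in>basis X1. \<Sum>f2\<in>basis (dual X2). \<Sum>e2\<in>basis X2. \<Sum>f3\<in>basis (dual X3). \<Sum>f1\<in>basis (dual X1). \<Sum>e3\<in>basis X3.
            ?r [e1, f2] * ?s [e2, f3] * (cnj (c [e3, f3, e2, f2, e1, f1]) * k [f1, e3]))"
          by (rule sum6_reorder(1))
        also have "\<dots> = 0"
          unfolding sum_distrib_left[symmetric] by (intro sum.neutral ballI) (simp add: z)
        finally show ?thesis .
      qed
      then have "triple ?r ?s k \<in> perp Xs (?P \<inter> C)" using tr P by (auto simp: perp_def)
      from sasaki_orthogonal[OF loop P(2) tr this] show "ip (form_space [dual X1, X3]) k ?t = 0"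
        unfolding Xs_def form_ip_triple_loop[OF X1 X2 X3 subsetD[OF R12(2) r] subsetD[OF R23(2) s]] by simp
    qed (use SC t in simp_all)
    then show "s \<circ> r \<in> R13" using conj_in[OF rs[OF r s]] by simp
  next
    assume comp: "\<forall>r\<in>R12. \<forall>s\<in>R23. s \<circ> r \<in> R13"
    have loop: "loop X3 X2 X1 \<in> forms Xs" unfolding Xs_def by (rule loop_in_forms[OF X1 X2 X3])
    obtain a where a: "a \<in> ?P" "\<And>b. b \<in> ?P \<Longrightarrow> form_ip Xs b (loop X3 X2 X1 - a) = 0"
      using orthogonal_projection[OF form_space_fd[OF fd(1)] P(1), of "loop X3 X2 X1"] P(2) loop by auto
    have af: "a \<in> forms Xs" using a P by blast
    have "a \<in> C"
      unfolding C
    proof (intro conjI af ballI)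
      fix b3 a2 b2 a1 assume c: "b3 \<in> carrier (hs (dual X3))" "a2 \<in> carrier (hs X2)" "b2 \<in> carrier (hs (dual X2))" "a1 \<in> carrier (hs X1)"
      let ?sl = "slice2 (\<lambda>p q. a [q, b3, a2, b2, a1, p])"
      have sl: "?sl \<in> forms [dual X1, X3]" using form_slice_outer[OF af[unfolded Xs_def] c] .
      show "?sl \<in> ?C"
      proof (rule mem_subspace_by_orthogonality[OF form_space_fd[OF fd(2)] SC(1)])
        fix k assume "k \<in> carrier (form_space [dual X1, X3])" and "\<And>b. b \<in> ?C \<Longrightarrow> ip (form_space [dual X1, X3]) b k = 0"
        then have k: "k \<in> forms [dual X1, X3]" and ort: "\<And>b. b \<in> ?C \<Longrightarrow> form_ip [dual X1, X3] b k = 0" by simp_all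
        \<comment> \<open>\<open>H\<close> is \<open>a\<close> with its slices in the arguments \<open>y\<^sub>1, x\<^sub>3\<close> paired with \<open>k\<close>; it remains an element of \<open>R\<^sub>1\<^sub>2 \<otimes> R\<^sub>2\<^sub>3\<close>.\<close>
        define H where "H p q u v = (\<Sum>f1\<in>basis (dual X1). \<Sum>e3\<in>basis X3. cnj (k [f1, e3]) * a [e3, v, u, q, p, f1])" for p q u v
        have H1: "slice2 (\<lambda>p q. H p q u v) \<in> op_form X2 ` R12" if "u \<in> carrier (hs X2)" "v \<in> carrier (hs (dual X3))" for u v
          unfolding H_def slice2_linear using a(1) A(2) bc that
          by (intro cvec.subspace_sum[OF S12(1)] cvec.subspace_scale[OF S12(1)]) simp
        have H2: "slice2 (\<lambda>u v. H p q u v) \<in> op_form X3 ` R23" if "p \<in> carrier (hs X1)" "q \<in> carrier (hs (dual X2))" for p q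
          unfolding H_def slice2_linear using a(1) B(2) bc that
          by (intro cvec.subspace_sum[OF S23(1)] cvec.subspace_scale[OF S23(1)]) simp
        have H3: "form_ip [X2, dual X3] (op_form X3 s) (slice2 (\<lambda>u v. H p q u v)) = 0"
          if s: "s \<in> R23" and pq: "p \<in> carrier (hs X1)" "q \<in> carrier (hs (dual X2))" for s p q
        proof -
          let ?s = "op_form X3 s"
          \<comment> \<open>\<open>H\<close> paired with \<open>s\<close>: an element of \<open>R\<^sub>1\<^sub>2\<close> that is orthogonal to all of \<open>R\<^sub>1\<^sub>2\<close>\<close>
          define U where "U = slice2 (\<lambda>p q. \<Sum>e2\<in>basis X2. \<Sum>f3\<in>basis (dual X3). cnj (?s [e2, f3]) * H p q e2 f3)"
          have U: "U \<in> op_form X2 ` R12"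
            unfolding U_def slice2_linear using H1 bc
            by (intro cvec.subspace_sum[OF S12(1)] cvec.subspace_scale[OF S12(1)]) simp
          have "form_ip [X1, dual X2] (op_form X2 r) U = 0" if r: "r \<in> R12" for r
          proof -
            let ?r = "op_form X2 r"
            have "form_ip [X1, dual X2] ?r U =
              (\<Sum>e1\<in>basis X1. \<Sum>f2\<in>basis (dual X2). \<Sum>e2\<in>basis X2. \<Sum>f3\<in>basis (dual X3). \<Sum>f1\<in>basis (dual X1). \<Sum>e3\<in>basis X3.
                cnj (?r [e1, f2]) * (cnj (?s [e2, f3]) * (cnj (k [f1, e3]) * a [e3, f3, e2, f2, e1, f1])))"
              by (simp add: form_ip_bases U_def H_def sum_distrib_left)
            also have "\<dots> = (\<Sum>e3\<in>basis X3. \<Sum>f3\<in>basis (dual X3). \<Sum>e2\<in>basis X2. \<Sum>f2\<in>basis (dual X2). \<Sum>e1\<in>basis X1. \<Sum>f1\<in>basis (dual X1).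
                cnj (?r [e1, f2]) * (cnj (?s [e2, f3]) * (cnj (k [f1, e3]) * a [e3, f3, e2, f2, e1, f1])))"
              by (rule sum6_reorder(1)[symmetric])
            also have "\<dots> = form_ip Xs (triple ?r ?s k) a"
              unfolding form_ip_bases Xs_def sum_bases_Cons sum_bases_Nil
              by (intro sum.cong refl) (simp add: triple_apply)
            also have "\<dots> = form_ip Xs (triple ?r ?s k) (loop X3 X2 X1)"
              using a(2)[OF tripleP[OF r s k]] form_ip_linear(2)[of Xs "triple ?r ?s k" "loop X3 X2 X1 - a" a] by simp
            also have "\<dots> = form_ip [dual X1, X3] k (conj2 X1 X3 (op_form X3 (s \<circ> r)))"
              unfolding Xs_def by (rule form_ip_triple_loop[OF X1 X2 X3 subsetD[OF R12(2) r] subsetD[OF R23(2) s]])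
            also have "\<dots> = 0"
              using ort[of "conj2 X1 X3 (op_form X3 (s \<circ> r))"] comp r s
                form_ip_cnj[of "[dual X1, X3]" k "conj2 X1 X3 (op_form X3 (s \<circ> r))"] by simp
            finally show ?thesis .
          qed
          then have "form_ip [X1, dual X2] U U = 0" using U by auto
          then have "U = 0"
            using ip_self_zero[OF form_space_prehilbert[OF fd(3)], of U] U S12(2) by auto
          then have "U [p, q] = 0" by simp
          then show ?thesis by (simp add: U_def form_ip_bases)
        qed
        have "H a1 b2 a2 b3 = 0"
        proof -
          let ?U = "slice2 (\<lambda>u v. H a1 b2 u v)"
          have U: "?U \<in> op_form X3 ` R23" using H2 c by simp
          then obtain s where s: "?U = op_form X3 s" "s \<in> R23" by blast
          have "form_ip [X2, dual X3] ?U ?U = 0" using H3[OF s(2) c(4,3)] unfolding s(1) .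
          then have "?U = 0"
            using ip_self_zero[OF form_space_prehilbert[OF fd(4)], of ?U] U S23(2) by auto
          then have "?U [a2, b3] = 0" by (simp only: zero_fun_apply)
          then show ?thesis by simp
        qed
        then show "ip (form_space [dual X1, X3]) k ?sl = 0" by (simp add: form_ip_bases H_def)
      qed (use SC sl in simp_all)
    qed
    then have 1: "a \<in> sasaki Xs ?P C" using meet_le_sasaki[OF P(2), of C] a(1) by blast
    have "loop X3 X2 X1 - a \<in> perp Xs ?P"
      using a loop af by (auto simp: perp_def intro: cvec.subspace_diff[OF forms_subspace])
    then have 2: "loop X3 X2 X1 - a \<in> sasaki Xs ?P C" using perp_le_sasaki by blast
    show "loop X3 X2 X1 \<in> sasaki Xs ?P C" using cvec.subspace_add[OF sasaki_subspace 1 2] by simp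
  qed
qed

lemma transitivity_iff:
  fixes x1 x2 x3 y1 y2 y3 :: "'v::cvector var"
  assumes \<X>: "quantum_set \<X>" and x: "sort_of x1 = \<X>" "sort_of x2 = \<X>" "sort_of x3 = \<X>"
    and y: "sort_of y1 = dual_qset \<X>" "sort_of y2 = dual_qset \<X>" "sort_of y3 = dual_qset \<X>"
    and dist: "distinct [x1, x2, x3, y1, y2, y3]"
    and R: "binary_relation \<X> \<X> R"
  shows "holds (ForallEq x1 y1 (ForallEq x2 y2 (ForallEq x3 y3
      (Imp (Conj (Rel (hat \<X> R) [x1, y2]) (Rel (hat \<X> R) [x2, y3])) (Rel (conj_rel (hat \<X> R)) [y1, x3]))))) \<longleftrightarrow>
    (\<forall>X\<in>\<X>. \<forall>Y\<in>\<X>. \<forall>Z\<in>\<X>. \<forall>r\<in>R X Y. \<forall>s\<in>R Y Z. s \<circ> r \<in> R X Z)"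
    (is "holds (ForallEq x1 y1 (ForallEq x2 y2 (ForallEq x3 y3 (Imp (Conj ?A ?B) ?C)))) \<longleftrightarrow> _")
proof -
  let ?ctx = "[x3, y3, x2, y2, x1, y1]"
  have ctx: "distinct ?ctx" using dist by auto
  have key: "loop X3 X2 X1 \<in> interp (Imp (Conj ?A ?B) ?C) ?ctx [X3, dual X3, X2, dual X2, X1, dual X1] \<longleftrightarrow>
      (\<forall>r\<in>R X1 X2. \<forall>s\<in>R X2 X3. s \<circ> r \<in> R X1 X3)"
    if X: "X1 \<in> \<X>" "X2 \<in> \<X>" "X3 \<in> \<X>" for X1 X2 X3
  proof -
    let ?Xs = "[X3, dual X3, X2, dual X2, X1, dual X1]"
    have fX: "fd_atom X1" "fd_atom X2" "fd_atom X3" using qset_fd[OF \<X>] X by auto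
    have Xs: "?Xs \<in> listset (map sort_of ?ctx)" "fd_atoms ?Xs"
      using X x y fX by (simp_all add: in_listset_iff del: listset.simps)
    note R12 = binary_relationD(1)[OF R, of X1 X2] binary_relationD(2)[OF R X(1,2)]
    note R23 = binary_relationD(1)[OF R, of X2 X3] binary_relationD(2)[OF R X(2,3)]
    note R13 = binary_relationD(1)[OF R, of X1 X3] binary_relationD(2)[OF R X(1,3)]
    note S12 = op_form_image_subspace[OF fX(1,2) R12] and S23 = op_form_image_subspace[OF fX(2,3) R23]
      and S13 = conj2_image_subspace[OF fX(1,3) op_form_image_subspace[OF fX(1,3) R13]]
    have arr: "arrange ?ctx [x1, y2] ?Xs = [X1, dual X2]" "arrange ?ctx [x2, y3] ?Xs = [X2, dual X3]"
      "arrange ?ctx [y1, x3] ?Xs = [dual X1, X3]"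
      "arrange ?ctx [x3, y3, x2, y1] ?Xs = [X3, dual X3, X2, dual X1]"
      "arrange ?ctx [x3, y2, x1, y1] ?Xs = [X3, dual X2, X1, dual X1]"
      "arrange ?ctx [y3, x2, y2, x1] ?Xs = [dual X3, X2, dual X2, X1]"
      using dist by (auto simp: arrange_def)
    have arr': "arrange [x1, y2, x3, y3, x2, y1] ?ctx [p, q, a3, b3, a2, b1] = [a3, b3, a2, q, p, b1]"
      "arrange [x2, y3, x3, y2, x1, y1] ?ctx [p, q, a3, b2, a1, b1] = [a3, q, p, b2, a1, b1]"
      "arrange [y1, x3, y3, x2, y2, x1] ?ctx [p, q, b3, a2, b2, a1] = [q, b3, a2, b2, a1, p]"
      for p q a3 b3 a2 b2 a1 b1 :: "'v vec"
      using dist by (auto simp: arrange_def)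
    have f: "filter (\<lambda>z. z \<notin> {x1, y2}) ?ctx = [x3, y3, x2, y1]" "filter (\<lambda>z. z \<notin> {x2, y3}) ?ctx = [x3, y2, x1, y1]"
      "filter (\<lambda>z. z \<notin> {y1, x3}) ?ctx = [y3, x2, y2, x1]"
      using dist by auto
    have sub: "x1 \<noteq> y2" "x2 \<noteq> y3" "y1 \<noteq> x3" "{x1, y2} \<subseteq> set ?ctx" "{x2, y3} \<subseteq> set ?ctx" "{y1, x3} \<subseteq> set ?ctx"
      using dist by auto
    note h12 = hat_eq[OF \<X> R X(1,2)] and h23 = hat_eq[OF \<X> R X(2,3)] and h13 = conj_rel_hat[OF \<X> R X(1,3)]
    note A = atomic2_iff_slices[OF ctx sub(1,4) Xs, of "hat \<X> R", unfolded f arr h12, OF S12, unfolded ball_tuples arr']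
    note B = atomic2_iff_slices[OF ctx sub(2,5) Xs, of "hat \<X> R", unfolded f arr h23, OF S23, unfolded ball_tuples arr']
    note C = atomic2_iff_slices[OF ctx sub(3,6) Xs, of "conj_rel (hat \<X> R)", unfolded f arr h13, OF S13, unfolded ball_tuples arr']
    have Conj: "interp (Conj ?A ?B) ?ctx ?Xs = interp ?A ?ctx ?Xs \<inter> interp ?B ?ctx ?Xs" by simp
    show ?thesis
      unfolding interp_Imp[OF Xs(1)] Conj
      by (rule loop_sasaki_iff[OF fX R12 R23 R13])
        (simp_all only: interp_subspace interp.simps(1) atomic_subspace A B C)
  qed
  have ev2: "tensor 2 (ev X2) (ev X1) \<in> forms [X2, dual X2, X1, dual X1]" "ev X1 \<in> forms [X1, dual X1]"
    if "X1 \<in> \<X>" "X2 \<in> \<X>" for X1 X2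
    using tensor_in_forms[OF ev_in_forms ev_in_forms, of X2 X1 2] ev_in_forms[of X1] qset_fd[OF \<X>] that by simp_all
  have "holds (ForallEq x1 y1 (ForallEq x2 y2 (ForallEq x3 y3 (Imp (Conj ?A ?B) ?C)))) \<longleftrightarrow>
    (\<forall>X1\<in>\<X>. ev X1 \<in> interp (ForallEq x2 y2 (ForallEq x3 y3 (Imp (Conj ?A ?B) ?C))) [x1, y1] [X1, dual X1])"
    by (rule holds_ForallEq_iff[OF \<X> x(1) y(1)]) (use dist in auto)
  also have "\<dots> \<longleftrightarrow> (\<forall>X1\<in>\<X>. \<forall>X2\<in>\<X>. tensor 2 (ev X2) (ev X1) \<in>
      interp (ForallEq x3 y3 (Imp (Conj ?A ?B) ?C)) [x2, y2, x1, y1] [X2, dual X2, X1, dual X1])"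
  proof (intro ball_cong refl)
    fix X1 assume X1: "X1 \<in> \<X>"
    have "[X1, dual X1] \<in> listset (map sort_of [x1, y1])" "fd_atoms [X1, dual X1]" "distinct [x2, y2, x1, y1]"
      using X1 x y dist qset_fd[OF \<X>] by (auto simp: in_listset_iff simp del: listset.simps)
    from mem_ForallEq_iff[OF \<X> x(2) y(2) this(3,1,2)] ev2(2)[OF X1 X1]
    show "ev X1 \<in> interp (ForallEq x2 y2 (ForallEq x3 y3 (Imp (Conj ?A ?B) ?C))) [x1, y1] [X1, dual X1] \<longleftrightarrow>
      (\<forall>X2\<in>\<X>. tensor 2 (ev X2) (ev X1) \<in>
      interp (ForallEq x3 y3 (Imp (Conj ?A ?B) ?C)) [x2, y2, x1, y1] [X2, dual X2, X1, dual X1])"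
      by blast
  qed
  also have "\<dots> \<longleftrightarrow> (\<forall>X1\<in>\<X>. \<forall>X2\<in>\<X>. \<forall>X3\<in>\<X>. loop X3 X2 X1 \<in>
      interp (Imp (Conj ?A ?B) ?C) ?ctx [X3, dual X3, X2, dual X2, X1, dual X1])"
  proof (intro ball_cong refl)
    fix X1 X2 assume X1: "X1 \<in> \<X>" "X2 \<in> \<X>"
    have "[X2, dual X2, X1, dual X1] \<in> listset (map sort_of [x2, y2, x1, y1])" "fd_atoms [X2, dual X2, X1, dual X1]"
      "distinct [x3, y3, x2, y2, x1, y1]"
      using X1 x y dist qset_fd[OF \<X>] by (auto simp: in_listset_iff simp del: listset.simps)
    from mem_ForallEq_iff[OF \<X> x(3) y(3) this(3,1,2)] ev2(1)[OF X1]
    show "tensor 2 (ev X2) (ev X1) \<in>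
      interp (ForallEq x3 y3 (Imp (Conj ?A ?B) ?C)) [x2, y2, x1, y1] [X2, dual X2, X1, dual X1] \<longleftrightarrow>
      (\<forall>X3\<in>\<X>. loop X3 X2 X1 \<in> interp (Imp (Conj ?A ?B) ?C) ?ctx [X3, dual X3, X2, dual X2, X1, dual X1])"
      unfolding loop_def by blast
  qed
  also have "\<dots> \<longleftrightarrow> (\<forall>X\<in>\<X>. \<forall>Y\<in>\<X>. \<forall>Z\<in>\<X>. \<forall>r\<in>R X Y. \<forall>s\<in>R Y Z. s \<circ> r \<in> R X Z)"
    using key by simp
  finally show ?thesis .
qed


section \<open>The l2-direct sum\<close>

locale qset =
  fixes \<X> :: "'v::cvector qset"
  assumes qset: "quantum_set \<X>"
begin

abbreviation H :: "('v atom \<Rightarrow> 'v vec) hspace" where "H \<equiv> l2sum \<X>"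

lemma fd: "X \<in> \<X> \<Longrightarrow> fd_atom X"
  by (rule qset_fd[OF qset])

lemma ph: "X \<in> \<X> \<Longrightarrow> prehilbert (hs X)"
  by (intro hs_prehilbert fd)

lemma mem_H: "\<psi> \<in> carrier H \<longleftrightarrow> (\<forall>X\<in>\<X>. \<psi> X \<in> carrier (hs X)) \<and> (\<forall>X. X \<notin> \<X> \<longrightarrow> \<psi> X = 0) \<and>
    (\<lambda>X. (hnorm (hs X) (\<psi> X))\<^sup>2) summable_on \<X>"
  by (simp add: l2sum_def)

lemma H_D:
  assumes "\<psi> \<in> carrier H"
  shows "X \<in> \<X> \<Longrightarrow> \<psi> X \<in> carrier (hs X)" "X \<notin> \<X> \<Longrightarrow> \<psi> X = 0" "(\<lambda>X. (hnorm (hs X) (\<psi> X))\<^sup>2) summable_on \<X>"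
  using assms by (simp_all add: mem_H)

lemma ip_H: "ip H \<phi> \<psi> = (\<Sum>\<^sub>\<infinity>X\<in>\<X>. ip (hs X) (\<phi> X) (\<psi> X))"
  by (simp add: l2sum_def)

lemma ip_summable:
  assumes "\<phi> \<in> carrier H" "\<psi> \<in> carrier H"
  shows "(\<lambda>X. ip (hs X) (\<phi> X) (\<psi> X)) summable_on \<X>"
proof (rule abs_summable_summable)
  show "(\<lambda>X. norm (ip (hs X) (\<phi> X) (\<psi> X))) summable_on \<X>"
  proof (rule summable_on_comparison_test)
    show "(\<lambda>X. (hnorm (hs X) (\<phi> X))\<^sup>2 + (hnorm (hs X) (\<psi> X))\<^sup>2) summable_on \<X>"
      using assms by (intro summable_on_add H_D)
    fix X assume X: "X \<in> \<X>"
    let ?a = "hnorm (hs X) (\<phi> X)" and ?b = "hnorm (hs X) (\<psi> X)"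
    have "norm (ip (hs X) (\<phi> X) (\<psi> X)) \<le> ?a * ?b"
      using X assms by (intro Cauchy_Schwarz ph H_D)
    also have "\<dots> \<le> ?a\<^sup>2 + ?b\<^sup>2"
    proof -
      have "0 \<le> ?a * ?b" using X assms by (intro mult_nonneg_nonneg hnorm_nonneg ph H_D)
      then show ?thesis using sum_squares_bound[of ?a ?b] by linarith
    qed
    finally show "norm (ip (hs X) (\<phi> X) (\<psi> X)) \<le> ?a\<^sup>2 + ?b\<^sup>2" .
  qed simp
qed

lemma H_add: "\<phi> \<in> carrier H \<Longrightarrow> \<psi> \<in> carrier H \<Longrightarrow> \<phi> + \<psi> \<in> carrier H"
proof -
  assume a: "\<phi> \<in> carrier H" "\<psi> \<in> carrier H"
  have "(\<lambda>X. (hnorm (hs X) ((\<phi> + \<psi>) X))\<^sup>2) summable_on \<X>"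
  proof (rule summable_on_comparison_test)
    show "(\<lambda>X. 2 * (hnorm (hs X) (\<phi> X))\<^sup>2 + 2 * (hnorm (hs X) (\<psi> X))\<^sup>2) summable_on \<X>"
      using a by (intro summable_on_add summable_on_cmult_right H_D)
    fix X assume X: "X \<in> \<X>"
    let ?a = "hnorm (hs X) (\<phi> X)" and ?b = "hnorm (hs X) (\<psi> X)"
    have "hnorm (hs X) ((\<phi> + \<psi>) X) \<le> ?a + ?b"
      using X a by (simp add: hnorm_triangle ph H_D)
    then have "(hnorm (hs X) ((\<phi> + \<psi>) X))\<^sup>2 \<le> (?a + ?b)\<^sup>2"
      using X a by (intro power_mono) (simp_all add: ph H_D)
    also have "\<dots> \<le> 2 * ?a\<^sup>2 + 2 * ?b\<^sup>2" using sum_squares_bound[of ?a ?b] by (simp add: power2_sum)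
    finally show "(hnorm (hs X) ((\<phi> + \<psi>) X))\<^sup>2 \<le> 2 * ?a\<^sup>2 + 2 * ?b\<^sup>2" .
  qed simp
  then show ?thesis using a by (simp add: mem_H ph)
qed

lemma H_scale: "\<psi> \<in> carrier H \<Longrightarrow> c *C \<psi> \<in> carrier H"
proof -
  assume a: "\<psi> \<in> carrier H"
  have "(\<lambda>X. (cmod c)\<^sup>2 * (hnorm (hs X) (\<psi> X))\<^sup>2) summable_on \<X>"
    by (intro summable_on_cmult_right H_D a)
  then have "(\<lambda>X. (hnorm (hs X) ((c *C \<psi>) X))\<^sup>2) summable_on \<X>"
    by (rule summable_on_cong[THEN iffD1, rotated])
      (use a in \<open>simp add: scaleC_fun_def hnorm_scale ph H_D power_mult_distrib\<close>)
  then show ?thesis using a by (simp add: mem_H ph scaleC_fun_def)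
qed

lemma norm_sq: "\<psi> \<in> carrier H \<Longrightarrow> ip H \<psi> \<psi> = complex_of_real (\<Sum>\<^sub>\<infinity>X\<in>\<X>. (hnorm (hs X) (\<psi> X))\<^sup>2)"
proof -
  assume a: "\<psi> \<in> carrier H"
  have "ip H \<psi> \<psi> = (\<Sum>\<^sub>\<infinity>X\<in>\<X>. complex_of_real ((hnorm (hs X) (\<psi> X))\<^sup>2))"
    unfolding ip_H using a by (intro infsum_cong) (simp add: ip_self ph H_D)
  also have "\<dots> = complex_of_real (\<Sum>\<^sub>\<infinity>X\<in>\<X>. (hnorm (hs X) (\<psi> X))\<^sup>2)"
    using infsum_comm_additive[of complex_of_real "\<lambda>X. (hnorm (hs X) (\<psi> X))\<^sup>2" \<X>] H_D(3)[OF a]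
    by (simp add: Modules.additive_def o_def)
  finally show ?thesis .
qed

lemma prehilbert_H: "prehilbert H"
  unfolding prehilbert_def
proof (intro conjI ballI allI impI)
  show "cvec.subspace (carrier H)"
  proof (rule cvec.subspaceI)
    show "0 \<in> carrier H" by (simp add: mem_H ph summable_on_0)
  qed (auto intro: H_add H_scale)
  fix \<phi> \<psi> assume a: "\<phi> \<in> carrier H" "\<psi> \<in> carrier H"
  show "ip H \<psi> \<phi> = cnj (ip H \<phi> \<psi>)"
    unfolding ip_H infsum_cnj[symmetric] using a by (intro infsum_cong ip_cnj) (simp_all add: ph H_D)
  show "ip H \<phi> (c *C \<psi>) = c * ip H \<phi> \<psi>" for c
    unfolding ip_H infsum_cmult_right'[symmetric] using a
    by (intro infsum_cong) (simp add: scaleC_fun_def ip_scale_right ph H_D)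
  fix \<eta> assume b: "\<eta> \<in> carrier H"
  show "ip H \<phi> (\<psi> + \<eta>) = ip H \<phi> \<psi> + ip H \<phi> \<eta>"
    unfolding ip_H using a b
    by (subst infsum_add[symmetric]) (auto simp: ip_add_right ph H_D ip_summable intro!: infsum_cong)
next
  fix \<psi> assume a: "\<psi> \<in> carrier H" and nz: "\<psi> \<noteq> 0"
  then obtain X where "\<psi> X \<noteq> 0" by (auto simp: fun_eq_iff)
  then have X: "X \<in> \<X>" using H_D(2)[OF a] by blast
  have "0 < (hnorm (hs X) (\<psi> X))\<^sup>2" using \<open>\<psi> X \<noteq> 0\<close> X a by (simp add: hnorm_eq_zero ph H_D)
  also have "\<dots> = (\<Sum>Y\<in>{X}. (hnorm (hs Y) (\<psi> Y))\<^sup>2)" by simp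
  also have "\<dots> \<le> (\<Sum>\<^sub>\<infinity>X\<in>\<X>. (hnorm (hs X) (\<psi> X))\<^sup>2)"
    using X a by (intro finite_sum_le_infsum H_D) auto
  finally show "0 < Re (ip H \<psi> \<psi>)" by (simp add: norm_sq[OF a])
qed

lemma hnorm_H_sq: "\<psi> \<in> carrier H \<Longrightarrow> (hnorm H \<psi>)\<^sup>2 = (\<Sum>\<^sub>\<infinity>X\<in>\<X>. (hnorm (hs X) (\<psi> X))\<^sup>2)"
  using norm_sq[of \<psi>] ip_self[OF prehilbert_H, of \<psi>] by (simp only: of_real_eq_iff)

subsection \<open>Inclusions and blocks\<close>

lemma inc_same [simp]: "x \<in> carrier (hs X) \<Longrightarrow> inc X x X = x"
  by (simp add: inc_def id_op_def)

lemma inc_other [simp]: "Y \<noteq> X \<Longrightarrow> inc X x Y = 0"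
  by (simp add: inc_def)

lemma inc_outside: "x \<notin> carrier (hs X) \<Longrightarrow> inc X x = 0"
  by (auto simp: inc_def id_op_def)

lemma inc_in_H: "X \<in> \<X> \<Longrightarrow> inc X x \<in> carrier H"
proof -
  assume X: "X \<in> \<X>"
  have "(\<lambda>Y. (hnorm (hs Y) (inc X x Y))\<^sup>2) summable_on \<X> \<longleftrightarrow> (\<lambda>Y. (hnorm (hs Y) (inc X x Y))\<^sup>2) summable_on {X}"
    using X by (intro summable_on_cong_neutral) (auto simp: ph)
  then have "(\<lambda>Y. (hnorm (hs Y) (inc X x Y))\<^sup>2) summable_on \<X>" by simp
  then show ?thesis using X by (auto simp: mem_H inc_def id_op_def ph)
qed

lemma ip_inc:
  assumes "X \<in> \<X>" "x \<in> carrier (hs X)" "\<psi> \<in> carrier H"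
  shows "ip H (inc X x) \<psi> = ip (hs X) x (\<psi> X)"
proof -
  have "ip H (inc X x) \<psi> = (\<Sum>\<^sub>\<infinity>Y\<in>{X}. ip (hs Y) (inc X x Y) (\<psi> Y))"
    unfolding ip_H using assms by (intro infsum_cong_neutral) (auto simp: ph H_D)
  then show ?thesis using assms by simp
qed

lemma inc_in_ops: "X \<in> \<X> \<Longrightarrow> inc X \<in> ops (hs X) H"
  by (intro fd_opsI hs_fd fd prehilbert_H inc_in_H)
    (auto simp: inc_def id_op_def fun_eq_iff scaleC_fun_def ph)

lemma adj_inc:
  assumes X: "X \<in> \<X>" and \<psi>: "\<psi> \<in> carrier H"
  shows "adj (hs X) H (inc X) \<psi> = \<psi> X"
proof -
  note A = fd_adj[OF hs_fd[OF fd[OF X]] prehilbert_H inc_in_ops[OF X]]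
  show ?thesis
    using A(2)[OF _ \<psi>] ip_inc[OF X _ \<psi>] opsD(1)[OF A(1) \<psi>] H_D(1)[OF \<psi> X]
    by (intro ip_nondegenerate[OF ph[OF X]]) simp_all
qed

text \<open>The operator \<open>inc\<^sub>Y\<^sup>\<dagger> v inc\<^sub>X\<close>.\<close>

definition block :: "(('v atom \<Rightarrow> 'v vec) \<Rightarrow> ('v atom \<Rightarrow> 'v vec)) \<Rightarrow> 'v atom \<Rightarrow> 'v atom \<Rightarrow> 'v vec \<Rightarrow> 'v vec" where
  "block v X Y x = v (inc X x) Y"

lemma rel_of_block:
  assumes "V \<subseteq> ops H H" "X \<in> \<X>" "Y \<in> \<X>"
  shows "rel_of \<X> V X Y = (\<lambda>v. block v X Y) ` V"
proof -
  have "adj (hs Y) H (inc Y) \<circ> v \<circ> inc X = block v X Y" if "v \<in> V" for v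
    using adj_inc[OF assms(3)] opsD(1)[of v H H] inc_in_H[OF assms(2)] that assms(1)
    by (auto simp: block_def fun_eq_iff)
  then have "(\<lambda>v. adj (hs Y) H (inc Y) \<circ> v \<circ> inc X) ` V = (\<lambda>v. block v X Y) ` V"
    by (intro image_cong refl)
  then show ?thesis using assms(2,3) by (simp add: rel_of_def Setcompr_eq_image)
qed

lemma block_in_ops:
  assumes v: "v \<in> ops H H" and X: "X \<in> \<X>" and Y: "Y \<in> \<X>"
  shows "block v X Y \<in> ops (hs X) (hs Y)"
proof (rule fd_opsI[OF hs_fd[OF fd[OF X]] ph[OF Y]])
  note i = inc_in_ops[OF X]
  show "block v X Y x \<in> carrier (hs Y)" for x
    unfolding block_def using H_D(1)[OF opsD(1)[OF v inc_in_H[OF X]] Y] .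
  show "block v X Y (x + y) = block v X Y x + block v X Y y" if "x \<in> carrier (hs X)" "y \<in> carrier (hs X)" for x y
    using that by (simp add: block_def opsD(2)[OF i] opsD(2)[OF v] inc_in_H X)
  show "block v X Y (c *C x) = c *C block v X Y x" if "x \<in> carrier (hs X)" for c x
    using that by (simp add: block_def opsD(3)[OF i] opsD(3)[OF v] inc_in_H X) (simp add: scaleC_fun_def)
  show "block v X Y x = 0" if "x \<notin> carrier (hs X)" for x
    using that by (simp add: block_def inc_outside ops_zero[OF prehilbert_H v])
qed

subsection \<open>Truncation to finitely many atoms\<close>

definition trunc :: "'v atom set \<Rightarrow> ('v atom \<Rightarrow> 'v vec) \<Rightarrow> ('v atom \<Rightarrow> 'v vec)" where
  "trunc F \<psi> = (\<Sum>X\<in>F. inc X (\<psi> X))"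

lemma trunc_in_H: "F \<subseteq> \<X> \<Longrightarrow> trunc F \<psi> \<in> carrier H"
  unfolding trunc_def by (intro carrier_sum prehilbert_H inc_in_H) auto

lemma trunc_apply:
  assumes "finite F" "F \<subseteq> \<X>" "\<psi> \<in> carrier H"
  shows "trunc F \<psi> Y = (if Y \<in> F then \<psi> Y else 0)"
proof -
  have "trunc F \<psi> Y = (\<Sum>X\<in>F. if X = Y then \<psi> Y else 0)"
    unfolding trunc_def sum_fun_apply using assms H_D(1)[OF assms(3)]
    by (intro sum.cong) (auto simp: subset_iff)
  then show ?thesis using assms(1) by simp
qed

lemma ip_trunc:
  assumes "finite F" "F \<subseteq> \<X>" "\<phi> \<in> carrier H" "\<psi> \<in> carrier H"
  shows "ip H (trunc F \<phi>) \<psi> = (\<Sum>X\<in>F. ip (hs X) (\<phi> X) (\<psi> X))"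
  unfolding trunc_def using assms
  by (subst ip_sum_left) (auto simp: prehilbert_H inc_in_H ip_inc H_D subset_iff intro!: sum.cong)

lemma hnorm_trunc_sq:
  assumes "finite F" "F \<subseteq> \<X>" "\<psi> \<in> carrier H"
  shows "(hnorm H (trunc F \<psi>))\<^sup>2 = (\<Sum>X\<in>F. (hnorm (hs X) (\<psi> X))\<^sup>2)"
proof -
  have "complex_of_real ((hnorm H (trunc F \<psi>))\<^sup>2) = ip H (trunc F \<psi>) (trunc F \<psi>)"
    using assms by (simp add: ip_self prehilbert_H trunc_in_H)
  also have "\<dots> = (\<Sum>X\<in>F. ip (hs X) (\<psi> X) (\<psi> X))"
    using assms by (simp add: ip_trunc trunc_in_H trunc_apply)
  also have "\<dots> = complex_of_real (\<Sum>X\<in>F. (hnorm (hs X) (\<psi> X))\<^sup>2)"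
    unfolding of_real_sum using assms by (intro sum.cong) (auto simp: ip_self ph H_D subset_iff)
  finally show ?thesis by (simp only: of_real_eq_iff)
qed

lemma hnorm_trunc_le:
  assumes "finite F" "F \<subseteq> \<X>" "\<psi> \<in> carrier H"
  shows "hnorm H (trunc F \<psi>) \<le> hnorm H \<psi>"
proof (rule power2_le_imp_le)
  show "(hnorm H (trunc F \<psi>))\<^sup>2 \<le> (hnorm H \<psi>)\<^sup>2"
    unfolding hnorm_trunc_sq[OF assms] hnorm_H_sq[OF assms(3)]
    using assms by (intro finite_sum_le_infsum H_D) auto
qed (simp add: prehilbert_H assms)

text \<open>By Pythagoras, \<open>\<parallel>\<psi> - trunc F \<psi>\<parallel>\<^sup>2\<close> is the tail of the convergent sum \<open>\<parallel>\<psi>\<parallel>\<^sup>2\<close>.\<close>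

lemma trunc_tendsto:
  assumes \<psi>: "\<psi> \<in> carrier H"
  shows "((\<lambda>F. hnorm H (trunc F \<psi> - \<psi>)) \<longlongrightarrow> 0) (finite_subsets_at_top \<X>)"
proof -
  let ?f = "\<lambda>X. (hnorm (hs X) (\<psi> X))\<^sup>2"
  have eq: "(hnorm H (trunc F \<psi> - \<psi>))\<^sup>2 = infsum ?f \<X> - sum ?f F" if F: "finite F" "F \<subseteq> \<X>" for F
  proof -
    have d: "\<psi> - trunc F \<psi> \<in> carrier H" by (intro carrier_diff prehilbert_H \<psi> trunc_in_H F)
    have t: "trunc F \<psi> \<in> carrier H" by (rule trunc_in_H[OF F(2)])
    have o1: "ip H (trunc F \<psi>) (\<psi> - trunc F \<psi>) = 0"
      using d by (simp add: ip_trunc[OF F \<psi>] trunc_apply[OF F \<psi>] F ph subset_iff H_D[OF \<psi>])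
        (intro sum.neutral, use F H_D(1)[OF \<psi>] ph in auto)
    have "ip H \<psi> \<psi> - ip H (trunc F \<psi>) (trunc F \<psi>) = ip H (trunc F \<psi> - \<psi>) (trunc F \<psi> - \<psi>)"
      using o1 ip_cnj[OF prehilbert_H t \<psi>] ip_cnj[OF prehilbert_H t t]
      by (simp add: ip_diff_left ip_diff_right prehilbert_H t \<psi>)
    then have "complex_of_real ((hnorm H (trunc F \<psi> - \<psi>))\<^sup>2) = complex_of_real ((hnorm H \<psi>)\<^sup>2 - (hnorm H (trunc F \<psi>))\<^sup>2)"
      using t \<psi> by (simp add: ip_self prehilbert_H)
    then show ?thesis
      unfolding of_real_eq_iff hnorm_trunc_sq[OF F \<psi>] hnorm_H_sq[OF \<psi>] .
  qed
  have "((\<lambda>F. infsum ?f \<X> - sum ?f F) \<longlongrightarrow> infsum ?f \<X> - infsum ?f \<X>) (finite_subsets_at_top \<X>)"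
    by (intro tendsto_diff tendsto_const infsum_tendsto H_D(3)[OF \<psi>])
  then have "((\<lambda>F. sqrt (infsum ?f \<X> - sum ?f F)) \<longlongrightarrow> 0) (finite_subsets_at_top \<X>)"
    using tendsto_real_sqrt by fastforce
  moreover have "\<forall>\<^sub>F F in finite_subsets_at_top \<X>. sqrt (infsum ?f \<X> - sum ?f F) = hnorm H (trunc F \<psi> - \<psi>)"
    by (rule eventually_finite_subsets_at_top_weakI)
      (simp add: eq[symmetric] prehilbert_H \<psi> trunc_in_H)
  ultimately show ?thesis by (rule Lim_transform_eventually)
qed

lemma ip_trunc_trunc_tendsto:
  assumes v: "v \<in> ops H H" and \<phi>: "\<phi> \<in> carrier H" and \<psi>: "\<psi> \<in> carrier H"
  shows "((\<lambda>F. ip H (trunc F \<phi>) (v (trunc F \<psi>))) \<longlongrightarrow> ip H \<phi> (v \<psi>)) (finite_subsets_at_top \<X>)" (is ?A)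
    and "((\<lambda>F. ip H \<phi> (v (trunc F \<psi>))) \<longlongrightarrow> ip H \<phi> (v \<psi>)) (finite_subsets_at_top \<X>)" (is ?B)
proof -
  obtain C where C: "C \<ge> 0" "\<And>x. x \<in> carrier H \<Longrightarrow> hnorm H (v x) \<le> C * hnorm H x"
    using ops_bound[OF v prehilbert_H] by blast
  note p = prehilbert_H
  have vc: "v x \<in> carrier H" if "x \<in> carrier H" for x using opsD(1)[OF v that] .
  have B: "cmod (ip H \<phi> (v (trunc F \<psi>)) - ip H \<phi> (v \<psi>)) \<le> hnorm H \<phi> * C * hnorm H (trunc F \<psi> - \<psi>)"
    if F: "finite F" "F \<subseteq> \<X>" for F
  proof -
    have t: "trunc F \<psi> \<in> carrier H" by (rule trunc_in_H[OF F(2)])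
    have "ip H \<phi> (v (trunc F \<psi>)) - ip H \<phi> (v \<psi>) = ip H \<phi> (v (trunc F \<psi> - \<psi>))"
      by (simp add: ops_diff[OF p v] ip_diff_right p \<phi> \<psi> t vc)
    also have "cmod \<dots> \<le> hnorm H \<phi> * hnorm H (v (trunc F \<psi> - \<psi>))"
      by (intro Cauchy_Schwarz p \<phi> vc carrier_diff t \<psi>)
    also have "\<dots> \<le> hnorm H \<phi> * (C * hnorm H (trunc F \<psi> - \<psi>))"
      by (intro mult_left_mono C carrier_diff p t \<psi> hnorm_nonneg \<phi>)
    finally show ?thesis by (simp add: mult.assoc)
  qed
  have lim0: "((\<lambda>F. c * hnorm H (trunc F \<eta> - \<eta>)) \<longlongrightarrow> 0) (finite_subsets_at_top \<X>)" if "\<eta> \<in> carrier H" for c \<eta>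
    using tendsto_mult_right_zero[OF trunc_tendsto[OF that]] .
  show ?B
    by (rule Lim_null[THEN iffD2], rule Lim_null_comparison[OF _ lim0[OF \<psi>, of "hnorm H \<phi> * C"]])
      (intro eventually_finite_subsets_at_top_weakI, use B in simp)
  have A: "cmod (ip H (trunc F \<phi>) (v (trunc F \<psi>)) - ip H \<phi> (v (trunc F \<psi>))) \<le> C * hnorm H \<psi> * hnorm H (trunc F \<phi> - \<phi>)"
    if F: "finite F" "F \<subseteq> \<X>" for F
  proof -
    have t: "trunc F \<psi> \<in> carrier H" "trunc F \<phi> \<in> carrier H" by (rule trunc_in_H[OF F(2)])+
    have "ip H (trunc F \<phi>) (v (trunc F \<psi>)) - ip H \<phi> (v (trunc F \<psi>)) = ip H (trunc F \<phi> - \<phi>) (v (trunc F \<psi>))"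
      by (simp add: ip_diff_left p \<phi> \<psi> t vc)
    also have "cmod \<dots> \<le> hnorm H (trunc F \<phi> - \<phi>) * hnorm H (v (trunc F \<psi>))"
      by (intro Cauchy_Schwarz p \<phi> vc carrier_diff t \<psi>)
    also have "\<dots> \<le> hnorm H (trunc F \<phi> - \<phi>) * (C * hnorm H \<psi>)"
    proof (intro mult_left_mono hnorm_nonneg p carrier_diff t \<phi>)
      have "hnorm H (v (trunc F \<psi>)) \<le> C * hnorm H (trunc F \<psi>)" by (rule C(2)[OF t(1)])
      also have "\<dots> \<le> C * hnorm H \<psi>" by (intro mult_left_mono hnorm_trunc_le F \<psi> C(1))
      finally show "hnorm H (v (trunc F \<psi>)) \<le> C * hnorm H \<psi>" .
    qed
    finally show ?thesis by (simp add: mult_ac)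
  qed
  have "((\<lambda>F. ip H (trunc F \<phi>) (v (trunc F \<psi>)) - ip H \<phi> (v (trunc F \<psi>))) \<longlongrightarrow> 0) (finite_subsets_at_top \<X>)"
    by (rule Lim_null_comparison[OF _ lim0[OF \<phi>, of "C * hnorm H \<psi>"]])
      (intro eventually_finite_subsets_at_top_weakI, use A in simp)
  from tendsto_add[OF this \<open>?B\<close>] show ?A by simp
qed

lemma block_sum_trunc:
  assumes v: "v \<in> ops H H" and F: "finite F" "F \<subseteq> \<X>" and \<psi>: "\<psi> \<in> carrier H" 
  shows "v (trunc F \<psi>) Y = (\<Sum>X\<in>F. block v X Y (\<psi> X))"
  unfolding trunc_def using F
  by (subst ops_sum[OF prehilbert_H v]) (auto simp: inc_in_H sum_fun_apply block_def)

text \<open>The blocks determine \<open>v\<close> on truncated vectors, and \<open>v \<psi>\<close> is the weak limit of the values at the truncations of \<open>\<psi>\<close>.\<close>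

lemma ops_eq_by_blocks:
  assumes v: "v \<in> ops H H" and w: "w \<in> ops H H"
    and eq: "\<And>X Y. X \<in> \<X> \<Longrightarrow> Y \<in> \<X> \<Longrightarrow> block v X Y = block w X Y"
  shows "v = w"
proof (rule ops_eqI[OF v w])
  fix \<psi> assume \<psi>: "\<psi> \<in> carrier H"
  show "v \<psi> = w \<psi>"
  proof
    fix Y show "v \<psi> Y = w \<psi> Y"
    proof (cases "Y \<in> \<X>")
      case True
      show ?thesis
      proof (rule ip_nondegenerate[OF ph[OF True]])
        fix y assume y: "y \<in> carrier (hs Y)"
        note i = inc_in_H[OF True, of y]
        have ev: "\<forall>\<^sub>F F in finite_subsets_at_top \<X>. ip H (inc Y y) (v (trunc F \<psi>)) = ip H (inc Y y) (w (trunc F \<psi>))"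
        proof (rule eventually_finite_subsets_at_top_weakI)
          fix F assume F: "finite F" "F \<subseteq> \<X>"
          have "v (trunc F \<psi>) Y = w (trunc F \<psi>) Y"
            unfolding block_sum_trunc[OF v F \<psi>] block_sum_trunc[OF w F \<psi>]
            using F eq True by (intro sum.cong) auto
          then show "ip H (inc Y y) (v (trunc F \<psi>)) = ip H (inc Y y) (w (trunc F \<psi>))"
            using True y F opsD(1)[OF v] opsD(1)[OF w] by (simp add: ip_inc trunc_in_H)
        qed
        have "ip H (inc Y y) (v \<psi>) = ip H (inc Y y) (w \<psi>)"
          using tendsto_unique[OF finite_subsets_at_top_neq_bot
              Lim_transform_eventually[OF ip_trunc_trunc_tendsto(2)[OF v i \<psi>] ev] ip_trunc_trunc_tendsto(2)[OF w i \<psi>]] .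
        then show "ip (hs Y) y (v \<psi> Y) = ip (hs Y) y (w \<psi> Y)"
          using True y \<psi> opsD(1)[OF v] opsD(1)[OF w] by (simp add: ip_inc)
      qed (use True \<psi> opsD(1)[OF v] opsD(1)[OF w] in \<open>simp_all add: H_D\<close>)
    qed (use \<psi> opsD(1)[OF v] opsD(1)[OF w] in \<open>simp add: H_D\<close>)
  qed
qed

subsection \<open>Adjoints\<close>

text \<open>The adjoint is assembled from the adjoints of \<open>v inc\<^sub>X\<close>, whose domains are finite-dimensional.  That
  \<open>v\<^sup>\<dagger> \<phi>\<close> is square summable follows by applying \<open>v\<close> to its truncations \<open>\<psi>\<close>:
  \<open>\<parallel>\<psi>\<parallel>\<^sup>2 = \<langle>v \<psi> | \<phi>\<rangle> \<le> \<parallel>v\<parallel> \<parallel>\<psi>\<parallel> \<parallel>\<phi>\<parallel>\<close>.\<close>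

lemma adj_H:
  assumes v: "v \<in> ops H H"
  shows "adj H H v \<in> ops H H"
    and "\<And>\<psi> \<phi>. \<psi> \<in> carrier H \<Longrightarrow> \<phi> \<in> carrier H \<Longrightarrow> ip H (v \<psi>) \<phi> = ip H \<psi> (adj H H v \<phi>)"
proof -
  note p = prehilbert_H
  obtain C where C: "C \<ge> 0" "\<And>x. x \<in> carrier H \<Longrightarrow> hnorm H (v x) \<le> C * hnorm H x"
    using ops_bound[OF v p] by blast
  define bX where "bX X = adj (hs X) H (v \<circ> inc X)" for X
  define b where "b \<phi> = (\<lambda>X. if X \<in> \<X> then bX X \<phi> else 0)" for \<phi>
  have bX: "bX X \<in> ops H (hs X)" "\<And>x \<phi>. x \<in> carrier (hs X) \<Longrightarrow> \<phi> \<in> carrier H \<Longrightarrow> ip H (v (inc X x)) \<phi> = ip (hs X) x (bX X \<phi>)"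
    if X: "X \<in> \<X>" for X
    using fd_adj[OF hs_fd[OF fd[OF X]] p ops_comp[OF ph[OF X] p p v inc_in_ops[OF X]]] by (auto simp: bX_def)
  have bc: "b \<phi> X \<in> carrier (hs X)" if "X \<in> \<X>" "\<phi> \<in> carrier H" for X \<phi>
    using opsD(1)[OF bX(1)] that by (simp add: b_def)
  have ipb: "ip H (v (inc X x)) \<phi> = ip (hs X) x (b \<phi> X)" if "X \<in> \<X>" "x \<in> carrier (hs X)" "\<phi> \<in> carrier H" for X x \<phi>
    using bX(2) that by (simp add: b_def)
  have bound: "(\<Sum>X\<in>F. (hnorm (hs X) (b \<phi> X))\<^sup>2) \<le> (C * hnorm H \<phi>)\<^sup>2" if F: "finite F" "F \<subseteq> \<X>" and \<phi>: "\<phi> \<in> carrier H" for F \<phi>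
  proof -
    let ?S = "\<Sum>X\<in>F. (hnorm (hs X) (b \<phi> X))\<^sup>2"
    define \<psi> where "\<psi> = (\<Sum>X\<in>F. inc X (b \<phi> X))"
    have \<psi>: "\<psi> \<in> carrier H" unfolding \<psi>_def using F by (intro carrier_sum p inc_in_H) auto
    have \<psi>Y: "\<psi> Y = (if Y \<in> F then b \<phi> Y else 0)" for Y
    proof -
      have "\<psi> Y = (\<Sum>X\<in>F. if X = Y then b \<phi> Y else 0)"
        unfolding \<psi>_def sum_fun_apply using F bc[OF _ \<phi>] by (intro sum.cong) (auto simp: subset_iff)
      then show ?thesis using F(1) by simp
    qed
    have "trunc F \<psi> = \<psi>" using trunc_apply[OF F \<psi>] \<psi>Y by (auto simp: fun_eq_iff)
    then have n: "(hnorm H \<psi>)\<^sup>2 = ?S" using hnorm_trunc_sq[OF F \<psi>] \<psi>Y by simp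
    have "ip H (v \<psi>) \<phi> = (\<Sum>X\<in>F. ip H (v (inc X (b \<phi> X))) \<phi>)"
      unfolding \<psi>_def using F \<phi> opsD(1)[OF v]
      by (subst ops_sum[OF p v]) (auto simp: inc_in_H p intro!: ip_sum_left)
    also have "\<dots> = (\<Sum>X\<in>F. complex_of_real ((hnorm (hs X) (b \<phi> X))\<^sup>2))"
      using F \<phi> by (intro sum.cong) (auto simp: subset_iff ipb bc ip_self ph)
    finally have S: "ip H (v \<psi>) \<phi> = complex_of_real ?S" by simp
    have "?S \<ge> 0" by (simp add: sum_nonneg)
    then have "?S = cmod (ip H (v \<psi>) \<phi>)" by (simp only: S norm_of_real abs_of_nonneg)
    also have "\<dots> \<le> hnorm H (v \<psi>) * hnorm H \<phi>" by (intro Cauchy_Schwarz p opsD(1)[OF v] \<psi> \<phi>)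
    also have "\<dots> \<le> C * hnorm H \<psi> * hnorm H \<phi>" by (intro mult_right_mono C \<psi> hnorm_nonneg p \<phi>)
    finally have "(hnorm H \<psi>)\<^sup>2 \<le> C * hnorm H \<psi> * hnorm H \<phi>" unfolding n .
    then have le: "hnorm H \<psi> * hnorm H \<psi> \<le> hnorm H \<psi> * (C * hnorm H \<phi>)"
      by (simp add: power2_eq_square mult_ac)
    have "hnorm H \<psi> \<le> C * hnorm H \<phi>"
    proof (cases "hnorm H \<psi> = 0")
      case True
      then show ?thesis using C(1) \<phi> p by simp
    next
      case False
      then show ?thesis using le hnorm_nonneg[OF p \<psi>] by (simp add: mult_le_cancel_left)
    qed
    then show ?thesis unfolding n[symmetric] using hnorm_nonneg[OF p \<psi>] by (intro power_mono)
  qed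
  have summ: "(\<lambda>X. (hnorm (hs X) (b \<phi> X))\<^sup>2) summable_on \<X>" if "\<phi> \<in> carrier H" for \<phi>
    using bound[OF _ _ that] by (intro nonneg_bdd_above_summable_on) (auto intro!: bdd_aboveI2)
  have bH: "b \<phi> \<in> carrier H" if "\<phi> \<in> carrier H" for \<phi>
    using that by (simp add: mem_H summ bc) (simp add: b_def)
  have "b \<in> ops H H"
  proof (rule opsI[where C=C])
    fix \<phi> assume \<phi>: "\<phi> \<in> carrier H"
    show "b \<phi> \<in> carrier H" by (rule bH[OF \<phi>])
    have "(hnorm H (b \<phi>))\<^sup>2 \<le> (C * hnorm H \<phi>)\<^sup>2"
      unfolding hnorm_H_sq[OF bH[OF \<phi>]] using bound[OF _ _ \<phi>] by (intro infsum_le_finite_sums summ \<phi>)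
    then show "hnorm H (b \<phi>) \<le> C * hnorm H \<phi>"
      by (rule power2_le_imp_le) (simp add: C p \<phi>)
    show "b (c *C \<phi>) = c *C b \<phi>" for c
      using \<phi> opsD(3)[OF bX(1)] by (auto simp: b_def fun_eq_iff scaleC_fun_def)
    show "b (\<phi> + \<psi>) = b \<phi> + b \<psi>" if "\<psi> \<in> carrier H" for \<psi>
      using \<phi> that opsD(2)[OF bX(1)] by (auto simp: b_def fun_eq_iff)
  next
    fix \<phi> assume "\<phi> \<notin> carrier H"
    then show "b \<phi> = 0" using opsD(4)[OF bX(1)] by (auto simp: b_def fun_eq_iff)
  qed
  moreover have "ip H (v \<psi>) \<phi> = ip H \<psi> (b \<phi>)" if \<psi>: "\<psi> \<in> carrier H" and \<phi>: "\<phi> \<in> carrier H" for \<psi> \<phi>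
  proof -
    have 1: "((\<lambda>F. cnj (ip H \<phi> (v (trunc F \<psi>)))) \<longlongrightarrow> cnj (ip H \<phi> (v \<psi>))) (finite_subsets_at_top \<X>)"
      by (intro tendsto_cnj ip_trunc_trunc_tendsto(2) v \<phi> \<psi>)
    have 2: "((\<lambda>F. \<Sum>X\<in>F. ip (hs X) (\<psi> X) (b \<phi> X)) \<longlongrightarrow> ip H \<psi> (b \<phi>)) (finite_subsets_at_top \<X>)"
      unfolding ip_H by (intro infsum_tendsto ip_summable \<psi> bH \<phi>)
    have "\<forall>\<^sub>F F in finite_subsets_at_top \<X>. cnj (ip H \<phi> (v (trunc F \<psi>))) = (\<Sum>X\<in>F. ip (hs X) (\<psi> X) (b \<phi> X))"
    proof (rule eventually_finite_subsets_at_top_weakI)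
      fix F assume F: "finite F" "F \<subseteq> \<X>"
      have t: "trunc F \<psi> \<in> carrier H" by (rule trunc_in_H[OF F(2)])
      have "cnj (ip H \<phi> (v (trunc F \<psi>))) = ip H (v (trunc F \<psi>)) \<phi>"
        using ip_cnj[OF p \<phi> opsD(1)[OF v t]] by simp
      also have "\<dots> = (\<Sum>X\<in>F. ip H (v (inc X (\<psi> X))) \<phi>)"
        unfolding trunc_def using F \<phi> opsD(1)[OF v]
        by (subst ops_sum[OF p v]) (auto simp: inc_in_H p intro!: ip_sum_left)
      also have "\<dots> = (\<Sum>X\<in>F. ip (hs X) (\<psi> X) (b \<phi> X))"
        using F \<phi> \<psi> by (intro sum.cong) (auto simp: subset_iff ipb H_D)
      finally show "cnj (ip H \<phi> (v (trunc F \<psi>))) = (\<Sum>X\<in>F. ip (hs X) (\<psi> X) (b \<phi> X))" .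
    qed
    from Lim_transform_eventually[OF 1 this] have "cnj (ip H \<phi> (v \<psi>)) = ip H \<psi> (b \<phi>)"
      using tendsto_unique[OF finite_subsets_at_top_neq_bot _ 2] by blast
    then show ?thesis using ip_cnj[OF p \<phi> opsD(1)[OF v \<psi>]] by simp
  qed
  moreover from calculation have "adj H H v = b" by (intro adj_eqI p) auto
  ultimately show "adj H H v \<in> ops H H" "\<And>\<psi> \<phi>. \<psi> \<in> carrier H \<Longrightarrow> \<phi> \<in> carrier H \<Longrightarrow> ip H (v \<psi>) \<phi> = ip H \<psi> (adj H H v \<phi>)"
    by auto
qed

lemma adj_adj_H: "v \<in> ops H H \<Longrightarrow> adj H H (adj H H v) = v"
proof (rule adj_eqI[OF prehilbert_H], assumption)
  fix \<psi> \<phi> assume v: "v \<in> ops H H" and c: "\<psi> \<in> carrier H" "\<phi> \<in> carrier H"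
  note A = adj_H[OF v]
  have "ip H (adj H H v \<psi>) \<phi> = cnj (ip H \<phi> (adj H H v \<psi>))"
    by (rule ip_cnj[OF prehilbert_H c(2) opsD(1)[OF A(1) c(1)]])
  also have "\<dots> = cnj (ip H (v \<phi>) \<psi>)" using A(2)[OF c(2,1)] by simp
  also have "\<dots> = ip H \<psi> (v \<phi>)" using ip_cnj[OF prehilbert_H opsD(1)[OF v c(2)] c(1)] by simp
  finally show "ip H (adj H H v \<psi>) \<phi> = ip H \<psi> (v \<phi>)" .
qed

lemma block_adj:
  assumes v: "v \<in> ops H H" and X: "X \<in> \<X>" and Y: "Y \<in> \<X>"
  shows "block (adj H H v) X Y = adj (hs Y) (hs X) (block v Y X)"
proof (rule adj_eqI[OF ph[OF Y] block_in_ops[OF adj_H(1)[OF v] X Y], symmetric])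
  note A = adj_H[OF v]
  fix y x assume y: "y \<in> carrier (hs Y)" and x: "x \<in> carrier (hs X)"
  have vy: "v (inc Y y) \<in> carrier H" using opsD(1)[OF v inc_in_H[OF Y]] .
  have ax: "adj H H v (inc X x) \<in> carrier H" using opsD(1)[OF A(1) inc_in_H[OF X]] .
  have "ip (hs X) (block v Y X y) x = cnj (ip (hs X) x (v (inc Y y) X))"
    unfolding block_def by (rule ip_cnj[OF ph[OF X] x H_D(1)[OF vy X]])
  also have "\<dots> = cnj (ip H (inc X x) (v (inc Y y)))" by (simp add: ip_inc X x vy)
  also have "\<dots> = ip H (v (inc Y y)) (inc X x)"
    by (rule ip_cnj[OF prehilbert_H inc_in_H[OF X] vy, symmetric])
  also have "\<dots> = ip H (inc Y y) (adj H H v (inc X x))" by (rule A(2)[OF inc_in_H[OF Y] inc_in_H[OF X]])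
  also have "\<dots> = ip (hs Y) y (block (adj H H v) X Y x)" by (simp add: ip_inc Y y ax block_def)
  finally show "ip (hs X) (block v Y X y) x = ip (hs Y) y (block (adj H H v) X Y x)" .
qed

end


context qset
begin

subsection \<open>Matrix units\<close>

text \<open>The operator on the direct sum whose block from \<open>X\<close> to \<open>Y\<close> is \<open>c\<close> and whose other blocks are \<open>0\<close>.\<close>

definition emb :: "'v atom \<Rightarrow> 'v atom \<Rightarrow> ('v vec \<Rightarrow> 'v vec) \<Rightarrow> ('v atom \<Rightarrow> 'v vec) \<Rightarrow> ('v atom \<Rightarrow> 'v vec)" where
  "emb X Y c = inc Y \<circ> c \<circ> adj (hs X) H (inc X)"

lemma emb_in_ops:
  assumes X: "X \<in> \<X>" and Y: "Y \<in> \<X>" and c: "c \<in> ops (hs X) (hs Y)"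
  shows "emb X Y c \<in> ops H H"
  unfolding emb_def using fd_adj(1)[OF hs_fd[OF fd[OF X]] prehilbert_H inc_in_ops[OF X]]
  by (intro ops_comp[OF prehilbert_H ph[OF X] prehilbert_H] ops_comp[OF ph[OF X] ph[OF Y] prehilbert_H] inc_in_ops Y c)

lemma emb_apply: "X \<in> \<X> \<Longrightarrow> \<psi> \<in> carrier H \<Longrightarrow> emb X Y c \<psi> = inc Y (c (\<psi> X))"
  by (simp add: emb_def adj_inc)

lemma block_emb:
  assumes X: "X \<in> \<X>" "Y \<in> \<X>" "X' \<in> \<X>" and c: "c \<in> ops (hs X) (hs Y)"
  shows "block (emb X Y c) X' Y' = (if X' = X \<and> Y' = Y then c else 0)"
proof
  fix x
  have c0: "c 0 = 0" using ops_zero[OF ph[OF X(1)] c] .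
  have cx: "c (inc X x X) = c x"
    using opsD(4)[OF c, of x] c0 by (cases "x \<in> carrier (hs X)") (simp_all add: inc_outside)
  have cc: "c x \<in> carrier (hs Y)" using opsD(1,4)[OF c, of x] ph[OF X(2)] by (cases "x \<in> carrier (hs X)") simp_all
  have i0: "inc Y 0 Y' = 0" by (simp add: inc_def id_op_def)
  show "block (emb X Y c) X' Y' x = (if X' = X \<and> Y' = Y then c else 0) x"
    using cx cc c0 i0 by (cases "X' = X"; cases "Y' = Y") (simp_all add: block_def emb_apply X inc_in_H)
qed

text \<open>With \<open>p\<^sub>X\<close> the projection onto an atom, this is \<open>p\<^sub>Y w p\<^sub>X\<close>.  As \<open>p\<^sub>X\<close> is in the commutant, a quantum preorder contains the
  blocks of its elements.\<close>

lemma emb_sandwich: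
  assumes X: "X \<in> \<X>" and Y: "Y \<in> \<X>" and w: "w \<in> ops H H"
  shows "emb X Y (block w X Y) = emb Y Y (id_op (hs Y)) \<circ> w \<circ> emb X X (id_op (hs X))"
proof -
  note iX = id_op_in_ops[OF ph[OF X]] and iY = id_op_in_ops[OF ph[OF Y]]
  show ?thesis
  proof (rule ops_eqI[of _ H H])
    show "emb X Y (block w X Y) \<in> ops H H" by (intro emb_in_ops X Y block_in_ops w)
    show "emb Y Y (id_op (hs Y)) \<circ> w \<circ> emb X X (id_op (hs X)) \<in> ops H H"
      by (intro ops_comp[OF prehilbert_H prehilbert_H prehilbert_H] emb_in_ops X Y iX iY w)
    fix \<psi> assume \<psi>: "\<psi> \<in> carrier H"
    have "w (inc X (\<psi> X)) \<in> carrier H" using opsD(1)[OF w inc_in_H[OF X]] .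
    then show "emb X Y (block w X Y) \<psi> = (emb Y Y (id_op (hs Y)) \<circ> w \<circ> emb X X (id_op (hs X))) \<psi>"
      using \<psi> by (simp add: emb_apply X Y block_def id_op_def H_D)
  qed
qed

lemma block_linear: "block (v + w) X Y = block v X Y + block w X Y" "block (c *C v) X Y = c *C block v X Y"
  "block (sum u I) X Y = (\<Sum>i\<in>I. block (u i) X Y)"
  by (auto simp: block_def fun_eq_iff scaleC_fun_def sum_fun_apply)

lemma block_compose:
  assumes v: "v \<in> ops H H" and w: "w \<in> ops H H" and X: "X \<in> \<X>" and Y: "Y \<in> \<X>"
  shows "block (w \<circ> emb Y Y (id_op (hs Y)) \<circ> v) X Z = block w Y Z \<circ> block v X Y"
proof
  fix x
  have vx: "v (inc X x) \<in> carrier H" using opsD(1)[OF v inc_in_H[OF X]] .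
  show "block (w \<circ> emb Y Y (id_op (hs Y)) \<circ> v) X Z x = (block w Y Z \<circ> block v X Y) x"
    using H_D(1)[OF vx Y] by (simp add: block_def emb_apply[OF Y vx] id_op_def)
qed

text \<open>The inverse of \<open>V \<mapsto> R\<close> in the correspondence.\<close>

definition rel_ops :: "'v brel \<Rightarrow> (('v atom \<Rightarrow> 'v vec) \<Rightarrow> ('v atom \<Rightarrow> 'v vec)) set" where
  "rel_ops R = {v \<in> ops H H. \<forall>X\<in>\<X>. \<forall>Y\<in>\<X>. block v X Y \<in> R X Y}"

lemma rel_ops_subspace:
  assumes "\<And>X Y. cvec.subspace (R X Y)"
  shows "cvec.subspace (rel_ops R)"
proof (rule cvec.subspaceI)
  note S = ops_subspace[OF prehilbert_H prehilbert_H]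
  have "block 0 X Y = 0" for X Y by (auto simp: block_def fun_eq_iff)
  then show "0 \<in> rel_ops R" using cvec.subspace_0[OF S] cvec.subspace_0[OF assms] by (simp add: rel_ops_def)
  show "x + y \<in> rel_ops R" if "x \<in> rel_ops R" "y \<in> rel_ops R" for x y
    using that cvec.subspace_add[OF S] cvec.subspace_add[OF assms] by (simp add: rel_ops_def block_linear)
  show "c *C x \<in> rel_ops R" if "x \<in> rel_ops R" for c x
    using that cvec.subspace_scale[OF S] cvec.subspace_scale[OF assms] by (simp add: rel_ops_def block_linear)
qed

lemma id_rel_subspace: "cvec.subspace (id_rel \<X> X Y)"
  by (simp add: id_rel_def)

lemma emb_in_rel_ops:
  assumes R: "\<And>X Y. cvec.subspace (R X Y)" and X: "X \<in> \<X>" "Y \<in> \<X>" and c: "c \<in> ops (hs X) (hs Y)" "c \<in> R X Y"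
  shows "emb X Y c \<in> rel_ops R"
  using emb_in_ops[OF X c(1)] c cvec.subspace_0[OF R] by (simp add: rel_ops_def block_emb X)

subsection \<open>The commutant\<close>

lemma diag_in_ops:
  assumes m: "\<And>X. X \<in> \<X> \<Longrightarrow> m X \<in> ops (hs X) (hs X)"
    and C: "\<And>X x. X \<in> \<X> \<Longrightarrow> x \<in> carrier (hs X) \<Longrightarrow> hnorm (hs X) (m X x) \<le> C * hnorm (hs X) x"
  shows "diag_op \<X> m \<in> ops H H"
proof -
  let ?d = "diag_op \<X> m"
  have app: "?d \<psi> = (\<lambda>X. if X \<in> \<X> then m X (\<psi> X) else 0)" if "\<psi> \<in> carrier H" for \<psi>
    using that by (simp add: diag_op_def)
  have sq: "(hnorm (hs X) (m X (\<psi> X)))\<^sup>2 \<le> C\<^sup>2 * (hnorm (hs X) (\<psi> X))\<^sup>2" if "\<psi> \<in> carrier H" "X \<in> \<X>" for \<psi> X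
    using power_mono[OF C[OF that(2) H_D(1)[OF that]] hnorm_nonneg[OF ph[OF that(2)] opsD(1)[OF m[OF that(2)] H_D(1)[OF that]]], of 2]
    by (simp add: power_mult_distrib)
  have dom: "(\<lambda>X. C\<^sup>2 * (hnorm (hs X) (\<psi> X))\<^sup>2) summable_on \<X>" if "\<psi> \<in> carrier H" for \<psi>
    by (intro summable_on_cmult_right H_D(3) that)
  have summ: "(\<lambda>X. (hnorm (hs X) (m X (\<psi> X)))\<^sup>2) summable_on \<X>" if "\<psi> \<in> carrier H" for \<psi>
    by (rule summable_on_comparison_test[OF dom[OF that]]) (use sq that in auto)
  have dH: "?d \<psi> \<in> carrier H" if \<psi>: "\<psi> \<in> carrier H" for \<psi>
  proof -
    have "(\<lambda>X. (hnorm (hs X) (?d \<psi> X))\<^sup>2) summable_on \<X>"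
      using summ[OF \<psi>] by (rule summable_on_cong[THEN iffD1, rotated]) (simp add: app[OF \<psi>])
    moreover have "m X (\<psi> X) \<in> carrier (hs X)" if "X \<in> \<X>" for X
      using opsD(1)[OF m[OF that] H_D(1)[OF \<psi> that]] .
    ultimately show ?thesis unfolding mem_H by (simp add: app[OF \<psi>])
  qed
  show ?thesis
  proof (rule opsI[where C="\<bar>C\<bar>"])
    fix \<psi> assume \<psi>: "\<psi> \<in> carrier H"
    show "?d \<psi> \<in> carrier H" by (rule dH[OF \<psi>])
    have "(hnorm H (?d \<psi>))\<^sup>2 = (\<Sum>\<^sub>\<infinity>X\<in>\<X>. (hnorm (hs X) (m X (\<psi> X)))\<^sup>2)"
      unfolding hnorm_H_sq[OF dH[OF \<psi>]] by (intro infsum_cong) (simp add: app[OF \<psi>])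
    also have "\<dots> \<le> (\<Sum>\<^sub>\<infinity>X\<in>\<X>. C\<^sup>2 * (hnorm (hs X) (\<psi> X))\<^sup>2)"
      by (intro infsum_mono summ dom sq \<psi>)
    also have "\<dots> = (\<bar>C\<bar> * hnorm H \<psi>)\<^sup>2"
      by (simp add: infsum_cmult_right' hnorm_H_sq[OF \<psi>] power_mult_distrib)
    finally show "hnorm H (?d \<psi>) \<le> \<bar>C\<bar> * hnorm H \<psi>"
      by (rule power2_le_imp_le) (simp add: prehilbert_H \<psi>)
    show "?d (c *C \<psi>) = c *C ?d \<psi>" for c
      unfolding app[OF carrier_scale[OF prehilbert_H \<psi>]] app[OF \<psi>]
      by (auto simp: fun_eq_iff scaleC_fun_def opsD(3)[OF m H_D(1)[OF \<psi>]])
    show "?d (\<psi> + \<phi>) = ?d \<psi> + ?d \<phi>" if "\<phi> \<in> carrier H" for \<phi>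
      unfolding app[OF carrier_add[OF prehilbert_H \<psi> that]] app[OF \<psi>] app[OF that]
      by (auto simp: fun_eq_iff opsD(2)[OF m H_D(1)[OF \<psi>] H_D(1)[OF that]])
  qed (simp add: diag_op_def fun_eq_iff)
qed

text \<open>An operator that commutes with \<open>\<ell>\<^sup>\<infinity>(\<X>)\<close> commutes with the projections onto the atoms, so it is block
  diagonal, and each block commutes with the rank one operators, so it is scalar.\<close>

lemma commutant_linfty: "commutant H (linfty \<X>) = rel_ops (id_rel \<X>)"
proof (intro equalityI subsetI)
  fix v assume v: "v \<in> commutant H (linfty \<X>)"
  then have vo: "v \<in> ops H H" and comm: "\<And>m. m \<in> linfty \<X> \<Longrightarrow> v \<circ> m = m \<circ> v" by (auto simp: commutant_def)
  have key: "v (inc X (a x)) = inc X (a (block v X X x))"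
    if X: "X \<in> \<X>" and a: "a \<in> ops (hs X) (hs X)" and x: "x \<in> carrier (hs X)" for X a x
  proof -
    define m where "m Y = (if Y = X then a else 0)" for Y
    obtain C where C: "C \<ge> 0" "\<And>x. x \<in> carrier (hs X) \<Longrightarrow> hnorm (hs X) (a x) \<le> C * hnorm (hs X) x"
      using ops_bound[OF a ph[OF X]] by blast
    have "m Y \<in> ops (hs Y) (hs Y)" if "Y \<in> \<X>" for Y
      using a cvec.subspace_0[OF ops_subspace[OF ph[OF that] ph[OF that]]] by (simp add: m_def)
    moreover have "\<forall>Y\<in>\<X>. \<forall>x\<in>carrier (hs Y). hnorm (hs Y) (m Y x) \<le> C * hnorm (hs Y) x"
      using C ph by (simp add: m_def)
    ultimately have "diag_op \<X> m \<in> linfty \<X>" unfolding linfty_def by blast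
    from fun_cong[OF comm[OF this], of "inc X x"] have eq: "v (diag_op \<X> m (inc X x)) = diag_op \<X> m (v (inc X x))" by simp
    have d: "diag_op \<X> m \<psi> = inc X (a (\<psi> X))" if "\<psi> \<in> carrier H" for \<psi>
      using that X opsD(1)[OF a H_D(1)[OF that X]] by (auto simp: diag_op_def m_def fun_eq_iff)
    show ?thesis using eq x X opsD(1)[OF vo] by (simp add: d inc_in_H block_def)
  qed
  show "v \<in> rel_ops (id_rel \<X>)"
    unfolding rel_ops_def
  proof (intro CollectI conjI vo ballI)
    fix X Y assume X: "X \<in> \<X>" and Y: "Y \<in> \<X>"
    note cX = block_in_ops[OF vo X X]
    show "block v X Y \<in> id_rel \<X> X Y"
    proof (cases "X = Y")
      case False
      have "block v X Y = 0"
      proof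
        fix x show "block v X Y x = 0 x"
        proof (cases "x \<in> carrier (hs X)")
          case True
          then have "id_op (hs X) x = x" by (simp add: id_op_def)
          with key[OF X id_op_in_ops[OF ph[OF X]] True]
          have "v (inc X x) = inc X (id_op (hs X) (block v X X x))" by simp
          then have "v (inc X x) Y = inc X (id_op (hs X) (block v X X x)) Y" by (rule fun_cong)
          also have "\<dots> = 0" using False by (intro inc_other) simp
          finally show ?thesis by (simp add: block_def)
        qed (simp add: opsD(4)[OF block_in_ops[OF vo X Y]])
      qed
      then show ?thesis using cvec.subspace_0[OF id_rel_subspace] by simp
    next
      case True
      have "\<exists>c. block v X X = c *C id_op (hs X)"
      proof (cases "basis X = {}")
        case True
        then have "carrier (hs X) = {0}" using onbD(2)[OF onb_basis[OF fd[OF X]]] by simp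
        then have "block v X X x = 0" for x using opsD(4)[OF cX, of x] ops_zero[OF ph[OF X] cX] by (cases "x = 0") auto
        then have "block v X X = 0 *C id_op (hs X)" by (auto simp: fun_eq_iff scaleC_fun_def)
        then show ?thesis by blast
      next
        case False
        then obtain e where eb: "e \<in> basis X" by blast
        have e: "e \<in> carrier (hs X)" "ip (hs X) e e = 1"
          using basis_carrier[OF fd[OF X] eb] onbD(4)[OF onb_basis[OF fd[OF X]] eb eb] by auto
        have "block v X X = ip (hs X) e (block v X X e) *C id_op (hs X)"
        proof
          fix x show "block v X X x = (ip (hs X) e (block v X X e) *C id_op (hs X)) x"
          proof (cases "x \<in> carrier (hs X)")
            case x: True
            \<comment> \<open>the rank one operator \<open>|x\<rangle>\<langle>e|\<close>\<close>
            define a where "a y = (if y \<in> carrier (hs X) then ip (hs X) e y *C x else 0)" for y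
            have a: "a \<in> ops (hs X) (hs X)"
              using ph[OF X] e x by (intro fd_opsI hs_fd fd X)
                (auto simp: a_def ip_add_right ip_scale_right cvec.scale_left_distrib)
            have ce: "block v X X e \<in> carrier (hs X)" by (rule opsD(1)[OF cX e(1)])
            have "a e = x" using e by (simp add: a_def)
            then have "block v X X x = inc X (a (block v X X e)) X"
              using key[OF X a e(1)] by (simp add: block_def)
            also have "\<dots> = ip (hs X) e (block v X X e) *C x"
              using ce x ph[OF X] by (simp add: a_def)
            finally show ?thesis using x by (simp add: scaleC_fun_def id_op_def)
          qed (simp add: scaleC_fun_def id_op_def opsD(4)[OF cX])
        qed
        then show ?thesis by blast
      qed
      then show ?thesis using True X by (auto simp: id_rel_def cvec.span_singleton)
    qed
  qed
next
  fix v assume v: "v \<in> rel_ops (id_rel \<X>)"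
  then have vo: "v \<in> ops H H" and vc: "\<And>X Y. X \<in> \<X> \<Longrightarrow> Y \<in> \<X> \<Longrightarrow> block v X Y \<in> id_rel \<X> X Y"
    by (auto simp: rel_ops_def)
  have "v \<circ> d = d \<circ> v" if "d \<in> linfty \<X>" for d
  proof -
    obtain m where d: "d = diag_op \<X> m" and m': "\<forall>X\<in>\<X>. m X \<in> ops (hs X) (hs X)"
      and "\<exists>C. \<forall>X\<in>\<X>. \<forall>x\<in>carrier (hs X). hnorm (hs X) (m X x) \<le> C * hnorm (hs X) x"
      using \<open>d \<in> linfty \<X>\<close> unfolding linfty_def by blast
    then obtain C where "\<forall>X\<in>\<X>. \<forall>x\<in>carrier (hs X). hnorm (hs X) (m X x) \<le> C * hnorm (hs X) x" by blast
    then have C: "\<And>X x. X \<in> \<X> \<Longrightarrow> x \<in> carrier (hs X) \<Longrightarrow> hnorm (hs X) (m X x) \<le> C * hnorm (hs X) x" by blast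
    have m: "\<And>X. X \<in> \<X> \<Longrightarrow> m X \<in> ops (hs X) (hs X)" using m' by blast
    have do: "d \<in> ops H H" unfolding d by (rule diag_in_ops[OF m C])
    note p = prehilbert_H
    show ?thesis
    proof (rule ops_eq_by_blocks[OF ops_comp[OF p p p vo do] ops_comp[OF p p p do vo]])
      fix X Y assume X: "X \<in> \<X>" and Y: "Y \<in> \<X>"
      show "block (v \<circ> d) X Y = block (d \<circ> v) X Y"
      proof
        fix x
        have vx: "v (inc X x) \<in> carrier H" by (rule opsD(1)[OF vo inc_in_H[OF X]])
        have "d (inc X x) = inc X (m X x)"
        proof
          fix Z
          have dZ: "d (inc X x) Z = (if Z \<in> \<X> then m Z (inc X x Z) else 0)"
            using inc_in_H[OF X] by (simp add: d diag_op_def)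
          show "d (inc X x) Z = inc X (m X x) Z"
          proof (cases "Z = X")
            case True
            have m0: "m X 0 = 0" using ops_zero[OF ph[OF X] m[OF X]] .
            show ?thesis
            proof (cases "x \<in> carrier (hs X)")
              case x: True
              then show ?thesis using True X dZ opsD(1)[OF m[OF X] x] by simp
            next
              case False
              then show ?thesis using True X dZ m0 opsD(4)[OF m[OF X] False] ph[OF X] by (simp add: inc_outside)
            qed
          next
            case False
            then show ?thesis using dZ ops_zero[OF ph m] by simp
          qed
        qed
        then have l: "block (v \<circ> d) X Y x = block v X Y (m X x)" by (simp add: block_def)
        have r: "block (d \<circ> v) X Y x = m Y (block v X Y x)"
          using vx Y by (simp add: block_def d diag_op_def)
        show "block (v \<circ> d) X Y x = block (d \<circ> v) X Y x"
        proof (cases "X = Y")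
          case False
          then have "block v X Y = 0" using vc[OF X Y] by (simp add: id_rel_def)
          then show ?thesis unfolding l r using ops_zero[OF ph[OF Y] m[OF Y]] by simp
        next
          case True
          then obtain c where c: "block v X Y = c *C id_op (hs X)" using vc[OF X Y] X by (auto simp: id_rel_def cvec.span_singleton)
          show ?thesis unfolding l r c using True opsD[OF m[OF X], of x] ops_zero[OF ph[OF X] m[OF X]]
            by (cases "x \<in> carrier (hs X)") (simp_all add: scaleC_fun_def id_op_def)
        qed
      qed
    qed
  qed
  then show "v \<in> commutant H (linfty \<X>)" using vo by (simp add: commutant_def)
qed

subsection \<open>Ultraweakly closed spaces of operators\<close>

lemma form_ip_block:
  assumes X: "X \<in> \<X>" and Y: "Y \<in> \<X>" and a: "a \<in> ops H H"
  shows "form_ip [X, dual Y] k (op_form Y (block a X Y)) =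
    (\<Sum>(e, f)\<in>basis X \<times> basis (dual Y). ip H (inc Y (k [e, f] *C riesz_vec Y f)) (a (inc X e)))"
proof -
  have fY': "fd_atom (dual Y)" using fd[OF Y] by simp
  have "cnj (k [e, f]) * op_form Y (block a X Y) [e, f] = ip H (inc Y (k [e, f] *C riesz_vec Y f)) (a (inc X e))"
    if e: "e \<in> basis X" and f: "f \<in> basis (dual Y)" for e f
  proof -
    have fc: "f \<in> carrier (hs (dual Y))" by (rule basis_carrier[OF fY' f])
    note rf = riesz_vec[OF fd[OF Y] fc]
    have ae: "a (inc X e) \<in> carrier H" by (rule opsD(1)[OF a inc_in_H[OF X]])
    show ?thesis
      using ip_inc[OF Y carrier_scale[OF ph[OF Y] rf(1)] ae] fc rf(2)[OF H_D(1)[OF ae Y]]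
        ip_scale_left[OF ph[OF Y] rf(1) H_D(1)[OF ae Y]]
      by (simp add: op_form_apply block_def)
  qed
  then show ?thesis
    unfolding form_ip_bases sum.cartesian_product[symmetric] by simp
qed

text \<open>Normal functionals are given by sequences, so the finite family is padded by zero vectors.  The padding contributes
  \<open>\<langle>0 | a 0\<rangle>\<close>, which is zero for linear \<open>a\<close>.\<close>

lemma finite_normal_functional:
  assumes I: "finite I" and \<xi>: "\<And>i. i \<in> I \<Longrightarrow> \<xi> i \<in> carrier H" and \<eta>: "\<And>i. i \<in> I \<Longrightarrow> \<eta> i \<in> carrier H"
  obtains \<omega> where "\<omega> \<in> normal_functionals H" "\<And>a. a \<in> ops H H \<Longrightarrow> \<omega> a = (\<Sum>i\<in>I. ip H (\<xi> i) (a (\<eta> i)))"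
proof -
  obtain h where h: "bij_betw h {0..<card I} I" using ex_bij_betw_nat_finite[OF I] by blast
  define pad where "pad z k = (if k < card I then z (h k) else 0)" for z :: "_ \<Rightarrow> 'v atom \<Rightarrow> 'v vec" and k
  have hI: "h k \<in> I" if "k < card I" for k using bij_betwE[OF h] that by simp
  have pc: "pad \<xi> k \<in> carrier H" "pad \<eta> k \<in> carrier H" for k
    using \<xi>[OF hI] \<eta>[OF hI] prehilbert_H by (simp_all add: pad_def)
  have ps: "summable (\<lambda>k. (hnorm H (pad z k))\<^sup>2)" for z
    using prehilbert_H by (intro summable_finite[of "{..<card I}"]) (auto simp: pad_def)
  define \<omega> where "\<omega> a = (\<Sum>k. ip H (pad \<xi> k) (a (pad \<eta> k)))" for a
  have "\<omega> \<in> normal_functionals H"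
    unfolding normal_functionals_def \<omega>_def using pc ps
    by (intro CollectI exI[of _ "pad \<xi>"] exI[of _ "pad \<eta>"]) auto
  moreover have "\<omega> a = (\<Sum>i\<in>I. ip H (\<xi> i) (a (\<eta> i)))" if a: "a \<in> ops H H" for a
  proof -
    have "\<omega> a = (\<Sum>k\<in>{0..<card I}. ip H (pad \<xi> k) (a (pad \<eta> k)))"
      unfolding \<omega>_def
      by (rule suminf_finite) (auto simp: pad_def prehilbert_H ops_zero[OF prehilbert_H a])
    also have "\<dots> = (\<Sum>k\<in>{0..<card I}. ip H (\<xi> (h k)) (a (\<eta> (h k))))"
      by (intro sum.cong) (simp_all add: pad_def)
    also have "\<dots> = (\<Sum>i\<in>I. ip H (\<xi> i) (a (\<eta> i)))" by (rule sum.reindex_bij_betw[OF h])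
    finally show ?thesis .
  qed
  ultimately show ?thesis using that by blast
qed

lemma topspace_ultraweak: "topspace (ultraweak H) = ops H H"
proof -
  obtain \<omega> where "\<omega> \<in> normal_functionals H"
    using finite_normal_functional[of "{} :: nat set" undefined undefined] by auto
  then have "ops H H \<in> {{a \<in> ops H H. \<omega> a \<in> U} | \<omega> U. \<omega> \<in> normal_functionals H \<and> open U}"
    by (auto intro!: exI[of _ \<omega>] exI[of _ UNIV])
  then show ?thesis unfolding ultraweak_def by (auto simp del: topspace_def) 
qed

text \<open>Membership of one block in the finite-dimensional space \<open>R X Y\<close> is detected by finitely many matrix
  coefficients, which are normal functionals.\<close>

lemma rel_ops_closed:
  assumes R: "binary_relation \<X> \<X> R"
  shows "closedin (ultraweak H) (rel_ops R)"
  unfolding closedin_def topspace_ultraweak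
proof (intro conjI)
  show "rel_ops R \<subseteq> ops H H" by (auto simp: rel_ops_def)
  show "openin (ultraweak H) (ops H H - rel_ops R)"
  proof (subst openin_subopen, intro ballI)
    fix v assume v: "v \<in> ops H H - rel_ops R"
    then have vo: "v \<in> ops H H" by simp
    from v obtain X Y where X: "X \<in> \<X>" and Y: "Y \<in> \<X>" and nc: "block v X Y \<notin> R X Y" by (auto simp: rel_ops_def)
    have fd2: "fd_atoms [X, dual Y]" using fd X Y by simp
    note RXY = binary_relationD(1)[OF R, of X Y] binary_relationD(2)[OF R X Y]
    note S = op_form_image_subspace[OF fd[OF X] fd[OF Y] RXY]
    have "op_form Y (block v X Y) \<notin> op_form Y ` R X Y"
      using nc op_form_inj[OF fd[OF Y] block_in_ops[OF vo X Y]] RXY(2) by blast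
    then obtain k where k: "\<And>b. b \<in> op_form Y ` R X Y \<Longrightarrow> form_ip [X, dual Y] b k = 0"
      "form_ip [X, dual Y] k (op_form Y (block v X Y)) \<noteq> 0"
      using mem_subspace_by_orthogonality[OF form_space_fd[OF fd2], of "op_form Y ` R X Y" "op_form Y (block v X Y)"]
        S op_form_in_forms[OF fd[OF X] fd[OF Y] block_in_ops[OF vo X Y]] by auto
    have fY': "fd_atom (dual Y)" using fd[OF Y] by simp
    obtain \<omega> where \<omega>: "\<omega> \<in> normal_functionals H"
      "\<And>a. a \<in> ops H H \<Longrightarrow> \<omega> a = (\<Sum>p\<in>basis X \<times> basis (dual Y). ip H (inc Y (k [fst p, snd p] *C riesz_vec Y (snd p))) (a (inc X (fst p))))"
      using finite_normal_functional[of "basis X \<times> basis (dual Y)" "\<lambda>p. inc Y (k [fst p, snd p] *C riesz_vec Y (snd p))" "\<lambda>p. inc X (fst p)"]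
        finite_basis[OF fd[OF X]] finite_basis[OF fY'] inc_in_H[OF X] inc_in_H[OF Y] by blast
    then have \<omega>k: "\<omega> a = form_ip [X, dual Y] k (op_form Y (block a X Y))" if "a \<in> ops H H" for a
      using that form_ip_block[OF X Y that] by (simp add: case_prod_unfold)
    define T where "T = {a \<in> ops H H. \<omega> a \<in> - {0}}"
    have "openin (ultraweak H) T"
      unfolding ultraweak_def T_def using \<omega>(1) by (intro topology_generated_by_Basis) blast
    moreover have "v \<in> T" using vo k(2) \<omega>k by (simp add: T_def)
    moreover have "T \<subseteq> ops H H - rel_ops R"
    proof
      fix a assume a: "a \<in> T"
      then have ao: "a \<in> ops H H" and nz: "\<omega> a \<noteq> 0" by (auto simp: T_def)
      have "block a X Y \<notin> R X Y"
      proof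
        assume "block a X Y \<in> R X Y"
        then have "form_ip [X, dual Y] (op_form Y (block a X Y)) k = 0" by (intro k(1) imageI)
        then show False using nz \<omega>k[OF ao] form_ip_cnj[of "[X, dual Y]" k "op_form Y (block a X Y)"] by simp
      qed
      then show "a \<in> ops H H - rel_ops R" using ao X Y by (auto simp: rel_ops_def)
    qed
    ultimately show "\<exists>T. openin (ultraweak H) T \<and> v \<in> T \<and> T \<subseteq> ops H H - rel_ops R" by blast
  qed
qed

text \<open>The truncation \<open>p\<^sub>F v p\<^sub>F\<close>, where \<open>p\<^sub>F\<close> is the projection onto finitely many atoms.  As a sum of blocks it visibly
  belongs to a quantum preorder that contains the blocks of \<open>v\<close>.\<close>

definition cut :: "'v atom set \<Rightarrow> (('v atom \<Rightarrow> 'v vec) \<Rightarrow> ('v atom \<Rightarrow> 'v vec)) \<Rightarrow> ('v atom \<Rightarrow> 'v vec) \<Rightarrow> ('v atom \<Rightarrow> 'v vec)" where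
  "cut F v = (\<Sum>X\<in>F. \<Sum>Y\<in>F. emb X Y (block v X Y))"

lemma cut_in_ops:
  assumes "v \<in> ops H H" "F \<subseteq> \<X>" shows "cut F v \<in> ops H H"
  unfolding cut_def using assms
  by (intro cvec.subspace_sum[OF ops_subspace[OF prehilbert_H prehilbert_H]] emb_in_ops block_in_ops) auto

lemma ip_cut:
  assumes v: "v \<in> ops H H" and F: "finite F" "F \<subseteq> \<X>" and \<phi>: "\<phi> \<in> carrier H" and \<psi>: "\<psi> \<in> carrier H"
  shows "ip H \<phi> (cut F v \<psi>) = ip H (trunc F \<phi>) (v (trunc F \<psi>))"
proof -
  note p = prehilbert_H
  have c: "block v X Y (\<psi> X) \<in> carrier (hs Y)" if "X \<in> F" "Y \<in> F" for X Y
    using that F opsD(1)[OF block_in_ops[OF v] H_D(1)[OF \<psi>]] by blast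
  have inc_right: "ip H \<phi> (inc Y y) = ip (hs Y) (\<phi> Y) y" if "Y \<in> F" "y \<in> carrier (hs Y)" for Y y
  proof -
    have Y: "Y \<in> \<X>" using that F by blast
    have "ip H \<phi> (inc Y y) = cnj (ip H (inc Y y) \<phi>)" by (rule ip_cnj[OF p inc_in_H[OF Y] \<phi>])
    also have "\<dots> = cnj (ip (hs Y) y (\<phi> Y))" by (simp add: ip_inc Y that \<phi>)
    also have "\<dots> = ip (hs Y) (\<phi> Y) y" by (rule ip_cnj[OF ph[OF Y] that(2) H_D(1)[OF \<phi> Y], symmetric])
    finally show ?thesis .
  qed
  have t: "trunc F \<psi> \<in> carrier H" by (rule trunc_in_H[OF F(2)])
  have "cut F v \<psi> = (\<Sum>X\<in>F. \<Sum>Y\<in>F. inc Y (block v X Y (\<psi> X)))"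
    unfolding cut_def sum_fun_apply[where x = \<psi>] using F by (intro sum.cong refl) (auto simp: emb_apply \<psi>)
  then have "ip H \<phi> (cut F v \<psi>) = (\<Sum>X\<in>F. \<Sum>Y\<in>F. ip H \<phi> (inc Y (block v X Y (\<psi> X))))"
    using F by (simp add: ip_sum_right p \<phi> carrier_sum inc_in_H subset_iff)
  also have "\<dots> = (\<Sum>X\<in>F. \<Sum>Y\<in>F. ip (hs Y) (\<phi> Y) (block v X Y (\<psi> X)))"
    by (intro sum.cong refl) (simp add: inc_right c)
  also have "\<dots> = (\<Sum>Y\<in>F. \<Sum>X\<in>F. ip (hs Y) (\<phi> Y) (block v X Y (\<psi> X)))" by (rule sum.swap)
  also have "\<dots> = (\<Sum>Y\<in>F. ip (hs Y) (\<phi> Y) (v (trunc F \<psi>) Y))"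
  proof (intro sum.cong refl)
    fix Y assume Y: "Y \<in> F"
    then have "Y \<in> \<X>" using F by blast
    then show "(\<Sum>X\<in>F. ip (hs Y) (\<phi> Y) (block v X Y (\<psi> X))) = ip (hs Y) (\<phi> Y) (v (trunc F \<psi>) Y)"
      unfolding block_sum_trunc[OF v F \<psi>] using Y c by (intro ip_sum_right[symmetric] ph H_D(1)[OF \<phi>]) auto
  qed
  also have "\<dots> = ip H (trunc F \<phi>) (v (trunc F \<psi>))"
    by (rule ip_trunc[OF F \<phi> opsD(1)[OF v t], symmetric])
  finally show ?thesis .
qed

text \<open>Each term of a normal functional converges weakly, and it is dominated by a summable sequence that does not depend on
  the finite set of atoms; so the sum converges by Tannery's theorem.\<close>

lemma normal_cut_tendsto:
  assumes v: "v \<in> ops H H" and \<omega>: "\<omega> \<in> normal_functionals H"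
  shows "((\<lambda>F. \<omega> (cut F v)) \<longlongrightarrow> \<omega> v) (finite_subsets_at_top \<X>)"
proof -
  note p = prehilbert_H
  obtain \<xi> \<eta> where \<omega>_eq: "\<omega> = (\<lambda>a. \<Sum>k. ip H (\<xi> k) (a (\<eta> k)))"
    and r: "range \<xi> \<subseteq> carrier H" "range \<eta> \<subseteq> carrier H"
    and s: "summable (\<lambda>k::nat. (hnorm H (\<xi> k))\<^sup>2)" "summable (\<lambda>k. (hnorm H (\<eta> k))\<^sup>2)"
    using \<omega> unfolding normal_functionals_def by auto
  have \<xi>: "\<xi> k \<in> carrier H" and \<eta>: "\<eta> k \<in> carrier H" for k using r by auto
  obtain C where C: "C \<ge> 0" "\<And>x. x \<in> carrier H \<Longrightarrow> hnorm H (v x) \<le> C * hnorm H x"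
    using ops_bound[OF v p] by blast
  define A where "A k F = ip H (trunc F (\<xi> k)) (v (trunc F (\<eta> k)))" for k F
  define M where "M k = C * ((hnorm H (\<xi> k))\<^sup>2 + (hnorm H (\<eta> k))\<^sup>2)" for k
  have bound: "norm (A k F) \<le> M k" if F: "finite F" "F \<subseteq> \<X>" for k F
  proof -
    let ?a = "hnorm H (\<xi> k)" and ?b = "hnorm H (\<eta> k)"
    have t: "trunc F \<psi> \<in> carrier H" for \<psi> by (rule trunc_in_H[OF F(2)])
    have n: "0 \<le> ?a" "0 \<le> ?b" by (intro hnorm_nonneg p \<xi> \<eta>)+
    have "norm (A k F) \<le> hnorm H (trunc F (\<xi> k)) * hnorm H (v (trunc F (\<eta> k)))"
      unfolding A_def by (intro Cauchy_Schwarz p t opsD(1)[OF v])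
    also have "\<dots> \<le> ?a * (C * hnorm H (trunc F (\<eta> k)))"
      by (intro mult_mono hnorm_trunc_le F \<xi> C(2) t n hnorm_nonneg p opsD(1)[OF v])
    also have "\<dots> \<le> ?a * (C * ?b)"
      by (intro mult_left_mono hnorm_trunc_le F \<eta> C(1) n)
    also have "\<dots> = C * (?a * ?b)" by simp
    also have "\<dots> \<le> C * (?a\<^sup>2 + ?b\<^sup>2)"
    proof (rule mult_left_mono[OF _ C(1)])
      have "0 \<le> ?a * ?b" using n by simp
      then show "?a * ?b \<le> ?a\<^sup>2 + ?b\<^sup>2" using sum_squares_bound[of ?a ?b] by linarith
    qed
    finally show ?thesis by (simp add: M_def)
  qed
  have "((\<lambda>F. \<Sum>k. A k F) \<longlongrightarrow> (\<Sum>k. ip H (\<xi> k) (v (\<eta> k)))) (finite_subsets_at_top \<X>)"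
  proof (rule tannerys_theorem[THEN conjunct2, THEN conjunct2])
    show "((\<lambda>F. A k F) \<longlongrightarrow> ip H (\<xi> k) (v (\<eta> k))) (finite_subsets_at_top \<X>)" for k
      unfolding A_def by (intro ip_trunc_trunc_tendsto(1) v \<xi> \<eta>)
    have "\<forall>\<^sub>F F in finite_subsets_at_top \<X>. finite F \<and> F \<subseteq> \<X>"
      by (rule eventually_finite_subsets_at_top_weakI) simp
    then show "\<forall>\<^sub>F (k, F) in at_top \<times>\<^sub>F finite_subsets_at_top \<X>. norm (A k F) \<le> M k"
      unfolding eventually_prod_filter using bound
      by (intro exI[of _ "\<lambda>_. True"] exI[of _ "\<lambda>F. finite F \<and> F \<subseteq> \<X>"]) simp
    show "summable M" unfolding M_def by (intro summable_mult summable_add s)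
  qed simp
  moreover have "\<forall>\<^sub>F F in finite_subsets_at_top \<X>. (\<Sum>k. A k F) = \<omega> (cut F v)"
    by (rule eventually_finite_subsets_at_top_weakI) (simp add: \<omega>_eq A_def ip_cut[OF v _ _ \<xi> \<eta>])
  ultimately have "((\<lambda>F. \<omega> (cut F v)) \<longlongrightarrow> (\<Sum>k. ip H (\<xi> k) (v (\<eta> k)))) (finite_subsets_at_top \<X>)"
    by (rule Lim_transform_eventually)
  then show ?thesis by (simp add: \<omega>_eq)
qed

text \<open>It suffices to consider the generating open sets, for which this is the convergence of one normal functional.\<close>

lemma ultraweak_cut_eventually:
  assumes v: "v \<in> ops H H" and U: "openin (ultraweak H) U" "v \<in> U"
  shows "\<forall>\<^sub>F F in finite_subsets_at_top \<X>. cut F v \<in> U"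
proof -
  have "generate_topology_on {{a \<in> ops H H. \<omega> a \<in> U} | \<omega> U. \<omega> \<in> normal_functionals H \<and> open U} U"
    using U(1) unfolding ultraweak_def openin_topology_generated_by_iff .
  then show ?thesis using U(2)
  proof induction
    case (Int a b)
    then show ?case by (auto intro: eventually_conj)
  next
    case (UN K)
    then obtain k where "k \<in> K" "v \<in> k" by blast
    with UN have "\<forall>\<^sub>F F in finite_subsets_at_top \<X>. cut F v \<in> k" by blast
    then show ?case by (rule eventually_mono) (use \<open>k \<in> K\<close> in blast)
  next
    case (Basis s)
    then obtain \<omega> W where s: "s = {a \<in> ops H H. \<omega> a \<in> W}" "\<omega> \<in> normal_functionals H" "open W" by blast
    have "\<forall>\<^sub>F F in finite_subsets_at_top \<X>. \<omega> (cut F v) \<in> W"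
      using topological_tendstoD[OF normal_cut_tendsto[OF v s(2)] s(3)] Basis s(1) by simp
    moreover have "\<forall>\<^sub>F F in finite_subsets_at_top \<X>. cut F v \<in> ops H H"
      by (rule eventually_finite_subsets_at_top_weakI) (simp add: cut_in_ops v)
    ultimately show ?case unfolding s(1) by (auto intro: eventually_conj)
  qed simp
qed

section \<open>Quantum preorders and relations\<close>

lemma quantum_preorderD:
  assumes "quantum_preorder H (linfty \<X>) V"
  shows "V \<subseteq> ops H H" "cvec.subspace V" "v \<in> V \<Longrightarrow> w \<in> V \<Longrightarrow> v \<circ> w \<in> V" "closedin (ultraweak H) V" "rel_ops (id_rel \<X>) \<subseteq> V"
  using assms by (auto simp: quantum_preorder_def commutant_linfty)

lemma emb_id_in_preorder:
  assumes V: "quantum_preorder H (linfty \<X>) V" and X: "X \<in> \<X>"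
  shows "emb X X (id_op (hs X)) \<in> V"
proof -
  have "id_op (hs X) \<in> id_rel \<X> X X" using X by (simp add: id_rel_def cvec.span_base)
  then have "emb X X (id_op (hs X)) \<in> rel_ops (id_rel \<X>)"
    by (intro emb_in_rel_ops id_rel_subspace X id_op_in_ops ph)
  then show ?thesis using quantum_preorderD(5)[OF V] by blast
qed

text \<open>\<open>V\<close> contains the truncations of every operator whose blocks are blocks of \<open>V\<close>, because it is
  a bimodule over the commutant; it contains the operator itself because it is closed.\<close>

lemma preorder_eq_rel_ops:
  assumes V: "quantum_preorder H (linfty \<X>) V"
  shows "V = rel_ops (rel_of \<X> V)"
proof (intro equalityI subsetI)
  note D = quantum_preorderD[OF V]
  fix v assume "v \<in> V"
  then show "v \<in> rel_ops (rel_of \<X> V)" using D(1) rel_of_block[OF D(1)] by (auto simp: rel_ops_def)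
next
  note D = quantum_preorderD[OF V]
  fix v assume v: "v \<in> rel_ops (rel_of \<X> V)"
  then have vo: "v \<in> ops H H" by (simp add: rel_ops_def)
  have "emb X Y (block v X Y) \<in> V" if X: "X \<in> \<X>" and Y: "Y \<in> \<X>" for X Y
  proof -
    have "block v X Y \<in> rel_of \<X> V X Y" using v X Y by (simp add: rel_ops_def)
    then obtain w where w: "w \<in> V" "block v X Y = block w X Y" using rel_of_block[OF D(1) X Y] by auto
    have "emb Y Y (id_op (hs Y)) \<circ> w \<circ> emb X X (id_op (hs X)) \<in> V"
      by (intro D(3) emb_id_in_preorder[OF V] X Y w)
    then show ?thesis using emb_sandwich[OF X Y subsetD[OF D(1) w(1)]] w(2) by simp
  qed
  then have cut: "cut F v \<in> V" if "F \<subseteq> \<X>" for F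
    unfolding cut_def using that by (intro cvec.subspace_sum[OF D(2)]) auto
  show "v \<in> V"
  proof (rule ccontr)
    assume "v \<notin> V"
    moreover have "openin (ultraweak H) (ops H H - V)" using D(4) by (simp add: closedin_def topspace_ultraweak)
    ultimately have "\<forall>\<^sub>F F in finite_subsets_at_top \<X>. cut F v \<in> ops H H - V"
      using vo by (intro ultraweak_cut_eventually) auto
    moreover have "\<forall>\<^sub>F F in finite_subsets_at_top \<X>. cut F v \<in> V"
      by (rule eventually_finite_subsets_at_top_weakI) (simp add: cut)
    ultimately have "\<forall>\<^sub>F F in finite_subsets_at_top \<X>. False" by eventually_elim simp
    then show False by (simp add: eventually_False finite_subsets_at_top_neq_bot)
  qed
qed

lemma rel_of_rel_ops:
  assumes R: "binary_relation \<X> \<X> R"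
  shows "rel_of \<X> (rel_ops R) = R"
proof (intro ext)
  fix X Y
  show "rel_of \<X> (rel_ops R) X Y = R X Y"
  proof (cases "X \<in> \<X> \<and> Y \<in> \<X>")
    case True
    then have X: "X \<in> \<X>" and Y: "Y \<in> \<X>" by auto
    have "rel_of \<X> (rel_ops R) X Y = (\<lambda>v. block v X Y) ` rel_ops R"
      by (rule rel_of_block[OF _ X Y]) (auto simp: rel_ops_def)
    also have "\<dots> = R X Y"
    proof (intro equalityI subsetI)
      fix r assume r: "r \<in> R X Y"
      have ro: "r \<in> ops (hs X) (hs Y)" using r binary_relationD(2)[OF R X Y] by blast
      have "emb X Y r \<in> rel_ops R" by (intro emb_in_rel_ops binary_relationD(1)[OF R] X Y ro r)
      moreover have "block (emb X Y r) X Y = r" by (simp add: block_emb X Y ro)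
      ultimately show "r \<in> (\<lambda>v. block v X Y) ` rel_ops R" by force
    qed (use X Y in \<open>auto simp: rel_ops_def\<close>)
    finally show ?thesis .
  next
    case False
    then show ?thesis using binary_relationD(3)[OF R, of X Y] by (auto simp: rel_of_def)
  qed
qed

lemma rel_of_preorder:
  assumes V: "quantum_preorder H (linfty \<X>) V"
  shows "binary_relation \<X> \<X> (rel_of \<X> V)" and "X \<in> \<X> \<Longrightarrow> id_op (hs X) \<in> rel_of \<X> V X X"
    and "X \<in> \<X> \<Longrightarrow> Y \<in> \<X> \<Longrightarrow> Z \<in> \<X> \<Longrightarrow> r \<in> rel_of \<X> V X Y \<Longrightarrow> s \<in> rel_of \<X> V Y Z \<Longrightarrow> s \<circ> r \<in> rel_of \<X> V X Z"
proof -
  note D = quantum_preorderD[OF V]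
  note rc = rel_of_block[OF D(1)]
  show "binary_relation \<X> \<X> (rel_of \<X> V)"
    unfolding binary_relation_def
  proof (intro allI conjI)
    fix X Y
    show "rel_of \<X> V X Y \<subseteq> (if X \<in> \<X> \<and> Y \<in> \<X> then ops (hs X) (hs Y) else {0})"
      using rc[of X Y] block_in_ops[OF subsetD[OF D(1)]] by (auto simp: rel_of_def[of \<X> V X Y])
    show "cvec.subspace (rel_of \<X> V X Y)"
    proof (cases "X \<in> \<X> \<and> Y \<in> \<X>")
      case True
      have "cvec.subspace ((\<lambda>v. block v X Y) ` V)"
      proof (rule cvec.subspaceI)
        have "block 0 X Y = 0" by (auto simp: block_def fun_eq_iff)
        then show "0 \<in> (\<lambda>v. block v X Y) ` V" using imageI[OF cvec.subspace_0[OF D(2)], of "\<lambda>v. block v X Y"] by simp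
        fix a b assume "a \<in> (\<lambda>v. block v X Y) ` V" "b \<in> (\<lambda>v. block v X Y) ` V"
        then obtain v w where vw: "a = block v X Y" "b = block w X Y" "v \<in> V" "w \<in> V" by blast
        show "a + b \<in> (\<lambda>v. block v X Y) ` V"
          unfolding vw(1,2) block_linear(1)[symmetric] by (intro imageI cvec.subspace_add[OF D(2)] vw)
      next
        fix c a assume "a \<in> (\<lambda>v. block v X Y) ` V"
        then obtain v where v: "a = block v X Y" "v \<in> V" by blast
        show "c *C a \<in> (\<lambda>v. block v X Y) ` V"
          unfolding v(1) block_linear(2)[symmetric] by (intro imageI cvec.subspace_scale[OF D(2)] v)
      qed
      then show ?thesis using rc True by simp
    qed (auto simp: rel_of_def)
  qed
  show "id_op (hs X) \<in> rel_of \<X> V X X" if X: "X \<in> \<X>"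
    using emb_id_in_preorder[OF V X] block_emb[OF X X X id_op_in_ops[OF ph[OF X]], of X] rc[OF X X] by force
  show "s \<circ> r \<in> rel_of \<X> V X Z"
    if X: "X \<in> \<X>" and Y: "Y \<in> \<X>" and Z: "Z \<in> \<X>" and r: "r \<in> rel_of \<X> V X Y" and s: "s \<in> rel_of \<X> V Y Z"
  proof -
    obtain v w where v: "v \<in> V" "r = block v X Y" and w: "w \<in> V" "s = block w Y Z"
      using r s rc[OF X Y] rc[OF Y Z] by auto
    have "w \<circ> emb Y Y (id_op (hs Y)) \<circ> v \<in> V" by (intro D(3) emb_id_in_preorder[OF V] Y v w)
    moreover have "block (w \<circ> emb Y Y (id_op (hs Y)) \<circ> v) X Z = s \<circ> r"
      unfolding v(2) w(2) by (intro block_compose X Y subsetD[OF D(1)] v w)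
    ultimately show ?thesis unfolding rc[OF X Z] by force
  qed
qed

text \<open>A block of a product is an infinite sum of products of blocks.  The finite partial sums belong to \<open>R X Z\<close>, which is
  closed because it is finite-dimensional; the limit is taken in the functionals that vanish on \<open>R X Z\<close>.\<close>

lemma rel_ops_compose:
  assumes R: "binary_relation \<X> \<X> R"
    and trans: "\<And>X Y Z r s. X \<in> \<X> \<Longrightarrow> Y \<in> \<X> \<Longrightarrow> Z \<in> \<X> \<Longrightarrow> r \<in> R X Y \<Longrightarrow> s \<in> R Y Z \<Longrightarrow> s \<circ> r \<in> R X Z"
    and v: "v \<in> rel_ops R" and w: "w \<in> rel_ops R"
  shows "v \<circ> w \<in> rel_ops R"
proof -
  note p = prehilbert_H
  have vo: "v \<in> ops H H" and wo: "w \<in> ops H H" using v w by (auto simp: rel_ops_def)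
  have vw: "v \<circ> w \<in> ops H H" by (intro ops_comp[OF p p p] vo wo)
  have "block (v \<circ> w) X Z \<in> R X Z" if X: "X \<in> \<X>" and Z: "Z \<in> \<X>" for X Z
  proof -
    have fd2: "fd_atoms [X, dual Z]" using fd X Z by simp
    note RXZ = binary_relationD(1)[OF R, of X Z] binary_relationD(2)[OF R X Z]
    note S = op_form_image_subspace[OF fd[OF X] fd[OF Z] RXZ]
    have "op_form Z (block (v \<circ> w) X Z) \<in> op_form Z ` R X Z"
    proof (rule mem_subspace_by_orthogonality[OF form_space_fd[OF fd2] S(1)])
      fix k assume "k \<in> carrier (form_space [X, dual Z])" and
        k0: "\<And>b. b \<in> op_form Z ` R X Z \<Longrightarrow> ip (form_space [X, dual Z]) b k = 0"
      define c where "c F = (\<Sum>Y\<in>F. v \<circ> emb Y Y (id_op (hs Y)) \<circ> w)" for F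
      have cF: "c F \<in> ops H H" "block (c F) X Z \<in> R X Z" if F: "F \<subseteq> \<X>" for F
      proof -
        show "c F \<in> ops H H" unfolding c_def using F
          by (intro cvec.subspace_sum[OF ops_subspace[OF p p]] ops_comp[OF p p p] vo wo emb_in_ops id_op_in_ops ph) auto
        have "block v Y Z \<circ> block w X Y \<in> R X Z" if "Y \<in> F" for Y
          using that F v w X Z by (intro trans[of X Y Z]) (auto simp: rel_ops_def)
        then show "block (c F) X Z \<in> R X Z" unfolding c_def block_linear using F
          by (intro cvec.subspace_sum[OF RXZ(1)]) (auto simp: block_compose[OF wo vo X])
      qed
      let ?\<zeta> = "\<lambda>e f. inc Z (k [e, f] *C riesz_vec Z f)"
      have lim: "((\<lambda>F. \<Sum>(e, f)\<in>basis X \<times> basis (dual Z). ip H (?\<zeta> e f) (c F (inc X e))) \<longlongrightarrow>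
        (\<Sum>(e, f)\<in>basis X \<times> basis (dual Z). ip H (?\<zeta> e f) ((v \<circ> w) (inc X e)))) (finite_subsets_at_top \<X>)"
      proof (rule tendsto_sum, clarify)
        fix e1 e2 f1 f2
        define e where "e = (e1 :: 'v, e2 :: 'v \<Rightarrow> complex)"
        define f where "f = (f1 :: 'v, f2 :: 'v \<Rightarrow> complex)"
        have we: "w (inc X e) \<in> carrier H" by (rule opsD(1)[OF wo inc_in_H[OF X]])
        have "((\<lambda>F. ip H (?\<zeta> e f) (v (trunc F (w (inc X e))))) \<longlongrightarrow> ip H (?\<zeta> e f) (v (w (inc X e)))) (finite_subsets_at_top \<X>)"
          by (intro ip_trunc_trunc_tendsto(2) vo we inc_in_H Z)
        moreover have "\<forall>\<^sub>F F in finite_subsets_at_top \<X>. ip H (?\<zeta> e f) (v (trunc F (w (inc X e)))) = ip H (?\<zeta> e f) (c F (inc X e))"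
        proof (rule eventually_finite_subsets_at_top_weakI)
          fix F assume F: "finite F" "F \<subseteq> \<X>"
          have "c F (inc X e) = (\<Sum>Y\<in>F. v (inc Y (w (inc X e) Y)))"
            unfolding c_def sum_fun_apply[where x = "inc X e"]
          proof (intro sum.cong refl)
            fix Y assume "Y \<in> F"
            then have Y: "Y \<in> \<X>" using F by blast
            show "(v \<circ> emb Y Y (id_op (hs Y)) \<circ> w) (inc X e) = v (inc Y (w (inc X e) Y))"
              using H_D(1)[OF we Y] by (simp add: emb_apply[OF Y we] id_op_def)
          qed
          also have "\<dots> = v (trunc F (w (inc X e)))"
            unfolding trunc_def using F by (intro ops_sum[OF p vo, symmetric]) (auto simp: inc_in_H)
          finally show "ip H (?\<zeta> e f) (v (trunc F (w (inc X e)))) = ip H (?\<zeta> e f) (c F (inc X e))" by simp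
        qed
        ultimately show "((\<lambda>F. ip H (?\<zeta> (e1, e2) (f1, f2)) (c F (inc X (e1, e2)))) \<longlongrightarrow>
          ip H (?\<zeta> (e1, e2) (f1, f2)) ((v \<circ> w) (inc X (e1, e2)))) (finite_subsets_at_top \<X>)"
          unfolding e_def[symmetric] f_def[symmetric] o_apply by (rule Lim_transform_eventually)
      qed
      have "\<forall>\<^sub>F F in finite_subsets_at_top \<X>. (\<Sum>(e, f)\<in>basis X \<times> basis (dual Z). ip H (?\<zeta> e f) (c F (inc X e))) = 0"
      proof (rule eventually_finite_subsets_at_top_weakI)
        fix F assume F: "finite F" "F \<subseteq> \<X>"
        have "form_ip [X, dual Z] (op_form Z (block (c F) X Z)) k = 0" using k0 cF(2)[OF F(2)] by simp
        then show "(\<Sum>(e, f)\<in>basis X \<times> basis (dual Z). ip H (?\<zeta> e f) (c F (inc X e))) = 0"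
          unfolding form_ip_block[OF X Z cF(1)[OF F(2)], symmetric]
          using form_ip_cnj[of "[X, dual Z]" k "op_form Z (block (c F) X Z)"] by simp
      qed
      from Lim_transform_eventually[OF lim this]
      have "(\<Sum>(e, f)\<in>basis X \<times> basis (dual Z). ip H (?\<zeta> e f) ((v \<circ> w) (inc X e))) = 0"
        using tendsto_unique[OF finite_subsets_at_top_neq_bot _ tendsto_const] by blast
      then show "ip (form_space [X, dual Z]) k (op_form Z (block (v \<circ> w) X Z)) = 0"
        using form_ip_block[OF X Z vw, of k] by simp
    qed (use S op_form_in_forms[OF fd[OF X] fd[OF Z] block_in_ops[OF vw X Z]] in simp_all)
    then show ?thesis using op_form_inj[OF fd[OF Z] block_in_ops[OF vw X Z]] RXZ(2) by blast
  qed
  then show ?thesis using vw by (simp add: rel_ops_def)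
qed

lemma rel_ops_preorder:
  assumes R: "binary_relation \<X> \<X> R" and refl: "\<And>X. X \<in> \<X> \<Longrightarrow> id_op (hs X) \<in> R X X"
    and trans: "\<And>X Y Z r s. X \<in> \<X> \<Longrightarrow> Y \<in> \<X> \<Longrightarrow> Z \<in> \<X> \<Longrightarrow> r \<in> R X Y \<Longrightarrow> s \<in> R Y Z \<Longrightarrow> s \<circ> r \<in> R X Z"
  shows "quantum_preorder H (linfty \<X>) (rel_ops R)"
  unfolding quantum_preorder_def
proof (intro conjI ballI)
  show "rel_ops R \<subseteq> ops H H" by (auto simp: rel_ops_def)
  show "cvec.subspace (rel_ops R)" by (rule rel_ops_subspace[OF binary_relationD(1)[OF R]])
  show "closedin (ultraweak H) (rel_ops R)" by (rule rel_ops_closed[OF R])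
  show "v \<circ> w \<in> rel_ops R" if "v \<in> rel_ops R" "w \<in> rel_ops R" for v w
    by (rule rel_ops_compose[OF R trans that])
  have "id_rel \<X> X Y \<subseteq> R X Y" if "X \<in> \<X>" for X Y
  proof (cases "X = Y")
    case True
    have "cvec.span {id_op (hs X)} \<subseteq> R X X"
      using refl[OF that] by (intro cvec.span_minimal binary_relationD(1)[OF R]) simp
    then show ?thesis using True that by (simp add: id_rel_def)
  qed (simp add: id_rel_def cvec.subspace_0[OF binary_relationD(1)[OF R]])
  then show "commutant H (linfty \<X>) \<subseteq> rel_ops R" unfolding commutant_linfty rel_ops_def by blast
qed

lemma adj_id_rel:
  assumes X: "X \<in> \<X>" and Y: "Y \<in> \<X>" and r: "r \<in> id_rel \<X> Y X"
  shows "adj (hs Y) (hs X) r \<in> id_rel \<X> X Y"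
proof (cases "X = Y")
  case True
  then obtain c where c: "r = c *C id_op (hs X)" using r X by (auto simp: id_rel_def cvec.span_singleton)
  have "adj (hs X) (hs X) r = cnj c *C id_op (hs X)"
    using ph[OF X] unfolding c
    by (intro adj_eqI cvec.subspace_scale[OF ops_subspace] id_op_in_ops)
      (simp_all add: scaleC_fun_def id_op_def ip_scale_left ip_scale_right)
  then show ?thesis using True X by (auto simp: id_rel_def cvec.span_singleton)
next
  case False
  then have "r = 0" using r by (simp add: id_rel_def)
  have "adj (hs Y) (hs X) 0 = 0"
    using ph[OF X] ph[OF Y] by (intro adj_eqI cvec.subspace_0[OF ops_subspace]) simp_all
  then show ?thesis using \<open>r = 0\<close> cvec.subspace_0[OF id_rel_subspace] by simp
qed

text \<open>As \<open>V\<close> consists of the operators with blocks in \<open>R\<close>, and taking adjoints takes the adjoints of all blocks, both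
  \<open>V \<inter> V\<^sup>\<dagger>\<close> and the commutant are described by their blocks.  The commutant is always contained in \<open>V \<inter> V\<^sup>\<dagger>\<close>, since it
  is closed under adjoints.\<close>

lemma partial_order_iff:
  assumes V: "quantum_preorder H (linfty \<X>) V"
  shows "quantum_partial_order H (linfty \<X>) V \<longleftrightarrow>
    (\<forall>X\<in>\<X>. \<forall>Y\<in>\<X>. \<forall>s\<in>rel_of \<X> V Y X. adj (hs Y) (hs X) s \<in> rel_of \<X> V X Y \<longrightarrow> adj (hs Y) (hs X) s \<in> id_rel \<X> X Y)"
proof -
  let ?R = "rel_of \<X> V"
  note D = quantum_preorderD[OF V] and B = rel_of_preorder(1)[OF V]
  have VR: "v \<in> V \<longleftrightarrow> v \<in> ops H H \<and> (\<forall>X\<in>\<X>. \<forall>Y\<in>\<X>. block v X Y \<in> ?R X Y)" for v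
    using preorder_eq_rel_ops[OF V] by (auto simp: rel_ops_def)
  have sup: "rel_ops (id_rel \<X>) \<subseteq> V \<inter> adj H H ` V"
  proof
    fix m assume m: "m \<in> rel_ops (id_rel \<X>)"
    then have mo: "m \<in> ops H H" by (simp add: rel_ops_def)
    have "adj H H m \<in> rel_ops (id_rel \<X>)"
      using m adj_H(1)[OF mo] block_adj[OF mo] adj_id_rel by (simp add: rel_ops_def)
    then have "adj H H m \<in> V" using D(5) by blast
    then have "m \<in> adj H H ` V" using adj_adj_H[OF mo] by (metis imageI)
    then show "m \<in> V \<inter> adj H H ` V" using m D(5) by blast
  qed
  have "V \<inter> adj H H ` V \<subseteq> rel_ops (id_rel \<X>) \<longleftrightarrow>
    (\<forall>X\<in>\<X>. \<forall>Y\<in>\<X>. \<forall>s\<in>?R Y X. adj (hs Y) (hs X) s \<in> ?R X Y \<longrightarrow> adj (hs Y) (hs X) s \<in> id_rel \<X> X Y)"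
  proof (intro iffI ballI impI subsetI)
    fix X Y s assume le: "V \<inter> adj H H ` V \<subseteq> rel_ops (id_rel \<X>)" and X: "X \<in> \<X>" and Y: "Y \<in> \<X>"
      and s: "s \<in> ?R Y X" and as: "adj (hs Y) (hs X) s \<in> ?R X Y"
    have so: "s \<in> ops (hs Y) (hs X)" using s binary_relationD(2)[OF B Y X] by blast
    define v where "v = emb Y X s"
    have v: "v \<in> V" unfolding v_def
      by (subst preorder_eq_rel_ops[OF V]) (intro emb_in_rel_ops binary_relationD(1)[OF B] Y X so s)
    have vo: "v \<in> ops H H" using v D(1) by blast
    have "block (adj H H v) X' Y' \<in> ?R X' Y'" if X': "X' \<in> \<X>" and Y': "Y' \<in> \<X>" for X' Y'
    proof (cases "Y' = Y \<and> X' = X")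
      case True
      then show ?thesis using as block_adj[OF vo X' Y'] block_emb[OF Y X Y so, of X] by (simp add: v_def)
    next
      case False
      then have "block v Y' X' = 0" unfolding v_def block_emb[OF Y X Y' so] by auto
      moreover have "adj (hs Y') (hs X') 0 = 0"
        using ph[OF X'] ph[OF Y'] by (intro adj_eqI cvec.subspace_0[OF ops_subspace]) simp_all
      ultimately show ?thesis using block_adj[OF vo X' Y'] cvec.subspace_0[OF binary_relationD(1)[OF B]] by simp
    qed
    then have "adj H H v \<in> V" using adj_H(1)[OF vo] by (simp add: VR)
    then have "adj H H v \<in> rel_ops (id_rel \<X>)" using le v by blast
    then have "block (adj H H v) X Y \<in> id_rel \<X> X Y" using X Y by (simp add: rel_ops_def)
    then show "adj (hs Y) (hs X) s \<in> id_rel \<X> X Y"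
      using block_adj[OF vo X Y] block_emb[OF Y X Y so, of X] by (simp add: v_def)
  next
    fix w assume anti: "\<forall>X\<in>\<X>. \<forall>Y\<in>\<X>. \<forall>s\<in>?R Y X. adj (hs Y) (hs X) s \<in> ?R X Y \<longrightarrow> adj (hs Y) (hs X) s \<in> id_rel \<X> X Y"
      and w: "w \<in> V \<inter> adj H H ` V"
    then obtain v where v: "v \<in> V" "w = adj H H v" by blast
    have vo: "v \<in> ops H H" using v D(1) by blast
    have "block w X Y \<in> id_rel \<X> X Y" if X: "X \<in> \<X>" and Y: "Y \<in> \<X>" for X Y
    proof -
      have "block v Y X \<in> ?R Y X" using v(1) X Y by (simp add: VR)
      moreover have "block w X Y \<in> ?R X Y" using w X Y by (simp add: VR)
      moreover have "block w X Y = adj (hs Y) (hs X) (block v Y X)" using block_adj[OF vo X Y] v(2) by simp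
      ultimately show ?thesis using anti X Y by metis
    qed
    then show "w \<in> rel_ops (id_rel \<X>)" using w D(1) by (auto simp: rel_ops_def)
  qed
  then show ?thesis
    using V sup unfolding quantum_partial_order_def commutant_linfty by blast
qed

lemma bij_betw_preorders:
  "bij_betw (rel_of \<X>) {V. quantum_preorder H (linfty \<X>) V}
    {R. binary_relation \<X> \<X> R \<and> (\<forall>X\<in>\<X>. id_op (hs X) \<in> R X X) \<and>
        (\<forall>X\<in>\<X>. \<forall>Y\<in>\<X>. \<forall>Z\<in>\<X>. \<forall>r\<in>R X Y. \<forall>s\<in>R Y Z. s \<circ> r \<in> R X Z)}"
proof (rule bij_betw_byWitness[of _ rel_ops])
  show "\<forall>V\<in>{V. quantum_preorder H (linfty \<X>) V}. rel_ops (rel_of \<X> V) = V"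
    using preorder_eq_rel_ops by auto
qed (auto simp: rel_of_rel_ops intro: rel_of_preorder rel_ops_preorder)

end

theorem corollary4p3p2:
  fixes \<X> :: "'v::cvector qset"
    and x\<^sub>1 x\<^sub>2 x\<^sub>3 y\<^sub>1 y\<^sub>2 y\<^sub>3 :: "'v var"
  assumes "quantum_set \<X>"
    and "sort_of x\<^sub>1 = \<X>" "sort_of x\<^sub>2 = \<X>" "sort_of x\<^sub>3 = \<X>"
    and "sort_of y\<^sub>1 = dual_qset \<X>" "sort_of y\<^sub>2 = dual_qset \<X>" "sort_of y\<^sub>3 = dual_qset \<X>"
    and "distinct [x\<^sub>1, x\<^sub>2, x\<^sub>3, y\<^sub>1, y\<^sub>2, y\<^sub>3]"
  shows
    "bij_betw (rel_of \<X>)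
       {V. quantum_preorder (l2sum \<X>) (linfty \<X>) V}
       {R. binary_relation \<X> \<X> R \<and>
           holds (ForallEq x\<^sub>1 y\<^sub>1 (Rel (hat \<X> R) [x\<^sub>1, y\<^sub>1])) \<and>
           holds (ForallEq x\<^sub>1 y\<^sub>1 (ForallEq x\<^sub>2 y\<^sub>2 (ForallEq x\<^sub>3 y\<^sub>3
             (Imp (Conj (Rel (hat \<X> R) [x\<^sub>1, y\<^sub>2]) (Rel (hat \<X> R) [x\<^sub>2, y\<^sub>3]))
                  (Rel (conj_rel (hat \<X> R)) [y\<^sub>1, x\<^sub>3])))))} \<and>
     bij_betw (rel_of \<X>)
       {V. quantum_partial_order (l2sum \<X>) (linfty \<X>) V}
       {R. binary_relation \<X> \<X> R \<and>
           holds (ForallEq x\<^sub>1 y\<^sub>1 (Rel (hat \<X> R) [x\<^sub>1, y\<^sub>1])) \<and>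
           holds (ForallEq x\<^sub>1 y\<^sub>1 (ForallEq x\<^sub>2 y\<^sub>2 (ForallEq x\<^sub>3 y\<^sub>3
             (Imp (Conj (Rel (hat \<X> R) [x\<^sub>1, y\<^sub>2]) (Rel (hat \<X> R) [x\<^sub>2, y\<^sub>3]))
                  (Rel (conj_rel (hat \<X> R)) [y\<^sub>1, x\<^sub>3]))))) \<and>
           holds (Forall x\<^sub>1 (Forall y\<^sub>2
             (Imp (Conj (Rel (hat \<X> R) [x\<^sub>1, y\<^sub>2]) (Rel (conj_rel (hat \<X> R)) [y\<^sub>2, x\<^sub>1]))
                  (Rel (eq_rel \<X>) [x\<^sub>1, y\<^sub>2]))))}"
    (is "bij_betw _ ?P {R. binary_relation \<X> \<X> R \<and> ?refl R \<and> ?trans R} \<and>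
         bij_betw _ ?Q {R. binary_relation \<X> \<X> R \<and> ?refl R \<and> ?trans R \<and> ?anti R}")
proof -
  interpret qset \<X> using assms(1) by unfold_locales
  have neq: "x\<^sub>1 \<noteq> y\<^sub>1" "x\<^sub>1 \<noteq> y\<^sub>2" using assms(8) by auto
  let ?B = "{R. binary_relation \<X> \<X> R \<and> ?refl R \<and> ?trans R}"
  have "?B = {R. binary_relation \<X> \<X> R \<and> (\<forall>X\<in>\<X>. id_op (hs X) \<in> R X X) \<and>
        (\<forall>X\<in>\<X>. \<forall>Y\<in>\<X>. \<forall>Z\<in>\<X>. \<forall>r\<in>R X Y. \<forall>s\<in>R Y Z. s \<circ> r \<in> R X Z)}"
    using reflexivity_iff[OF assms(1,2,5) neq(1)] transitivity_iff[OF assms(1-8)] by blast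
  then have pre: "bij_betw (rel_of \<X>) ?P ?B" using bij_betw_preorders by simp
  have anti: "V \<in> ?Q \<longleftrightarrow> ?anti (rel_of \<X> V)" if "V \<in> ?P" for V
    using partial_order_iff[of V] antisymmetry_iff[OF assms(1,2,6) neq(2) rel_of_preorder(1)] that by simp
  have QP: "?Q \<subseteq> ?P" by (auto simp: quantum_partial_order_def)
  have "rel_of \<X> ` ?Q = {R \<in> ?B. ?anti R}"
  proof (intro equalityI subsetI)
    fix R assume "R \<in> rel_of \<X> ` ?Q"
    then obtain V where V: "V \<in> ?Q" "R = rel_of \<X> V" by blast
    then show "R \<in> {R \<in> ?B. ?anti R}" using anti[of V] QP bij_betwE[OF pre] by blast
  next
    fix R assume R: "R \<in> {R \<in> ?B. ?anti R}"
    then obtain V where "V \<in> ?P" "R = rel_of \<X> V" using bij_betw_imp_surj_on[OF pre] by blast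
    then show "R \<in> rel_of \<X> ` ?Q" using anti[of V] R by blast
  qed
  then have "bij_betw (rel_of \<X>) ?Q {R \<in> ?B. ?anti R}" by (rule bij_betw_subset[OF pre QP])
  moreover have "{R \<in> ?B. ?anti R} = {R. binary_relation \<X> \<X> R \<and> ?refl R \<and> ?trans R \<and> ?anti R}" by blast
  ultimately show ?thesis using pre by simp
qed

end
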